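(* Let $d\ge 2$ be an integer and let $p$ be an odd prime such that $p\nmid d(d-1)$. Let $\lambda\in\mathbb{F}_p$ with $\lambda\neq 0$. Then the number $N_{\mathbb{F}_p}(Z_\lambda)$ of $\mathbb{F}_p$-points on the $0$-dimensional variety $Z_\lambda: x_1^d+x_2^d=d\lambda x_1x_2^{d-1}$ in $\mathbb{P}^1$ is given by $$N_{\mathbb{F}_p}(Z_{\lambda})=1+{_{d-1}G}_{d-1}\left[\begin{array}{cccc}\frac{1}{d}, & \frac{2}{d}, & \ldots, & \frac{d-1}{d}\\ 0, & \frac{1}{d-1}, & \ldots, & \frac{d-2}{d-1}\end{array}\Big|\ \lambda^d(d-1)^{d-1}\right].$$
   Context: $N_{\mathbb{F}_p}(Z_\lambda)$ is the number of points $[x_1:x_2]\in\mathbb{P}^1(\mathbb{F}_p)$ satisfying $x_1^d+x_2^d=d\lambda x_1x_2^{d-1}$. McCarthy's $p$-adic hypergeometric series: $\Gamma_p:\mathbb{Z}_p\to\mathbb{Z}_p^\times$ is the $p$-adic gamma function, i.e. the unique continuous function with $\Gamma_p(0)=1$ and $\Gamma_p(n)=(-1)^n\prod_{0<j<n,\,p\nmid j}j$ for positive integers $n$. $\omega:\mathbb{F}_p^\times\to\mathbb{Z}_p^\times$ is the Teichmüller character ($\omega(a)$ is the $(p-1)$-th root of unity with $\omega(a)\equiv a \pmod p$) and $\overline{\omega}$ its inverse; all characters, including the trivial one $\overline\omega^0$, are extended to $\mathbb{F}_p$ by the value $0$ at $0$. $\lfloor x\rfloor$ is the floor and $\langle x\rangle=x-\lfloor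 x\rfloor$ the fractional part of $x\in\mathbb{Q}$. For an odd prime $p$, $t\in\mathbb{F}_p$, $n\ge 1$ and $a_i,b_i\in\mathbb{Q}\cap\mathbb{Z}_p$ ($1\le i\le n$), $${_nG}_n\left[\begin{array}{cccc}a_1,&a_2,&\ldots,&a_n\\ b_1,&b_2,&\ldots,&b_n\end{array}\Big|\ t\right]:=\frac{-1}{p-1}\sum_{j=0}^{p-2}(-1)^{jn}\,\overline{\omega}^j(t)\prod_{i=1}^n(-p)^{-\lfloor\langle a_i\rangle-\frac{j}{p-1}\rfloor-\lfloor\langle -b_i\rangle+\frac{j}{p-1}\rfloor}\frac{\Gamma_p(\langle a_i-\frac{j}{p-1}\rangle)}{\Gamma_p(\langle a_i\rangle)}\frac{\Gamma_p(\langle -b_i+\frac{j}{p-1}\rangle)}{\Gamma_p(\langle -b_i\rangle)}.$$ Integers and rational numbers with denominator prime to $p$ appearing as the argument $t$ are reduced modulo $p$. *)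

theory Defs
  imports
    Complex_Main
    "HOL-Computational_Algebra.Fraction_Field"
    "HOL-Computational_Algebra.Polynomial_Factorial"
    "Berlekamp_Zassenhaus.Finite_Field"
begin

text \<open>
  As with \<^typ>\<open>'p mod_ring\<close>, which is the field with p elements, the prime is carried by a type:
  p is \<open>CARD('p)\<close> with \<open>'p\<close> of class \<open>prime_card\<close>.
\<close>

text \<open>
  The inverse limit of the rings \<open>\<int>/p^n\<close>: a p-adic integer is the coherent sequence of its residues,
  the n-th one lying in \<open>{0..<p^n}\<close>.
\<close>

typedef (overloaded) ('p::prime_card) padic_int =
  "{x :: nat \<Rightarrow> int. \<forall>n. 0 \<le> x n \<and> x n < int CARD('p) ^ n \<and> x (Suc n) mod int CARD('p) ^ n = x n}"
  morphisms padic_res Abs_padic_int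
  by (rule exI[of _ "\<lambda>_. 0"]) simp

setup_lifting type_definition_padic_int

lemma padic_coherent:
  assumes "x mod (P::int) ^ Suc n = y"
  shows "y mod P ^ n = x mod P ^ n"
  using assms by (metis mod_mod_cancel le_imp_power_dvd lessI less_imp_le)

lemma padic_closed:
  assumes "x' mod (P::int) ^ n = x"
  shows "(- x') mod P ^ Suc n mod P ^ n = (- x) mod P ^ n"
    and "y' mod P ^ n = y \<Longrightarrow> (x' + y') mod P ^ Suc n mod P ^ n = (x + y) mod P ^ n"
    and "y' mod P ^ n = y \<Longrightarrow> (x' - y') mod P ^ Suc n mod P ^ n = (x - y) mod P ^ n"
    and "y' mod P ^ n = y \<Longrightarrow> (x' * y') mod P ^ Suc n mod P ^ n = (x * y) mod P ^ n"
  unfolding padic_coherent[OF refl] using assms by (auto simp: mod_simps)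

instantiation padic_int :: (prime_card) comm_ring_1
begin

lift_definition zero_padic_int :: "'a padic_int" is "\<lambda>_. 0"
  by simp

lift_definition one_padic_int :: "'a padic_int" is "\<lambda>n. 1 mod int CARD('a) ^ n"
  by (auto simp: padic_coherent)

lift_definition plus_padic_int :: "'a padic_int \<Rightarrow> 'a padic_int \<Rightarrow> 'a padic_int"
  is "\<lambda>x y n. (x n + y n) mod int CARD('a) ^ n"
  by (intro conjI padic_closed) simp_all

lift_definition minus_padic_int :: "'a padic_int \<Rightarrow> 'a padic_int \<Rightarrow> 'a padic_int"
  is "\<lambda>x y n. (x n - y n) mod int CARD('a) ^ n"
  by (intro conjI padic_closed) simp_all

lift_definition uminus_padic_int :: "'a padic_int \<Rightarrow> 'a padic_int"
  is "\<lambda>x n. (- x n) mod int CARD('a) ^ n"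
  by (intro conjI padic_closed) simp_all

lift_definition times_padic_int :: "'a padic_int \<Rightarrow> 'a padic_int \<Rightarrow> 'a padic_int"
  is "\<lambda>x y n. (x n * y n) mod int CARD('a) ^ n"
  by (intro conjI padic_closed) simp_all

instance
proof
  fix a b c :: "'a padic_int"
  show "a * b * c = a * (b * c)"
    by transfer (auto simp: mod_simps mult.assoc)
  show "a * b = b * a"
    by transfer (simp add: mult.commute)
  show "1 * a = a"
    by transfer (auto simp: mod_simps)
  show "a + b + c = a + (b + c)"
    by transfer (auto simp: mod_simps add.assoc)
  show "a + b = b + a"
    by transfer (simp add: add.commute)
  show "0 + a = a"
    by transfer auto
  show "- a + a = 0"
    by transfer (auto simp: mod_simps)
  show "a - b = a + - b"
    by transfer (auto simp: mod_simps)
  show "(a + b) * c = a * c + b * c"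
    by transfer (auto simp: mod_simps distrib_right)
  have "1 < int CARD('a)"
    using prime_gt_1_nat[OF prime_card] by simp
  then have "(\<lambda>n. 0) 1 \<noteq> 1 mod int CARD('a) ^ 1"
    by simp
  then show "(0::'a padic_int) \<noteq> 1"
    by transfer metis
qed

end

lemma padic_res_bounds [simp]:
  "0 \<le> padic_res (x :: 'p::prime_card padic_int) n"
  "padic_res (x :: 'p padic_int) n < int CARD('p) ^ n"
  using padic_res[of x] by auto

lemma padic_res_mod:
  assumes "m \<le> n"
  shows "padic_res (x :: 'p::prime_card padic_int) n mod int CARD('p) ^ m = padic_res x m"
  using assms
proof (induction rule: dec_induct)
  case base
  then show ?case by simp
next
  case (step n)
  have "padic_res x n = padic_res x (Suc n) mod int CARD('p) ^ n"
    using padic_res[of x] by auto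
  then show ?case
    using step by (metis mod_mod_cancel le_imp_power_dvd)
qed

lemma padic_res_eq_iff: "x = y \<longleftrightarrow> (\<forall>n. padic_res x n = padic_res y n)"
  by transfer auto

lemma padic_res_of_nat: "padic_res (of_nat k :: 'p::prime_card padic_int) n = int k mod int CARD('p) ^ n"
  by (induction k) (simp_all add: zero_padic_int.rep_eq plus_padic_int.rep_eq
      one_padic_int.rep_eq mod_simps add.commute)

lemma padic_res_of_int: "padic_res (of_int k :: 'p::prime_card padic_int) n = k mod int CARD('p) ^ n"
  by (cases k rule: int_cases2) (simp_all add: padic_res_of_nat uminus_padic_int.rep_eq mod_simps)

instance padic_int :: (prime_card) idom
proof
  fix a b :: "'a padic_int"
  let ?P = "int CARD('a)"
  assume "a \<noteq> 0" "b \<noteq> 0"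
  then obtain m n where m: "padic_res a m \<noteq> 0" and n: "padic_res b n \<noteq> 0"
    by (auto simp: padic_res_eq_iff zero_padic_int.rep_eq)
  have P: "prime ?P"
    using prime_card by simp
  have na: "\<not> ?P ^ m dvd padic_res a (m + n)"
    using m padic_res_mod[of m "m + n" a] by (simp add: dvd_eq_mod_eq_0)
  have nb: "\<not> ?P ^ n dvd padic_res b (m + n)"
    using n padic_res_mod[of n "m + n" b] by (simp add: dvd_eq_mod_eq_0)
  have nz: "padic_res a (m + n) \<noteq> 0" "padic_res b (m + n) \<noteq> 0"
    using na nb by auto
  have ma: "multiplicity ?P (padic_res a (m + n)) < m"
    using na by (metis multiplicity_dvd' not_le)
  have mb: "multiplicity ?P (padic_res b (m + n)) < n"
    using nb by (metis multiplicity_dvd' not_le)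
  have "multiplicity ?P (padic_res a (m + n) * padic_res b (m + n)) < m + n"
    using ma mb nz P by (subst prime_elem_multiplicity_mult_distrib) auto
  then have "\<not> ?P ^ (m + n) dvd padic_res a (m + n) * padic_res b (m + n)"
    using nz P by (subst power_dvd_iff_le_multiplicity) auto
  then have "padic_res (a * b) (m + n) \<noteq> 0"
    by (simp add: times_padic_int.rep_eq dvd_eq_mod_eq_0)
  then show "a * b \<noteq> 0"
    by (auto simp: zero_padic_int.rep_eq)
qed

instance padic_int :: (prime_card) ring_char_0
proof
  show "inj (of_nat :: nat \<Rightarrow> 'a padic_int)"
  proof (rule injI)
    fix k l :: nat
    assume "of_nat k = (of_nat l :: 'a padic_int)"
    moreover define n where "n = max k l"
    ultimately have "int k mod int CARD('a) ^ n = int l mod int CARD('a) ^ n"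
      by (metis padic_res_of_nat)
    moreover have "n < CARD('a) ^ n"
      using prime_gt_1_nat[OF prime_card[where 'a = 'a]] by (intro power_gt_expt) auto
    then have "int k < int CARD('a) ^ n" "int l < int CARD('a) ^ n"
      unfolding n_def by (metis max.strict_boundedE of_nat_less_iff of_nat_power)+
    ultimately show "k = l"
      by simp
  qed
qed

text \<open>
  The p-adic metric: if \<open>n\<close> is the p-adic valuation of \<open>x - y\<close>, then \<open>n + 1\<close> is the least index at
  which the residues of \<open>x\<close> and \<open>y\<close> differ (those at index 0 always agree).
\<close>

instantiation padic_int :: (prime_card) metric_space
begin

definition dist_padic_int :: "'a padic_int \<Rightarrow> 'a padic_int \<Rightarrow> real" where
  "dist x y = (if x = y then 0
     else (1 / real CARD('a)) ^ (LEAST n. padic_res x (Suc n) \<noteq> padic_res y (Suc n)))"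

definition uniformity_padic_int :: "('a padic_int \<times> 'a padic_int) filter" where
  "uniformity_padic_int = (INF e\<in>{0<..}. principal {(x, y). dist x y < e})"

definition open_padic_int :: "'a padic_int set \<Rightarrow> bool" where
  "open_padic_int U \<longleftrightarrow> (\<forall>x\<in>U. eventually (\<lambda>(x', y). x' = x \<longrightarrow> y \<in> U) uniformity)"

instance
proof
  fix x y z :: "'a padic_int"
  let ?q = "1 / real CARD('a)"
  let ?L = "\<lambda>x y :: 'a padic_int. LEAST n. padic_res x (Suc n) \<noteq> padic_res y (Suc n)"
  have q: "0 < ?q" "?q \<le> 1"
    using prime_gt_1_nat[OF prime_card[where 'a = 'a]] by auto
  show "dist x y = 0 \<longleftrightarrow> x = y"
    using q by (simp add: dist_padic_int_def)
  have differ: "\<exists>n. padic_res x (Suc n) \<noteq> padic_res y (Suc n)" if xy: "x \<noteq> y" for x y :: "'a padic_int"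
  proof -
    obtain m where m: "padic_res x m \<noteq> padic_res y m"
      using xy by (auto simp: padic_res_eq_iff)
    show ?thesis
      by (rule exI[of _ m]) (metis m padic_res_mod le_SucI order_refl)
  qed
  show "dist x y \<le> dist x z + dist y z"
  proof (cases "x = y \<or> x = z \<or> y = z")
    case True
    moreover have "0 \<le> dist u v" "dist u u = 0" for u v :: "'a padic_int"
      by (simp_all add: dist_padic_int_def)
    moreover have "dist u v = dist v u" for u v :: "'a padic_int"
    proof -
      have "(\<lambda>n. padic_res u (Suc n) \<noteq> padic_res v (Suc n)) =
          (\<lambda>n. padic_res v (Suc n) \<noteq> padic_res u (Suc n))"
        by auto
      then show ?thesis
        unfolding dist_padic_int_def by (simp only: eq_commute[of u v])
    qed
    ultimately show ?thesis
      by (metis add.left_neutral add.right_neutral order_refl add_nonneg_nonneg)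
  next
    case False
    then have "padic_res x (Suc (?L x y)) \<noteq> padic_res y (Suc (?L x y))"
      using LeastI_ex[OF differ[of x y]] by simp
    then consider "padic_res x (Suc (?L x y)) \<noteq> padic_res z (Suc (?L x y))"
      | "padic_res y (Suc (?L x y)) \<noteq> padic_res z (Suc (?L x y))"
      by metis
    then have "?L x z \<le> ?L x y \<or> ?L y z \<le> ?L x y"
      by cases (simp_all add: Least_le)
    then have "?q ^ ?L x y \<le> ?q ^ ?L x z \<or> ?q ^ ?L x y \<le> ?q ^ ?L y z"
      using q power_decreasing[of "?L x z" "?L x y" ?q] power_decreasing[of "?L y z" "?L x y" ?q]
      by linarith
    moreover have "0 \<le> ?q ^ ?L x z" "0 \<le> ?q ^ ?L y z"
      using q by simp_all
    ultimately show ?thesis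
      using False unfolding dist_padic_int_def by (simp only: if_False de_Morgan_disj) linarith
  qed
qed (rule uniformity_padic_int_def open_padic_int_def)+

end

type_synonym 'p padic = "'p padic_int fract"

lemma of_nat_fract: "of_nat n = to_fract (of_nat n)"
  by (induction n) (simp_all add: to_fract_def Zero_fract_def One_fract_def)

instance fract :: ("{idom, ring_char_0}") field_char_0
  by standard (simp add: inj_on_def of_nat_fract)

text \<open>The p-adic integer equal to the rational number \<open>q\<close>, whose denominator has to be prime to p.\<close>

definition padic_int_of_rat :: "rat \<Rightarrow> 'p::prime_card padic_int" where
  "padic_int_of_rat q = (THE x. to_fract x = of_rat q)"

definition padic_Gamma :: "'p::prime_card padic_int \<Rightarrow> 'p padic_int" where
  "padic_Gamma = (THE f. continuous_on UNIV f \<and> (\<forall>x. f x dvd 1) \<and> f 0 = 1 \<and>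
     (\<forall>n::nat. n > 0 \<longrightarrow>
        f (of_nat n) = (- 1) ^ n * (\<Prod>j | 0 < j \<and> j < n \<and> \<not> CARD('p) dvd j. of_nat j)))"

definition padic_Gamma_rat :: "rat \<Rightarrow> 'p::prime_card padic" where
  "padic_Gamma_rat q = to_fract (padic_Gamma (padic_int_of_rat q))"

definition padic_reduce :: "'p::prime_card padic_int \<Rightarrow> 'p mod_ring" where
  "padic_reduce x = of_int (padic_res x 1)"

definition teichmuller :: "'p::prime_card mod_ring \<Rightarrow> 'p padic_int" where
  "teichmuller a = (THE x. x ^ (CARD('p) - 1) = 1 \<and> padic_reduce x = a)"

text \<open>The j-th power of the inverse character; it vanishes at 0 even for \<open>j = 0\<close>.\<close>

definition teichmuller_inv_power :: "nat \<Rightarrow> 'p::prime_card mod_ring \<Rightarrow> 'p padic" where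
  "teichmuller_inv_power j t = (if t = 0 then 0 else inverse (to_fract (teichmuller t)) ^ j)"

text \<open>McCarthy's series; only the values \<open>a 1, \<dots>, a n\<close> and \<open>b 1, \<dots>, b n\<close> are used.\<close>

definition mccarthy_G ::
  "nat \<Rightarrow> (nat \<Rightarrow> rat) \<Rightarrow> (nat \<Rightarrow> rat) \<Rightarrow> 'p::prime_card mod_ring \<Rightarrow> 'p padic" where
  "mccarthy_G n a b t =
     (- 1) / (of_nat CARD('p) - 1) *
     (\<Sum>j = 0..CARD('p) - 2.
        (let r = of_nat j / (of_nat CARD('p) - 1) in
         (- 1) ^ (j * n) * teichmuller_inv_power j t *
         (\<Prod>i = 1..n.
            (- of_nat CARD('p)) powi (- \<lfloor>frac (a i) - r\<rfloor> - \<lfloor>frac (- b i) + r\<rfloor>) *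
            (padic_Gamma_rat (frac (a i - r)) / padic_Gamma_rat (frac (a i))) *
            (padic_Gamma_rat (frac (- b i + r)) / padic_Gamma_rat (frac (- b i))))))"

definition proj_line :: "('k::field \<times> 'k) set set" where
  "proj_line = (UNIV - {(0, 0)}) //
     {((x1, x2), (y1, y2)). (x1, x2) \<noteq> (0, 0) \<and> (\<exists>c. c \<noteq> 0 \<and> y1 = c * x1 \<and> y2 = c * x2)}"

text \<open>
  Since the equation is homogeneous, it holds for all representatives of a point as soon as it
  holds for one.
\<close>

definition Z_points :: "nat \<Rightarrow> 'k::field \<Rightarrow> ('k \<times> 'k) set set" where
  "Z_points d l = {P \<in> proj_line. \<forall>(x1, x2) \<in> P. x1 ^ d + x2 ^ d = of_nat d * l * x1 * x2 ^ (d - 1)}"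

lemma padic_reduce_one: "padic_reduce (1 :: 'p::prime_card padic_int) = 1"
  using prime_gt_1_nat[OF prime_card[where 'a = 'p]]
  by (simp add: padic_reduce_def one_padic_int.rep_eq)

lemma to_fract_padic_int_of_rat:
  assumes "coprime (snd (quotient_of q)) (int CARD('p))"
  shows "to_fract (padic_int_of_rat q :: 'p::prime_card padic_int) = of_rat q"
proof -
  let ?P = "int CARD('p)"
  obtain a b where ab: "quotient_of q = (a, b)"
    by (cases "quotient_of q")
  have b: "b > 0" "coprime b ?P" and q: "q = of_int a / of_int b"
    using quotient_of_denom_pos[OF ab] assms ab quotient_of_div[OF ab] by auto
  have "\<exists>c. \<forall>n. [b * c n = 1] (mod ?P ^ n)"
    using b by (intro choice allI cong_solve_coprime_int) simp
  then obtain c where c: "[b * c n = 1] (mod ?P ^ n)" for n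
    by blast
  define x where "x = (\<lambda>n. (a * c n) mod ?P ^ n)"
  have bx: "[b * x n = a] (mod ?P ^ n)" for n
  proof -
    have "[b * x n = a * (b * c n)] (mod ?P ^ n)"
      unfolding x_def cong_def by (simp add: mod_simps mult.left_commute)
    also have "[a * (b * c n) = a * 1] (mod ?P ^ n)"
      by (intro cong_mult cong_refl c)
    finally show ?thesis by simp
  qed
  have "x (Suc n) mod ?P ^ n = x n" for n
  proof -
    have "[b * x (Suc n) = b * x n] (mod ?P ^ n)"
      using bx[of n] bx[of "Suc n"]
      by (meson cong_dvd_modulus cong_sym cong_trans le_imp_power_dvd le_SucI order_refl)
    then have "[x (Suc n) = x n] (mod ?P ^ n)"
      using b by (simp add: cong_mult_lcancel)
    then show ?thesis
      by (simp add: cong_def x_def)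
  qed
  moreover have "0 < ?P ^ n" for n
    using prime_gt_0_nat[OF prime_card[where 'a = 'p]] by simp
  ultimately have res: "padic_res (Abs_padic_int x :: 'p padic_int) n = x n" for n
    by (subst Abs_padic_int_inverse) (auto simp: x_def)
  define y where "y = (Abs_padic_int x :: 'p padic_int)"
  have "of_int b * y = of_int a"
    unfolding padic_res_eq_iff
    using bx by (simp add: times_padic_int.rep_eq padic_res_of_int y_def res cong_def mod_simps)
  then have "to_fract (of_int b) * to_fract y = to_fract (of_int a)"
    by (metis to_fract_mult)
  moreover have "to_fract (of_int k) = (of_int k :: 'p padic)" for k
    by (cases k rule: int_cases2) (simp_all add: of_nat_fract)
  ultimately have "to_fract y = of_rat q"
    using b unfolding q by (simp add: of_rat_divide field_simps)
  then show ?thesis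
    unfolding padic_int_of_rat_def by (rule theI) (simp add: \<open>to_fract y = of_rat q\<close>[symmetric])
qed

end

theory Submission
  imports
    Defs
    "HOL-Computational_Algebra.Formal_Laurent_Series"
begin

text \<open>
  With \<open>y = x^d\<close> the points of \<open>Z_\<lambda>\<close> correspond to the \<open>y \<noteq> 0, -1\<close> with \<open>(1 + y)^d = (d \<lambda>)^d y\<close>,
  and detecting this equation with the powers of the Teichmueller character expresses their number
  by Jacobi sums. It remains to identify the j-th summand of the hypergeometric series with the
  j-th Jacobi sum. The multiplication formula for the p-adic gamma function collapses each of the
  two products of gamma values to one value; so three gamma values remain, and Jacobi sums are such
  products by the Gross-Koblitz formula. That formula is obtained by Dwork's method: the coefficients
  of \<open>exp (X + X^p/p)\<close> satisfy a recurrence whose telescoped form produces the gamma values, and at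
  a root \<open>\<pi>\<close> of \<open>X^(p-1) + p\<close> the series is a p-th root of unity. Instead of adjoining \<open>\<pi>\<close>, one
  computes with polynomials modulo \<open>X^(p-1) + p\<close>.
\<close>

section \<open>Congruences and limits of p-adic integers\<close>

text \<open>The obstacle is convergence. Estimating the two factors of
  \<open>exp (X + X^p/p)\<close> separately bounds the valuation of the m-th coefficient below by
  about -m/(p-1), which only offsets the valuation m/(p-1) of \<pi>^m, so evaluation at \<pi> is not
  justified. The improvement comes from the gamma values: for a < p the numbers (-p)^k k!/(a + p k)!
  are, up to sign, 1/Gamma_p(1 + a + p k), and they form a Newton series in k with coefficients
  (-p)^i i! times Dwork coefficients. Wilson's theorem makes the finite differences in k divisible
  by growing powers of p; this lowers the slope to 2/(3(p-1)), even for p = 3. The same series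
  continued to k = -a/(p-1) yields the value 1/Gamma_p(1 - a/(p-1)) of the Gross-Koblitz formula.
  The root of unity at \<pi> is 1 + \<pi> to first order; replacing \<pi> by \<omega>(x) \<pi>
  therefore raises it to the power x, so that character sums over x single out monomials, whose
  coefficients are thereby Gauss sums. The exponent of -p in a summand records whether a product of
  two such monomials exceeds degree p - 1.\<close>

definition padic_cong :: "nat \<Rightarrow> 'p::prime_card padic_int \<Rightarrow> 'p padic_int \<Rightarrow> bool" where
  "padic_cong n x y \<longleftrightarrow> padic_res x n = padic_res y n"

lemma padic_cong_refl [simp]: "padic_cong n x x"
  by (simp add: padic_cong_def)

lemma padic_cong_sym: "padic_cong n x y \<Longrightarrow> padic_cong n y x"
  by (simp add: padic_cong_def)

lemma padic_cong_trans [trans]: "padic_cong n x y \<Longrightarrow> padic_cong n y z \<Longrightarrow> padic_cong n x z"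
  by (simp add: padic_cong_def)

lemma padic_cong_mono: "padic_cong n x y \<Longrightarrow> m \<le> n \<Longrightarrow> padic_cong m x y"
  unfolding padic_cong_def by (metis padic_res_mod)

lemma padic_eqI: "(\<And>n. padic_cong n x y) \<Longrightarrow> x = y"
  by (simp add: padic_cong_def padic_res_eq_iff)

lemma padic_cong_add: "padic_cong n x x' \<Longrightarrow> padic_cong n y y' \<Longrightarrow> padic_cong n (x + y) (x' + y')"
  by (simp add: padic_cong_def plus_padic_int.rep_eq)

lemma padic_cong_diff: "padic_cong n x x' \<Longrightarrow> padic_cong n y y' \<Longrightarrow> padic_cong n (x - y) (x' - y')"
  by (simp add: padic_cong_def minus_padic_int.rep_eq)

lemma padic_cong_uminus: "padic_cong n x x' \<Longrightarrow> padic_cong n (- x) (- x')"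
  by (simp add: padic_cong_def uminus_padic_int.rep_eq)

lemma padic_cong_mult: "padic_cong n x x' \<Longrightarrow> padic_cong n y y' \<Longrightarrow> padic_cong n (x * y) (x' * y')"
  by (simp add: padic_cong_def times_padic_int.rep_eq)

lemma padic_cong_power: "padic_cong n x y \<Longrightarrow> padic_cong n (x ^ k) (y ^ k)"
  by (induction k) (auto intro: padic_cong_mult)

lemma padic_cong_prod:
  "(\<And>i. i \<in> A \<Longrightarrow> padic_cong n (f i) (g i)) \<Longrightarrow> padic_cong n (prod f A) (prod g A)"
  by (induction A rule: infinite_finite_induct) (auto intro: padic_cong_mult)

lemma padic_cong_of_int_iff:
  "padic_cong n (of_int a :: 'p::prime_card padic_int) (of_int b) \<longleftrightarrow> [a = b] (mod int CARD('p) ^ n)"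
  by (simp add: padic_cong_def padic_res_of_int cong_def)

lemma padic_cong_of_nat_iff:
  "padic_cong n (of_nat a :: 'p::prime_card padic_int) (of_nat b) \<longleftrightarrow> [a = b] (mod CARD('p) ^ n)"
  using padic_cong_of_int_iff[of n "int a" "int b", where 'p='p] cong_int_iff[of a b "CARD('p)^n"]
  by simp

lemma padic_approx_nat: "padic_cong n x (of_nat (nat (padic_res x n)))"
proof -
  have "int (nat (padic_res x n)) mod int CARD('a) ^ n = padic_res x n"
    by simp
  then show ?thesis by (simp add: padic_cong_def padic_res_of_nat del: of_nat_nat)
qed

text \<open>Step n only has to be stable modulo p^n: the residues of f n at index n are then
  coherent. This is the form of completeness behind inverses, quotients by p^n, gamma values and
  Teichmueller representatives.\<close>

lemma padic_limit:
  fixes f :: "nat \<Rightarrow> 'p::prime_card padic_int"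
  assumes "\<And>n. padic_cong n (f (Suc n)) (f n)"
  shows "\<exists>x. \<forall>n. padic_cong n x (f n)"
proof -
  define r where "r = (\<lambda>n. padic_res (f n) n)"
  have "r (Suc n) mod int CARD('p) ^ n = r n" for n
    using assms[of n] padic_res_mod[of n "Suc n" "f (Suc n)"] by (simp add: r_def padic_cong_def)
  then have "padic_res (Abs_padic_int r :: 'p padic_int) n = r n" for n
    by (subst Abs_padic_int_inverse) (auto simp: r_def)
  then show ?thesis
    by (intro exI[of _ "Abs_padic_int r"]) (simp add: padic_cong_def r_def)
qed

lemma p_gt_1: "1 < CARD('p::prime_card)"
  using prime_gt_1_nat[OF prime_card[where 'a = 'p]] .

lemma padic_cong_0 [simp]: "padic_cong 0 (x :: 'p::prime_card padic_int) y"
proof -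
  have "padic_res x 0 = 0" for x :: "'p padic_int"
    using padic_res_bounds(1)[of x 0] padic_res_bounds(2)[of x 0] by (simp only: power_0)
  then show ?thesis by (simp add: padic_cong_def)
qed

text \<open>A nonzero residue modulo p makes all residues prime to p, so x has inverses c n modulo
  every p^n. They are coherent because \<open>c (Suc n)\<close> = \<open>c (Suc n) * x * c n\<close>
  = \<open>c n\<close> modulo p^n.\<close>

lemma padic_inverse_exists:
  fixes x :: "'p::prime_card padic_int"
  assumes "\<not> padic_cong 1 x 0"
  obtains y where "x * y = 1"
proof -
  let ?P = "int CARD('p)"
  have cop: "coprime (padic_res x n) (?P ^ n)" for n
  proof (cases n)
    case (Suc m)
    have "padic_res x n mod ?P ^ 1 = padic_res x 1"
      using Suc by (intro padic_res_mod) simp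
    moreover have "padic_res x 1 \<noteq> 0"
      using assms by (simp add: padic_cong_def zero_padic_int.rep_eq)
    ultimately have "\<not> ?P dvd padic_res x n" by auto
    then have "coprime ?P (padic_res x n)"
      using prime_card_int prime_imp_coprime by blast
    then show ?thesis by (simp add: coprime_commute)
  qed simp
  then have "\<exists>c. \<forall>n. [padic_res x n * c n = 1] (mod ?P ^ n)"
    by (intro choice allI cong_solve_coprime_int)
  then obtain c where c: "[padic_res x n * c n = 1] (mod ?P ^ n)" for n by blast
  have xr: "padic_cong n x (of_int (padic_res x n))" for n
    by (simp add: padic_cong_def padic_res_of_int)
  have xc: "padic_cong n (x * of_int (c n)) 1" for n
  proof -
    have "padic_cong n (x * of_int (c n)) (of_int (padic_res x n) * of_int (c n))"
      by (intro padic_cong_mult xr padic_cong_refl)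
    also have "padic_cong n (of_int (padic_res x n) * of_int (c n)) (of_int 1 :: 'p padic_int)"
      unfolding of_int_mult[symmetric] padic_cong_of_int_iff by (rule c)
    finally show ?thesis by simp
  qed
  have "padic_cong n (of_int (c (Suc n)) :: 'p padic_int) (of_int (c n))" for n
  proof -
    have "padic_cong n (of_int (c (Suc n)) * 1) (of_int (c (Suc n)) * (x * of_int (c n)))"
      by (intro padic_cong_mult padic_cong_refl padic_cong_sym[OF xc])
    also have "of_int (c (Suc n)) * (x * of_int (c n)) = (x * of_int (c (Suc n))) * of_int (c n)"
      by (simp add: mult_ac)
    also have "padic_cong n \<dots> (1 * of_int (c n))"
      by (intro padic_cong_mult padic_cong_refl padic_cong_mono[OF xc]) simp
    finally show ?thesis by simp
  qed
  then obtain y :: "'p padic_int" where y: "\<And>n. padic_cong n y (of_int (c n))"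
    using padic_limit[of "\<lambda>n. of_int (c n)"] by auto
  have "x * y = 1"
  proof (rule padic_eqI)
    fix n
    have "padic_cong n (x * y) (x * of_int (c n))" by (intro padic_cong_mult padic_cong_refl y)
    then show "padic_cong n (x * y) 1" using xc padic_cong_trans by blast
  qed
  then show ?thesis by (rule that)
qed

lemma padic_dvd_1_iff: "x dvd 1 \<longleftrightarrow> \<not> padic_cong 1 x (0 :: 'p::prime_card padic_int)"
proof
  assume "x dvd 1"
  then obtain y where y: "x * y = 1" by (auto simp: dvd_def)
  show "\<not> padic_cong 1 x 0"
  proof
    assume "padic_cong 1 x 0"
    then have "padic_cong 1 (x * y) (0 * y)" by (intro padic_cong_mult) auto
    then have "[1 = 0] (mod CARD('p))"
      using padic_cong_of_nat_iff[of 1 1 0, where 'p='p] y by simp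
    then show False using p_gt_1[where 'p='p] by (simp add: cong_def)
  qed
qed (metis padic_inverse_exists dvd_triv_left)

text \<open>The quotient by p^n is built from the residues of x at index n + m, divided by p^n;
  these quotients are determined modulo p^m.\<close>

lemma padic_cong_0_iff_dvd:
  "padic_cong n x (0 :: 'p::prime_card padic_int) \<longleftrightarrow> of_nat CARD('p) ^ n dvd x"
proof
  assume x: "padic_cong n x (0 :: 'p::prime_card padic_int)"
  let ?P = "int CARD('p)"
  have P: "?P > 0" by simp
  define r where "r = (\<lambda>m. padic_res x (n + m) div ?P ^ n)"
  have dv: "?P ^ n dvd padic_res x (n + m)" for m
    using x padic_res_mod[of n "n + m" x] by (auto simp: padic_cong_def zero_padic_int.rep_eq)
  have r: "?P ^ n * r m = padic_res x (n + m)" for m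
    using dv[of m] by (simp add: r_def)
  have "padic_cong m (of_int (r (Suc m)) :: 'p padic_int) (of_int (r m))" for m
  proof -
    have "[?P ^ n * r (Suc m) = ?P ^ n * r m] (mod ?P ^ n * ?P ^ m)"
      unfolding r power_add[symmetric] cong_def
      using padic_res_mod[of "n + m" "n + Suc m" x] by simp
    then have "?P ^ n * ?P ^ m dvd ?P ^ n * (r (Suc m) - r m)"
      by (simp add: cong_iff_dvd_diff algebra_simps)
    then have "?P ^ m dvd r (Suc m) - r m" by simp
    then show ?thesis by (simp add: padic_cong_of_int_iff cong_iff_dvd_diff)
  qed
  then obtain y :: "'p padic_int" where y: "\<And>m. padic_cong m y (of_int (r m))"
    using padic_limit[of "\<lambda>m. of_int (r m)"] by auto
  have "x = of_nat CARD('p) ^ n * y"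
  proof (rule padic_eqI)
    fix m
    have "padic_cong m (of_nat CARD('p) ^ n * y) (of_nat CARD('p) ^ n * of_int (r m))"
      by (intro padic_cong_mult padic_cong_refl y)
    also have "of_nat CARD('p) ^ n * of_int (r m) = (of_int (padic_res x (n + m)) :: 'p padic_int)"
      using r[of m, symmetric] by simp
    also have "padic_cong m \<dots> x"
      by (rule padic_cong_sym, rule padic_cong_mono[of "n + m"])
        (simp_all add: padic_cong_def padic_res_of_int)
    finally show "padic_cong m x (of_nat CARD('p) ^ n * y)" by (rule padic_cong_sym)
  qed
  then show "of_nat CARD('p) ^ n dvd x" by simp
next
  assume "of_nat CARD('p) ^ n dvd x"
  then obtain y where y: "x = of_nat CARD('p) ^ n * y" by (auto simp: dvd_def)
  have "padic_cong n (of_nat (CARD('p) ^ n)) (of_nat 0 :: 'p padic_int)"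
    unfolding padic_cong_of_nat_iff by (simp add: cong_def)
  then have "padic_cong n (of_nat (CARD('p) ^ n) * y) (of_nat 0 * y)"
    by (intro padic_cong_mult padic_cong_refl)
  then show "padic_cong n x 0" by (simp add: y)
qed

lemma padic_cong_iff_dvd:
  "padic_cong n x (y :: 'p::prime_card padic_int) \<longleftrightarrow> of_nat CARD('p) ^ n dvd (x - y)"
proof -
  have "padic_cong n x y \<longleftrightarrow> padic_cong n (x - y) 0"
    using padic_cong_diff[of n x y y y] padic_cong_add[of n "x - y" 0 y y] by auto
  then show ?thesis by (simp add: padic_cong_0_iff_dvd)
qed

text \<open>The index in \<open>dist\<close> is the last one at which the residues still agree, so
  the closed ball of radius p^(-n) is exactly a residue class modulo p^n.\<close>

lemma dist_padic_le_iff: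
  "dist x (y :: 'p::prime_card padic_int) \<le> (1 / real CARD('p)) ^ n \<longleftrightarrow> padic_cong n x y"
proof (cases "x = y")
  case False
  let ?L = "LEAST n. padic_res x (Suc n) \<noteq> padic_res y (Suc n)"
  obtain m where m: "padic_res x m \<noteq> padic_res y m"
    using False by (auto simp: padic_res_eq_iff)
  then have "padic_res x (Suc m) \<noteq> padic_res y (Suc m)"
    by (metis padic_res_mod le_SucI order_refl)
  then have L: "padic_res x (Suc ?L) \<noteq> padic_res y (Suc ?L)"
    by (rule LeastI)
  have "padic_cong n x y \<longleftrightarrow> n \<le> ?L"
  proof
    assume "padic_cong n x y"
    show "n \<le> ?L"
    proof (rule ccontr)
      assume "\<not> n \<le> ?L"
      then have "padic_cong (Suc ?L) x y"
        using padic_cong_mono[OF \<open>padic_cong n x y\<close>] by simp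
      then show False using L by (simp add: padic_cong_def)
    qed
  next
    assume n: "n \<le> ?L"
    show "padic_cong n x y"
    proof (cases n)
      case (Suc k)
      then have "k < ?L" using n by simp
      from not_less_Least[OF this] show ?thesis using Suc by (simp add: padic_cong_def)
    qed simp
  qed
  moreover have "dist x y \<le> (1 / real CARD('p)) ^ n \<longleftrightarrow> n \<le> ?L"
    unfolding dist_padic_int_def using False p_gt_1[where 'p='p]
    by (simp add: power_le_one_iff divide_simps)
  ultimately show ?thesis by simp
qed (simp add: dist_padic_int_def)

text \<open>Residue classes form a neighbourhood basis, which turns the continuity in the
  description of \<open>padic_Gamma\<close> into a statement about congruences.\<close>

lemma padic_continuous_iff:
  fixes f :: "'p::prime_card padic_int \<Rightarrow> 'p padic_int"
  shows "continuous_on UNIV f \<longleftrightarrow>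
    (\<forall>x n. \<exists>m. \<forall>y. padic_cong m y x \<longrightarrow> padic_cong n (f y) (f x))"
proof -
  let ?q = "1 / real CARD('p)"
  have q: "0 < ?q" "?q < 1" using p_gt_1[where 'p='p] by auto
  have small: "\<exists>n. ?q ^ n < e" if "e > 0" for e
    using real_arch_pow_inv[OF that q(2)] .
  show ?thesis
  proof (intro iffI allI)
    fix x n assume "continuous_on UNIV f"
    then have "isCont f x" by (simp add: continuous_on_eq_continuous_at)
    then obtain s where s: "s > 0" "\<And>y. y \<noteq> x \<Longrightarrow> dist y x < s \<Longrightarrow> dist (f y) (f x) < ?q ^ n"
      unfolding isCont_def LIM_def using q by (metis zero_less_power)
    obtain m where m: "?q ^ m < s" using small[OF s(1)] by blast
    show "\<exists>m. \<forall>y. padic_cong m y x \<longrightarrow> padic_cong n (f y) (f x)"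
    proof (intro exI allI impI)
      fix y assume "padic_cong m y x"
      then have "dist y x < s" using m dist_padic_le_iff[of y x m] by simp
      then show "padic_cong n (f y) (f x)"
        using s(2)[of y] dist_padic_le_iff[of "f y" "f x" n] by (cases "y = x") auto
    qed
  next
    assume H: "\<forall>x n. \<exists>m. \<forall>y. padic_cong m y x \<longrightarrow> padic_cong n (f y) (f x)"
    have "isCont f x" for x
      unfolding isCont_def LIM_def
    proof (intro allI impI)
      fix r :: real assume "r > 0"
      then obtain n where n: "?q ^ n < r" using small by blast
      obtain m where m: "\<forall>y. padic_cong m y x \<longrightarrow> padic_cong n (f y) (f x)" using H by blast
      show "\<exists>s>0. \<forall>xa. xa \<noteq> x \<and> dist xa x < s \<longrightarrow> dist (f xa) (f x) < r"
      proof (intro exI[of _ "?q ^ m"] conjI allI impI)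
        fix y assume "y \<noteq> x \<and> dist y x < ?q ^ m"
        then have "padic_cong m y x" using dist_padic_le_iff[of y x m] by auto
        then show "dist (f y) (f x) < r" using m n dist_padic_le_iff[of "f y" "f x" n] by fastforce
      qed (use q in auto)
    qed
    then show "continuous_on UNIV f" by (simp add: continuous_on_eq_continuous_at)
  qed
qed

lemma padic_approx_pos_nat:
  fixes x :: "'p::prime_card padic_int"
  obtains k :: nat where "k > 0" "padic_cong n x (of_nat k)" "k \<ge> K"
proof -
  define k where "k = nat (padic_res x n) + CARD('p) ^ n * Suc K"
  have "Suc K \<le> CARD('p) ^ n * Suc K" using p_gt_1[where 'p='p] by (simp del: mult_Suc_right)
  then have "k \<ge> Suc K" unfolding k_def by linarith
  moreover have "padic_cong n (of_nat (nat (padic_res x n)) :: 'p padic_int) (of_nat k)"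
    unfolding padic_cong_of_nat_iff k_def by (simp add: cong_def del: mult_Suc_right)
  then have "padic_cong n x (of_nat k)" using padic_approx_nat padic_cong_trans by blast
  ultimately show ?thesis using that[of k] by simp
qed

text \<open>The positive integers meet every residue class, so they are dense. This yields the
  uniqueness in the description of \<open>padic_Gamma\<close>.\<close>

lemma padic_continuous_eqI:
  fixes f g :: "'p::prime_card padic_int \<Rightarrow> 'p padic_int"
  assumes "continuous_on UNIV f" "continuous_on UNIV g"
    and eq: "\<And>k. k > 0 \<Longrightarrow> f (of_nat k) = g (of_nat k)"
  shows "f = g"
proof (rule ext, rule padic_eqI)
  fix x n
  obtain m1 where m1: "\<forall>y. padic_cong m1 y x \<longrightarrow> padic_cong n (f y) (f x)"
    using assms(1) unfolding padic_continuous_iff by blast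
  obtain m2 where m2: "\<forall>y. padic_cong m2 y x \<longrightarrow> padic_cong n (g y) (g x)"
    using assms(2) unfolding padic_continuous_iff by blast
  obtain k where k: "k > 0" "padic_cong (max m1 m2) x (of_nat k)"
    using padic_approx_pos_nat by blast
  have "padic_cong n (f (of_nat k)) (f x)" "padic_cong n (g (of_nat k)) (g x)"
    using m1 m2 k padic_cong_mono[OF padic_cong_sym[OF k(2)]] by auto
  then show "padic_cong n (f x) (g x)"
    using eq[OF k(1)] by (metis padic_cong_sym padic_cong_trans)
qed

section \<open>The p-adic gamma function\<close>

text \<open>Up to the sign (-1)^n this is the value of the gamma function at n.\<close>

definition prime_to_p_fact :: "nat \<Rightarrow> nat \<Rightarrow> nat" where
  "prime_to_p_fact p n = (\<Prod>j | 0 < j \<and> j < n \<and> \<not> p dvd j. j)"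

lemma prime_to_p_fact_0 [simp]: "prime_to_p_fact p 0 = 1"
  by (simp add: prime_to_p_fact_def)

lemma prime_to_p_fact_Suc:
  "prime_to_p_fact p (Suc n) = (if p dvd n then 1 else n) * prime_to_p_fact p n"
proof -
  have fin: "finite {j. 0 < j \<and> j < n \<and> \<not> p dvd j}"
    by (rule finite_subset[of _ "{..<n}"]) auto
  show ?thesis
  proof (cases "p dvd n")
    case True
    then have "{j. 0 < j \<and> j < Suc n \<and> \<not> p dvd j} = {j. 0 < j \<and> j < n \<and> \<not> p dvd j}"
      by (auto simp: less_Suc_eq)
    then show ?thesis using True by (simp add: prime_to_p_fact_def)
  next
    case False
    then have "{j. 0 < j \<and> j < Suc n \<and> \<not> p dvd j} = insert n {j. 0 < j \<and> j < n \<and> \<not> p dvd j}"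
      by (auto simp: less_Suc_eq intro: gr0I)
    then show ?thesis using False fin by (simp add: prime_to_p_fact_def)
  qed
qed

lemma prime_to_p_fact_add:
  "prime_to_p_fact p (m + n) = prime_to_p_fact p m * (\<Prod>j<n. if p dvd m + j then 1 else m + j)"
  by (induction n) (simp_all add: prime_to_p_fact_Suc)

text \<open>The multiples of p up to n are p times the numbers up to n div p; they split off a power
  of p and a smaller factorial.\<close>

lemma fact_prime_to_p:
  assumes "p > 0"
  shows "fact n = prime_to_p_fact p (Suc n) * p ^ (n div p) * fact (n div p)"
proof (induction n)
  case (Suc n)
  show ?case
  proof (cases "p dvd Suc n")
    case True
    then have d: "Suc n div p = Suc (n div p)" by (simp add: div_Suc dvd_eq_mod_eq_0)
    have "Suc n = p * Suc (n div p)" using True d by (metis dvd_mult_div_cancel)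
    then have "fact (Suc n) = p * Suc (n div p) * (fact n :: nat)" by (metis fact_Suc of_nat_id)
    then show ?thesis using True Suc d by (simp add: prime_to_p_fact_Suc[of p "Suc n"] algebra_simps)
  next
    case False
    then have d: "Suc n div p = n div p" by (auto simp add: div_Suc dvd_eq_mod_eq_0)
    show ?thesis using False Suc d by (simp add: prime_to_p_fact_Suc[of p "Suc n"] algebra_simps)
  qed
qed (use assms in \<open>simp add: prime_to_p_fact_Suc\<close>)

text \<open>Moving the window by one replaces the factor g m by g (m + q), which is congruent to
  it.\<close>

lemma prod_residues_shift:
  fixes g :: "nat \<Rightarrow> int"
  assumes per: "\<And>j. [g (j + q) = g j] (mod M)"
  shows "[(\<Prod>j<q. g (m + j)) = (\<Prod>j<q. g j)] (mod M)"
proof (induction m)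
  case (Suc m)
  have "[(\<Prod>j<q. g (Suc m + j)) = (\<Prod>j<q. g (m + j))] (mod M)"
  proof (cases q)
    case (Suc r)
    have "(\<Prod>j<q. g (Suc m + j)) = (\<Prod>j<r. g (m + Suc j)) * g (m + q)"
      using Suc by simp
    also have "[\<dots> = (\<Prod>j<r. g (m + Suc j)) * g m] (mod M)"
      by (intro cong_mult cong_refl per)
    also have "(\<Prod>j<r. g (m + Suc j)) * g m = (\<Prod>j<q. g (m + j))"
      unfolding Suc by (simp add: prod.lessThan_Suc_shift del: prod.lessThan_Suc)
    finally show ?thesis .
  qed simp
  then show ?case using Suc cong_trans by blast
qed simp

text \<open>The residues below p^(n+1) are sorted into the classes j + t p^n. Each class contributes
  \<open>h j ^ p\<close> modulo p^(n+1), so the product is the p-th power of the product below p^n,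
  and taking p-th powers lifts the congruence to -1 from p^n to p^(n+1).\<close>

lemma wilson_prime_power:
  fixes p :: nat
  assumes p: "prime p" "odd p" and n: "n > 0"
  shows "[(\<Prod>j<p^n. if p dvd j then 1 else int j) = -1] (mod int p ^ n)"
  using n
proof (induction n rule: nat_induct_non_zero)
  case 1
  have p0: "p > 0" using p by (simp add: prime_gt_0_nat)
  have "(\<Prod>j<p. if p dvd j then 1 else int j) = (\<Prod>j\<in>{1..<p}. int j)"
    by (rule prod.mono_neutral_cong_right) (auto dest: dvd_imp_le simp: not_less_eq_eq)
  also have "{1..<p} = {1..p - 1}" by auto
  also have "(\<Prod>j\<in>{1..p - 1}. int j) = fact (p - 1)"
    by (simp add: fact_prod)
  also have "[(fact (p - 1) :: int) = -1] (mod int p)"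
    using wilson_theorem[OF p(1)] by simp
  finally show ?case by simp
next
  case (Suc n)
  define h where "h = (\<lambda>j. if p dvd j then 1 else int j)"
  have p0: "p > 0" using p by (simp add: prime_gt_0_nat)
  have mult: "(\<Prod>j<p * q. h j) = (\<Prod>t<p. \<Prod>j<q. h (j + t * q))" for q
  proof -
    have "prod h {t * q..<t * q + q} = (\<Prod>j<q. h (j + t * q))" for t
      using prod.shift_bounds_nat_ivl[of h 0 "t * q" q] by (simp add: atLeast0LessThan add.commute)
    then show ?thesis using prod.nat_group[of h q p] by (simp add: mult.commute)
  qed
  have inner: "[(\<Prod>t<p. h (j + t * p ^ n)) = h j ^ p] (mod int p ^ Suc n)" for j
  proof (cases "p dvd j")
    case True
    then have "h (j + t * p ^ n) = 1" for t using Suc.hyps by (simp add: h_def)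
    then show ?thesis using True by (simp add: h_def)
  next
    case False
    have "p dvd t * p ^ n" for t using Suc.hyps by simp
    then have "\<not> p dvd j + t * p ^ n" for t using False dvd_add_left_iff by blast
    then have "(\<Prod>t<p. h (j + t * p ^ n)) = (\<Prod>t<p. int j + int t * int p ^ n)"
      by (simp add: h_def)
    \<comment> \<open>Only the terms at most linear in p^n survive, since p^(2n) is divisible by
      p^(n+1).\<close>
    also have "[\<dots> = int j ^ p + int j ^ (p - 1) * int p ^ n * (\<Sum>t<p. int t)] (mod int p ^ Suc n)"
    proof -
      have "[(\<Prod>t<r. int j + int t * int p ^ n) =
          int j ^ r + int j ^ (r - 1) * int p ^ n * (\<Sum>t<r. int t)] (mod int p ^ Suc n)" for r
      proof (induction r)
        case (Suc r)
        have "[(\<Prod>t<Suc r. int j + int t * int p ^ n) =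
           (int j ^ r + int j ^ (r - 1) * int p ^ n * (\<Sum>t<r. int t)) * (int j + int r * int p ^ n)] (mod int p ^ Suc n)"
          using Suc by (simp add: cong_mult)
        also have "(int j ^ r + int j ^ (r - 1) * int p ^ n * (\<Sum>t<r. int t)) * (int j + int r * int p ^ n) =
           int j ^ Suc r + int j ^ r * int p ^ n * (\<Sum>t<Suc r. int t)
            + int j ^ (r - 1) * (\<Sum>t<r. int t) * int r * (int p ^ n * int p ^ n)"
          by (cases r) (simp_all add: algebra_simps)
        also have "[\<dots> = int j ^ Suc r + int j ^ r * int p ^ n * (\<Sum>t<Suc r. int t) + 0] (mod int p ^ Suc n)"
        proof (intro cong_add cong_refl)
          have "int p ^ Suc n dvd int p ^ n * int p ^ n"
            using Suc.hyps \<open>n > 0\<close> by (simp add: power_add[symmetric] le_imp_power_dvd flip: power_Suc)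
          then show "[int j ^ (r - 1) * (\<Sum>t<r. int t) * int r * (int p ^ n * int p ^ n) = 0] (mod int p ^ Suc n)"
            by (simp only: cong_0_iff dvd_mult)
        qed
        finally show ?case by simp
      qed simp
      then show ?thesis .
    qed
    also have "[int j ^ p + int j ^ (p - 1) * int p ^ n * (\<Sum>t<p. int t) = int j ^ p + 0] (mod int p ^ Suc n)"
    proof (intro cong_add cong_refl)
      \<comment> \<open>The sum is p (p - 1)/2, a multiple of p because p is odd.\<close>
      have "(\<Sum>t<p. int t) * 2 = int p * (int p - 1)"
        by (induction p) (simp_all add: algebra_simps)
      then have "int p dvd (\<Sum>t<p. int t) * 2" by simp
      moreover have "coprime (int p) 2" using p(2) by simp
      ultimately have "int p dvd (\<Sum>t<p. int t)" by (simp add: coprime_dvd_mult_left_iff)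
      then have "int p * int p ^ n dvd int j ^ (p - 1) * int p ^ n * (\<Sum>t<p. int t)"
        by (metis dvd_mult mult.commute mult.left_commute mult_dvd_mono dvd_refl)
      then show "[int j ^ (p - 1) * int p ^ n * (\<Sum>t<p. int t) = 0] (mod int p ^ Suc n)"
        by (simp add: cong_0_iff)
    qed
    finally show ?thesis using False by (simp add: h_def)
  qed
  have "(\<Prod>j<p ^ Suc n. h j) = (\<Prod>j<p ^ n. \<Prod>t<p. h (j + t * p ^ n))"
    using mult[of "p ^ n"] prod.swap by simp
  also have "[\<dots> = (\<Prod>j<p ^ n. h j ^ p)] (mod int p ^ Suc n)"
    by (intro cong_prod inner)
  also have "(\<Prod>j<p ^ n. h j ^ p) = (\<Prod>j<p ^ n. h j) ^ p"
    by (rule prod_power_distrib[symmetric])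
  also have "[\<dots> = (-1) ^ p] (mod int p ^ Suc n)"
  proof -
    define A where "A = (\<Prod>j<p ^ n. h j)"
    have "[A = -1] (mod int p ^ n)" using Suc.IH by (simp add: A_def h_def)
    then obtain c where c: "A = -1 + int p ^ n * c"
      by (metis cong_iff_lin cong_sym)
    have "A ^ p - (-1) ^ p = (A - (-1)) * (\<Sum>i<p. A ^ i * (-1) ^ (p - Suc i))"
      using power_diff_sumr2[of A p "-1"] by (simp add: mult.commute)
    \<comment> \<open>Modulo p all p summands equal (-1)^(p-1); this is the additional factor
      p.\<close>
    moreover have "int p dvd (\<Sum>i<p. A ^ i * (-1) ^ (p - Suc i))"
    proof -
      have "[A = -1] (mod int p)" using c \<open>n > 0\<close>
        by (simp add: cong_iff_dvd_diff)
      then have "[(\<Sum>i<p. A ^ i * (-1) ^ (p - Suc i)) = (\<Sum>i<p. (-1) ^ i * (-1) ^ (p - Suc i))] (mod int p)"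
        by (intro cong_sum cong_mult cong_pow cong_refl)
      also have "(\<Sum>i<p. (-1) ^ i * (-1) ^ (p - Suc i)) = (\<Sum>i<p. (-1 :: int) ^ (p - 1))"
        by (intro sum.cong refl) (simp flip: power_add)
      also have "[\<dots> = 0] (mod int p)" by (simp add: cong_0_iff)
      finally show ?thesis by (simp add: cong_0_iff)
    qed
    moreover have "int p ^ n dvd A - (-1)" using c by simp
    ultimately have "int p ^ n * int p dvd A ^ p - (-1) ^ p" by (simp add: mult_dvd_mono)
    then show ?thesis by (simp add: A_def cong_iff_dvd_diff mult.commute)
  qed
  also have "(-1 :: int) ^ p = -1" using p(2) by simp
  finally show ?case by (simp add: h_def)
qed

text \<open>The p^n new factors represent all residues, so they multiply to -1 by Wilson's theorem;
  the sign (-1)^(p^n) = -1 compensates this, which explains the sign in the gamma function.\<close>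

lemma prime_to_p_fact_period:
  assumes p: "prime p" "odd p"
  shows "[(-1) ^ (m + p ^ n) * int (prime_to_p_fact p (m + p ^ n)) = (-1) ^ m * int (prime_to_p_fact p m)] (mod int p ^ n)"
proof (cases "n = 0")
  case False
  define h where "h = (\<lambda>j. if p dvd j then 1 else int j)"
  have per: "[h (j + p ^ n) = h j] (mod int p ^ n)" for j
    using False by (simp add: h_def cong_def dvd_add_left_iff)
  have "(\<Prod>j<p ^ n. int (if p dvd m + j then 1 else m + j)) = (\<Prod>j<p ^ n. h (m + j))"
    by (intro prod.cong) (auto simp: h_def)
  also have "[\<dots> = (\<Prod>j<p ^ n. h j)] (mod int p ^ n)"
    by (rule prod_residues_shift[where g = h and q = "p ^ n", OF per])
  also have "[(\<Prod>j<p ^ n. h j) = -1] (mod int p ^ n)"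
    unfolding h_def using wilson_prime_power[OF p] False by simp
  finally have "[(-1) ^ (m + p ^ n) * (int (prime_to_p_fact p m) * (\<Prod>j<p ^ n. int (if p dvd m + j then 1 else m + j))) =
     (-1) ^ (m + p ^ n) * (int (prime_to_p_fact p m) * (-1))] (mod int p ^ n)"
    by (intro cong_mult cong_refl)
  moreover have "(-1 :: int) ^ (m + p ^ n) = - ((-1) ^ m)" using p(2) by (simp add: power_add)
  ultimately show ?thesis by (simp add: prime_to_p_fact_add)
qed simp

lemma prime_to_p_fact_cong:
  assumes p: "prime p" "odd p" and "[a = b] (mod p ^ n)"
  shows "[(-1) ^ a * int (prime_to_p_fact p a) = (-1) ^ b * int (prime_to_p_fact p b)] (mod int p ^ n)"
proof -
  have shift: "[(-1) ^ (m + p ^ n * k) * int (prime_to_p_fact p (m + p ^ n * k)) = (-1) ^ m * int (prime_to_p_fact p m)] (mod int p ^ n)" for m k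
  proof (induction k)
    case (Suc k)
    then show ?case using prime_to_p_fact_period[OF p, of "m + p ^ n * k" n]
      by (simp add: add_ac) (meson cong_trans)
  qed simp
  obtain k l where "a + p ^ n * k = b + p ^ n * l"
    using assms(3) by (metis cong_iff_lin_nat mult.commute)
  then show ?thesis using shift[of a k] shift[of b l] by (metis cong_sym cong_trans)
qed

text \<open>The values at natural numbers preserve congruences modulo every p^n, so the values at
  the residues of x are coherent. The second conclusion, a Lipschitz bound with constant 1, is the
  form in which continuity is used later.\<close>

lemma padic_Gamma_exists:
  assumes "odd CARD('p::prime_card)"
  obtains G :: "'p::prime_card padic_int \<Rightarrow> 'p padic_int" where
    "\<And>n. G (of_nat n) = of_int ((- 1) ^ n * int (prime_to_p_fact CARD('p) n))"
    "\<And>n x y. padic_cong n x y \<Longrightarrow> padic_cong n (G x) (G y)"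
proof -
  define h where "h = (\<lambda>n. (- 1) ^ n * int (prime_to_p_fact CARD('p) n))"
  have h: "padic_cong n (of_int (h a) :: 'p padic_int) (of_int (h b))" if "[a = b] (mod CARD('p) ^ n)" for a b n
    unfolding h_def padic_cong_of_int_iff
    by (rule prime_to_p_fact_cong[OF prime_card assms that])
  have "\<exists>y :: 'p padic_int. \<forall>n. padic_cong n y (of_int (h (nat (padic_res x n))))" for x :: "'p padic_int"
  proof (rule padic_limit, rule h)
    fix n
    have "padic_cong n (of_nat (nat (padic_res x (Suc n)))) x"
      by (rule padic_cong_sym, rule padic_cong_mono[OF padic_approx_nat]) simp
    also have "padic_cong n x (of_nat (nat (padic_res x n)))" by (rule padic_approx_nat)
    finally show "[nat (padic_res x (Suc n)) = nat (padic_res x n)] (mod CARD('p) ^ n)"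
      by (simp only: padic_cong_of_nat_iff)
  qed
  then obtain G :: "'p padic_int \<Rightarrow> 'p padic_int"
    where G: "\<And>x n. padic_cong n (G x) (of_int (h (nat (padic_res x n))))"
    using choice[of "\<lambda>x y. \<forall>n. padic_cong n y (of_int (h (nat (padic_res x n))))"] by blast
  have "G (of_nat k) = of_int (h k)" for k
  proof (rule padic_eqI)
    fix n
    have "[nat (padic_res (of_nat k :: 'p padic_int) n) = k] (mod CARD('p) ^ n)"
      using padic_approx_nat[of n "of_nat k :: 'p padic_int"]
      by (simp only: padic_cong_of_nat_iff cong_sym_eq)
    then show "padic_cong n (G (of_nat k)) (of_int (h k))"
      using G h padic_cong_trans by blast
  qed
  moreover have "padic_cong n (G x) (G y)" if "padic_cong n x y" for n x y
  proof -
    have "padic_res x n = padic_res y n" using that by (simp add: padic_cong_def)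
    then show ?thesis using G[of n x] G[of n y] padic_cong_sym padic_cong_trans by metis
  qed
  ultimately show ?thesis using that unfolding h_def by blast
qed

lemma padic_continuousI:
  fixes f :: "'p::prime_card padic_int \<Rightarrow> 'p padic_int"
  shows "(\<And>n x y. padic_cong n x y \<Longrightarrow> padic_cong n (f x) (f y)) \<Longrightarrow> continuous_on UNIV f"
  unfolding padic_continuous_iff by blast

text \<open>The extension just constructed satisfies the description in \<open>padic_Gamma\<close>,
  and by density nothing else does. These three facts are all that is used of the definition
  afterwards.\<close>

lemma
  assumes odd_p: "odd CARD('p::prime_card)"
  shows padic_Gamma_of_nat:
      "padic_Gamma (of_nat n :: 'p padic_int) = of_int ((- 1) ^ n * int (prime_to_p_fact CARD('p) n))"
    and padic_Gamma_cong: "padic_cong m x y \<Longrightarrow> padic_cong m (padic_Gamma x) (padic_Gamma (y :: 'p padic_int))"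
    and padic_Gamma_unit: "padic_Gamma (x :: 'p padic_int) dvd 1"
proof -
  obtain G :: "'p padic_int \<Rightarrow> 'p padic_int" where
    G: "\<And>n. G (of_nat n) = of_int ((- 1) ^ n * int (prime_to_p_fact CARD('p) n))"
    and lip: "\<And>n x y. padic_cong n x y \<Longrightarrow> padic_cong n (G x) (G y)"
    using padic_Gamma_exists[OF odd_p] by blast
  have val: "of_int ((- 1) ^ n * int (prime_to_p_fact CARD('p) n)) =
      ((- 1) ^ n * (\<Prod>j | 0 < j \<and> j < n \<and> \<not> CARD('p) dvd j. of_nat j) :: 'p padic_int)" for n
    by (simp add: prime_to_p_fact_def)
  have unit: "G x dvd 1" for x
  proof -
    obtain k where k: "padic_cong 1 x (of_nat k)" using padic_approx_nat by blast
    have "\<not> CARD('p) dvd prime_to_p_fact CARD('p) k" for k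
      by (induction k) (use p_gt_1[where 'p='p] prime_dvd_mult_iff[OF prime_card[where 'a='p]]
        in \<open>auto simp: prime_to_p_fact_Suc\<close>)
    then have "\<not> int CARD('p) dvd (- 1) ^ k * int (prime_to_p_fact CARD('p) k)"
      by (cases "even k") auto
    then have "\<not> padic_cong 1 (G (of_nat k)) 0"
      using padic_cong_of_int_iff[of 1 "(- 1) ^ k * int (prime_to_p_fact CARD('p) k)" 0, where 'p='p]
      by (simp add: G cong_0_iff del: One_nat_def)
    then show ?thesis
      unfolding padic_dvd_1_iff using lip[OF k] padic_cong_sym padic_cong_trans by blast
  qed
  have cont: "continuous_on UNIV G" by (rule padic_continuousI, rule lip)
  have "padic_Gamma = G"
    unfolding padic_Gamma_def
  proof (rule the_equality)
    show "continuous_on UNIV G \<and> (\<forall>x. G x dvd 1) \<and> G 0 = 1 \<and> (\<forall>n>0. G (of_nat n) =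
        (- 1) ^ n * (\<Prod>j | 0 < j \<and> j < n \<and> \<not> CARD('p) dvd j. of_nat j))"
      using cont unit G[of 0] by (auto simp: G val[symmetric] simp del: of_int_mult of_int_power)
  next
    fix f :: "'p padic_int \<Rightarrow> 'p padic_int"
    assume "continuous_on UNIV f \<and> (\<forall>x. f x dvd 1) \<and> f 0 = 1 \<and> (\<forall>n>0. f (of_nat n) =
        (- 1) ^ n * (\<Prod>j | 0 < j \<and> j < n \<and> \<not> CARD('p) dvd j. of_nat j))"
    then show "f = G"
      using cont
      by (intro padic_continuous_eqI) (auto simp: G val[symmetric] simp del: of_int_mult of_int_power)
  qed
  then show "padic_Gamma (of_nat n :: 'p padic_int) = of_int ((- 1) ^ n * int (prime_to_p_fact CARD('p) n))"
    and "padic_cong m x y \<Longrightarrow> padic_cong m (padic_Gamma x) (padic_Gamma (y :: 'p padic_int))"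
    and "padic_Gamma (x :: 'p padic_int) dvd 1"
    using G lip unit by simp_all
qed

text \<open>An approximation of x by a natural number to n + 1 digits settles both the case
  distinction, which concerns the first digit, and the congruence modulo p^n.\<close>

lemma padic_Gamma_plus_1:
  fixes x :: "'p::prime_card padic_int"
  assumes odd_p: "odd CARD('p)"
  shows "padic_Gamma (x + 1) = (if padic_cong 1 x 0 then - 1 else - x) * padic_Gamma x"
proof (rule padic_eqI)
  fix n
  obtain k where k: "padic_cong (Suc n) x (of_nat k)" using padic_approx_nat by blast
  have kn: "padic_cong n x (of_nat k)" "padic_cong 1 x (of_nat k)"
    using padic_cong_mono[OF k] by simp_all
  have z: "padic_cong 1 x 0 \<longleftrightarrow> CARD('p) dvd k"
    using padic_cong_of_nat_iff[of 1 k 0, where 'p='p] kn(2) padic_cong_sym padic_cong_trans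
    by (metis cong_0_iff of_nat_0 power_one_right)
  have "padic_cong n (padic_Gamma (x + 1)) (padic_Gamma (of_nat (Suc k)))"
    using kn(1) by (intro padic_Gamma_cong odd_p) (simp add: padic_cong_add add.commute[of 1])
  also have "padic_Gamma (of_nat (Suc k)) = (if padic_cong 1 x 0 then - 1 else - of_nat k) * padic_Gamma (of_nat k :: 'p padic_int)"
    unfolding padic_Gamma_of_nat[OF odd_p] z by (simp add: prime_to_p_fact_Suc)
  also have "padic_cong n \<dots> ((if padic_cong 1 x 0 then - 1 else - x) * padic_Gamma x)"
    using kn(1) by (intro padic_cong_mult padic_Gamma_cong odd_p)
      (auto intro: padic_cong_sym padic_cong_uminus)
  finally show "padic_cong n (padic_Gamma (x + 1)) ((if padic_cong 1 x 0 then - 1 else - x) * padic_Gamma x)" .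
qed

section \<open>Teichmueller representatives as limits of iterated p-th powers\<close>

lemma padic_cong_sum:
  "(\<And>i. i \<in> A \<Longrightarrow> padic_cong n (f i) (g i)) \<Longrightarrow> padic_cong n (sum f A) (sum g A)"
  by (induction A rule: infinite_finite_induct) (auto intro: padic_cong_add)

text \<open>In the factorization of x^p - y^p the cofactor of x - y is congruent to p y^(p-1) modulo
  p, as x and y agree modulo p; hence one more digit is gained.\<close>

lemma padic_cong_power_p:
  fixes x y :: "'p::prime_card padic_int"
  assumes "padic_cong n x y" "n > 0"
  shows "padic_cong (Suc n) (x ^ CARD('p)) (y ^ CARD('p))"
proof -
  let ?p = "CARD('p)"
  have xy: "padic_cong 1 x y" by (rule padic_cong_mono[OF assms(1)]) (use assms(2) in simp)
  have "padic_cong 1 (\<Sum>i<r. x ^ i * y ^ (r - Suc i)) (of_nat r * y ^ (r - 1))" for r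
  proof -
    have "padic_cong 1 (\<Sum>i<r. x ^ i * y ^ (r - Suc i)) (\<Sum>i<r. y ^ i * y ^ (r - Suc i))"
      by (intro padic_cong_sum padic_cong_mult padic_cong_power xy padic_cong_refl)
    also have "(\<Sum>i<r. y ^ i * y ^ (r - Suc i)) = (\<Sum>i<r. y ^ (r - 1))"
      by (intro sum.cong refl) (simp flip: power_add)
    also have "\<dots> = of_nat r * y ^ (r - 1)" by simp
    finally show ?thesis .
  qed
  from this[of ?p] have "of_nat ?p dvd (\<Sum>i<?p. x ^ i * y ^ (?p - Suc i)) - of_nat ?p * y ^ (?p - 1)"
    by (simp add: padic_cong_iff_dvd)
  then have "of_nat ?p dvd (\<Sum>i<?p. x ^ i * y ^ (?p - Suc i))"
    by (metis diff_add_cancel dvd_add dvd_triv_left)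
  moreover have "of_nat ?p ^ n dvd x - y" using assms(1) by (simp add: padic_cong_iff_dvd)
  ultimately have "of_nat ?p ^ n * of_nat ?p dvd (x - y) * (\<Sum>i<?p. x ^ i * y ^ (?p - Suc i))"
    by (rule mult_dvd_mono[rotated])
  moreover have "x ^ ?p - y ^ ?p = (x - y) * (\<Sum>i<?p. x ^ i * y ^ (?p - Suc i))"
    unfolding power_diff_sumr2 by (simp only: mult.commute)
  ultimately show ?thesis
    unfolding padic_cong_iff_dvd power_Suc2 by simp
qed

lemma padic_cong_power_p_power:
  fixes x y :: "'p::prime_card padic_int"
  assumes "padic_cong 1 x y"
  shows "padic_cong (Suc k) (x ^ (CARD('p) ^ k)) (y ^ (CARD('p) ^ k))"
proof (induction k)
  case (Suc k)
  have "padic_cong (Suc (Suc k)) ((x ^ (CARD('p) ^ k)) ^ CARD('p)) ((y ^ (CARD('p) ^ k)) ^ CARD('p))"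
    by (rule padic_cong_power_p[OF Suc]) simp
  then show ?case by (simp add: power_mult[symmetric] mult.commute)
qed (use assms in simp)

lemma of_int_mod_card: "(of_int (k mod int CARD('p)) :: 'p::prime_card mod_ring) = of_int k"
  unfolding of_int_of_int_mod_ring by transfer (rule mod_mod_trivial)

lemma padic_reduce_mult: "padic_reduce (x * y :: 'p::prime_card padic_int) = padic_reduce x * padic_reduce y"
  by (simp only: padic_reduce_def times_padic_int.rep_eq power_one_right of_int_mod_card of_int_mult)

lemma padic_reduce_power: "padic_reduce (x ^ n :: 'p::prime_card padic_int) = padic_reduce x ^ n"
  by (induction n) (simp_all only: padic_reduce_one padic_reduce_mult power_0 power_Suc)

lemma padic_reduce_of_int: "padic_reduce (of_int k :: 'p::prime_card padic_int) = of_int k"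
  by (simp only: padic_reduce_def padic_res_of_int power_one_right of_int_mod_card)

lemma padic_reduce_of_nat: "padic_reduce (of_nat k :: 'p::prime_card padic_int) = of_nat k"
  using padic_reduce_of_int[of "int k"] by simp

lemma padic_reduce_eq_iff: "padic_reduce (x :: 'p::prime_card padic_int) = padic_reduce y \<longleftrightarrow> padic_cong 1 x y"
proof
  assume "padic_reduce x = padic_reduce y"
  then have "to_int_mod_ring (of_int_mod_ring (padic_res x 1) :: 'p mod_ring) =
      to_int_mod_ring (of_int_mod_ring (padic_res y 1) :: 'p mod_ring)"
    by (simp only: padic_reduce_def of_int_of_int_mod_ring)
  moreover have "padic_res z 1 < int CARD('p)" for z :: "'p padic_int"
    using padic_res_bounds(2)[of z 1] by (simp only: power_one_right)
  ultimately show "padic_cong 1 x y"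
    unfolding padic_cong_def by (simp only: to_int_mod_ring_of_int_mod_ring padic_res_bounds(1))
qed (simp add: padic_reduce_def padic_cong_def)

lemma fermat_mod_ring:
  assumes "a \<noteq> (0 :: 'p::prime_card mod_ring)"
  shows "a ^ (CARD('p) - 1) = 1"
proof -
  \<comment> \<open>The inverse in this field is defined as the power with exponent p - 2, so
    Fermat's theorem is the law of inverses.\<close>
  have "inverse a * a = 1" using assms by simp
  then have "a ^ Suc (CARD('p) - 2) = 1" using assms by (simp add: inverse_mod_ring_def mult.commute)
  moreover have "Suc (CARD('p) - 2) = CARD('p) - 1" using p_gt_1[where 'p='p] by simp
  ultimately show ?thesis by simp
qed

lemma power_card_eq_self: "x ^ (CARD('p::prime_card) - 1) = 1 \<Longrightarrow> x ^ CARD('p) = (x :: 'a::comm_monoid_mult)"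
  using power_minus_mult[of "CARD('p)" x] by simp

lemma power_card_power_eq_self:
  assumes "x ^ CARD('p::prime_card) = (x :: 'a::comm_monoid_mult)"
  shows "x ^ (CARD('p) ^ k) = x"
  by (induction k) (simp_all add: power_mult assms)

text \<open>For a lift z of a the powers z^(p^n) converge, since each p-th power gains a digit.
  Their (p - 1)-st powers are the p^n-th powers of z^(p-1), which is 1 modulo p, and so tend to
  1.\<close>

lemma teichmuller_exists:
  assumes "a \<noteq> (0 :: 'p::prime_card mod_ring)"
  shows "\<exists>x. x ^ (CARD('p) - 1) = 1 \<and> padic_reduce x = a"
proof -
  let ?p = "CARD('p)"
  define z :: "'p padic_int" where "z = of_int (to_int_mod_ring a)"
  have z: "padic_reduce z = a" by (simp add: z_def padic_reduce_of_int of_int_of_int_mod_ring)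
  have "a ^ ?p = a" using fermat_mod_ring[OF assms] by (rule power_card_eq_self)
  then have zp: "padic_cong 1 (z ^ ?p) z"
    by (simp add: padic_reduce_eq_iff[symmetric] padic_reduce_power z del: One_nat_def)
  have "padic_cong (Suc n) (z ^ (?p ^ Suc n)) (z ^ (?p ^ n))" for n
    using padic_cong_power_p_power[OF zp, of n] by (simp only: power_mult power_Suc)
  then have "padic_cong n (z ^ (?p ^ Suc n)) (z ^ (?p ^ n))" for n
    by (rule padic_cong_mono) simp
  then have "\<exists>x. \<forall>n. padic_cong n x (z ^ (?p ^ n))"
    by (rule padic_limit)
  then obtain x where x: "\<And>n. padic_cong n x (z ^ (?p ^ n))" by blast
  have "padic_reduce x = padic_reduce (z ^ (?p ^ 1))"
    unfolding padic_reduce_eq_iff by (rule x)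
  then have red: "padic_reduce x = a" using \<open>a ^ ?p = a\<close> by (simp add: padic_reduce_power z)
  moreover have "x ^ (?p - 1) = 1"
  proof (rule padic_eqI)
    fix n
    have "padic_cong 1 (z ^ (?p - 1)) 1"
      by (simp add: padic_reduce_eq_iff[symmetric] padic_reduce_power z padic_reduce_one
          fermat_mod_ring[OF assms] del: One_nat_def)
    then have "padic_cong (Suc n) ((z ^ (?p - 1)) ^ (?p ^ n)) (1 ^ (?p ^ n))"
      by (rule padic_cong_power_p_power)
    moreover have "(z ^ (?p - 1)) ^ (?p ^ n) = (z ^ (?p ^ n)) ^ (?p - 1)"
      by (simp only: power_mult[symmetric] mult.commute)
    ultimately have "padic_cong n ((z ^ (?p ^ n)) ^ (?p - 1)) 1"
      by (simp only: power_one) (rule padic_cong_mono, assumption, simp)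
    then show "padic_cong n (x ^ (?p - 1)) 1"
      using padic_cong_power[OF x] padic_cong_trans by blast
  qed
  ultimately show ?thesis by blast
qed

text \<open>Raising to the power p^n fixes both elements, but improves a congruence modulo p to one
  modulo p^(n+1).\<close>

lemma teichmuller_unique:
  fixes x y :: "'p::prime_card padic_int"
  assumes "x ^ (CARD('p) - 1) = 1" "y ^ (CARD('p) - 1) = 1" "padic_cong 1 x y"
  shows "x = y"
proof (rule padic_eqI)
  fix n
  have *: "z ^ (CARD('p) ^ k) = z" if "z ^ (CARD('p) - 1) = 1" for z :: "'p padic_int" and k
    using power_card_power_eq_self[OF power_card_eq_self[OF that]] .
  show "padic_cong n x y"
    using padic_cong_power_p_power[OF assms(3), of n] padic_cong_mono[of "Suc n" x y n]
    by (simp add: *[OF assms(1)] *[OF assms(2)])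
qed

lemma
  assumes "a \<noteq> (0 :: 'p::prime_card mod_ring)"
  shows teichmuller_power_card: "teichmuller a ^ (CARD('p) - 1) = 1"
    and padic_reduce_teichmuller: "padic_reduce (teichmuller a) = a"
proof -
  have "\<exists>!x. x ^ (CARD('p) - 1) = 1 \<and> padic_reduce x = a"
    using teichmuller_exists[OF assms] by (rule ex_ex1I)
      (rule teichmuller_unique, auto simp: padic_reduce_eq_iff[symmetric] simp del: One_nat_def)
  from theI'[OF this] show "teichmuller a ^ (CARD('p) - 1) = 1" "padic_reduce (teichmuller a) = a"
    by (auto simp: teichmuller_def)
qed

lemma teichmuller_eqI:
  fixes x :: "'p::prime_card padic_int"
  assumes "x ^ (CARD('p) - 1) = 1" "padic_reduce x = a" "a \<noteq> 0"
  shows "teichmuller a = x"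
  by (rule teichmuller_unique)
    (use assms teichmuller_power_card padic_reduce_teichmuller in \<open>auto simp: padic_reduce_eq_iff[symmetric] simp del: One_nat_def\<close>)

lemma teichmuller_1 [simp]: "teichmuller (1 :: 'p::prime_card mod_ring) = 1"
  by (rule teichmuller_eqI) (simp_all add: padic_reduce_one)

lemma teichmuller_mult:
  "a \<noteq> 0 \<Longrightarrow> b \<noteq> 0 \<Longrightarrow> teichmuller (a * b :: 'p::prime_card mod_ring) = teichmuller a * teichmuller b"
  by (rule teichmuller_eqI)
    (simp_all add: power_mult_distrib teichmuller_power_card padic_reduce_mult padic_reduce_teichmuller del: One_nat_def)

lemma teichmuller_power:
  "a \<noteq> 0 \<Longrightarrow> teichmuller (a ^ n :: 'p::prime_card mod_ring) = teichmuller a ^ n"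
  by (induction n) (simp_all add: teichmuller_mult)

text \<open>The rate of convergence is needed for the multiplication formula, where powers of m with
  exponents divisible by p^N occur.\<close>

lemma teichmuller_of_nat_cong:
  assumes "\<not> CARD('p::prime_card) dvd m"
  shows "padic_cong (Suc n) (teichmuller (of_nat m :: 'p mod_ring)) (of_nat m ^ (CARD('p) ^ n))"
proof -
  have nz: "(of_nat m :: 'p mod_ring) \<noteq> 0"
  proof
    assume "(of_nat m :: 'p mod_ring) = 0"
    then have "padic_reduce (of_nat m :: 'p padic_int) = padic_reduce (of_nat 0)"
      by (simp only: padic_reduce_of_nat) (simp only: of_nat_0)
    then show False using assms
      unfolding padic_reduce_eq_iff padic_cong_of_nat_iff by (simp add: cong_0_iff)
  qed
  let ?t = "teichmuller (of_nat m :: 'p mod_ring)"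
  have "padic_cong 1 ?t (of_nat m)"
    unfolding padic_reduce_eq_iff[symmetric] padic_reduce_of_nat by (rule padic_reduce_teichmuller[OF nz])
  from padic_cong_power_p_power[OF this, of n] show ?thesis
    unfolding power_card_power_eq_self[OF power_card_eq_self[OF teichmuller_power_card[OF nz]]] .
qed

section \<open>Dwork coefficients and divided differences\<close>

lemma to_fract_power: "to_fract (x ^ n) = to_fract x ^ n"
  by (induction n) simp_all

text \<open>Membership in p^n Z_p, for n of either sign: a lower bound for the valuation that treats
  0 like every other element.\<close>

definition vge :: "int \<Rightarrow> 'p::prime_card padic \<Rightarrow> bool" where
  "vge n x \<longleftrightarrow> (\<exists>y. x = of_nat CARD('p) powi n * to_fract y)"

lemma vge_to_fract [simp]: "vge 0 (to_fract y)"
  by (auto simp: vge_def)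

lemma vge_0_iff: "vge 0 x \<longleftrightarrow> (\<exists>y. x = to_fract y)"
  by (auto simp: vge_def)

lemma vge_zero [simp]: "vge n 0"
  unfolding vge_def by (rule exI[of _ 0]) simp

lemma vge_add: "vge n x \<Longrightarrow> vge n y \<Longrightarrow> vge n (x + y)"
  unfolding vge_def by (metis distrib_left to_fract_add)

lemma vge_uminus: "vge n x \<Longrightarrow> vge n (- x)"
  unfolding vge_def by (metis mult_minus_right to_fract_uminus)

lemma vge_diff: "vge n x \<Longrightarrow> vge n y \<Longrightarrow> vge n (x - y)"
  using vge_add[of n x "- y"] vge_uminus[of n y] by simp

lemma vge_mult:
  assumes "vge m x" "vge n (y :: 'p::prime_card padic)"
  shows "vge (m + n) (x * y)"
proof -
  obtain u v where "x = of_nat CARD('p) powi m * to_fract u" "y = of_nat CARD('p) powi n * to_fract v"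
    using assms by (auto simp: vge_def)
  then have "x * y = of_nat CARD('p) powi (m + n) * to_fract (u * v)"
    by (simp add: power_int_add to_fract_mult mult_ac)
  then show ?thesis unfolding vge_def by blast
qed

lemma vge_p [simp]: "vge 1 (of_nat CARD('p) :: 'p::prime_card padic)"
  unfolding vge_def by (rule exI[of _ 1]) simp

lemma vge_powi: "vge n (of_nat CARD('p) powi n :: 'p::prime_card padic)"
  unfolding vge_def by (rule exI[of _ 1]) simp

lemma vge_mono:
  assumes "vge n (x :: 'p::prime_card padic)" "m \<le> n"
  shows "vge m x"
proof -
  obtain u where "x = of_nat CARD('p) powi n * to_fract u"
    using assms by (auto simp: vge_def)
  moreover have "(of_nat CARD('p) :: 'p padic) powi n = of_nat CARD('p) powi m * of_nat CARD('p) ^ nat (n - m)"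
    using assms(2) power_int_add[of "of_nat CARD('p) :: 'p padic" m "n - m"]
    by (simp add: power_int_def)
  ultimately have "x = of_nat CARD('p) powi m * to_fract (of_nat (CARD('p) ^ nat (n - m)) * u)"
    by (simp only: to_fract_mult to_fract_power of_nat_fract[symmetric] of_nat_power mult.assoc)
  then show ?thesis unfolding vge_def by blast
qed

lemma vge_of_nat [simp]: "vge 0 (of_nat k)"
  by (simp add: of_nat_fract)

lemma of_int_fract: "of_int k = to_fract (of_int k :: 'a::idom)"
  by (cases k rule: int_cases2) (simp_all add: of_nat_fract)

lemma vge_of_int [simp]: "vge 0 (of_int k)"
  by (simp add: of_int_fract)

lemma vge_1 [simp]: "vge 0 1"
  using vge_of_nat[of 1] by simp

lemma vge_sum: "(\<And>i. i \<in> A \<Longrightarrow> vge n (f i)) \<Longrightarrow> vge n (sum f A)"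
  by (induction A rule: infinite_finite_induct) (auto intro: vge_add)

lemma vge_power: "vge n x \<Longrightarrow> vge (int k * n) (x ^ k)"
proof (induction k)
  case (Suc k)
  then show ?case using vge_mult[of n x "int k * n" "x ^ k"] by (simp add: algebra_simps)
qed simp

lemma vge_mult_0: "vge n x \<Longrightarrow> vge 0 y \<Longrightarrow> vge n (x * y)" "vge 0 x \<Longrightarrow> vge n y \<Longrightarrow> vge n (x * y)"
  using vge_mult[of n x 0 y] vge_mult[of 0 x n y] by simp_all

lemma vge_p_power: "vge (int n) (of_nat CARD('p) ^ n :: 'p::prime_card padic)"
  using vge_powi[of "int n"] by (simp add: power_int_def)

lemma vge_to_fract_iff: "vge (int n) (to_fract y) \<longleftrightarrow> padic_cong n y (0 :: 'p::prime_card padic_int)"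
proof -
  have "vge (int n) (to_fract y) \<longleftrightarrow> (\<exists>z. to_fract y = to_fract (of_nat CARD('p) ^ n * z :: 'p padic_int))"
    by (simp add: vge_def power_int_def of_nat_fract to_fract_power)
  then show ?thesis unfolding padic_cong_0_iff_dvd dvd_def by (simp only: to_fract_eq_iff)
qed

lemma vge_diff_to_fract_iff:
  "vge (int n) (to_fract x - to_fract y) \<longleftrightarrow> padic_cong n x (y :: 'p::prime_card padic_int)"
  using vge_to_fract_iff[of n "x - y"] by (simp add: padic_cong_iff_dvd padic_cong_0_iff_dvd to_fract_diff)

lemma vge_all_imp_0:
  assumes "\<And>n::nat. vge (int n) (x :: 'p::prime_card padic)"
  shows "x = 0"
proof -
  obtain y where y: "x = to_fract y" using assms[of 0] by (auto simp: vge_0_iff)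
  have "y = 0" by (rule padic_eqI) (use assms vge_to_fract_iff y in blast)
  then show ?thesis by (simp add: y)
qed

lemma vge_inverse_unit:
  assumes "y dvd (1 :: 'p::prime_card padic_int)"
  shows "vge 0 (inverse (to_fract y))"
proof -
  obtain z where z: "y * z = 1" using assms by (auto simp: dvd_def)
  then have "to_fract y * to_fract z = 1" by (metis to_fract_mult to_fract_1)
  then have "inverse (to_fract y) = to_fract z" by (rule inverse_unique)
  then show ?thesis by simp
qed

lemma vge_inverse_of_nat:
  assumes "\<not> CARD('p::prime_card) dvd k"
  shows "vge 0 (inverse (of_nat k :: 'p padic))"
  unfolding of_nat_fract
  by (rule vge_inverse_unit)
    (use assms padic_cong_of_nat_iff[of 1 k 0, where 'p='p] in \<open>simp add: padic_dvd_1_iff cong_0_iff\<close>)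

lemma vge_of_nat_dvd:
  assumes "CARD('p::prime_card) ^ n dvd k"
  shows "vge (int n) (of_nat k :: 'p padic)"
  unfolding of_nat_fract vge_to_fract_iff
  using assms padic_cong_of_nat_iff[of n k 0, where 'p='p] by (simp add: cong_0_iff)

lemma not_dvd_prime_to_p_fact: "prime p \<Longrightarrow> \<not> p dvd prime_to_p_fact p k"
  by (induction k) (auto simp: prime_to_p_fact_Suc prime_dvd_mult_iff prime_gt_1_nat)

text \<open>With q = i div p, i! is a unit times p^q q!; by recursion its valuation is at most i/(p
  - 1).\<close>

lemma vge_inverse_fact:
  "vge (- int (i div (CARD('p) - 1))) (inverse (fact i) :: 'p::prime_card padic)"
proof (induction i rule: less_induct)
  case (less i)
  let ?p = "CARD('p)"
  show ?case
  proof (cases "i div ?p < i")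
    case False
    then have "i = 0" using p_gt_1[where 'p='p] by (metis div_less_dividend gr0I)
    then show ?thesis by simp
  next
    case True
    have "(fact i :: 'p padic) = of_nat (fact i)" by simp
    also have "\<dots> = of_nat (prime_to_p_fact ?p (Suc i)) * of_nat ?p ^ (i div ?p) * fact (i div ?p)"
      by (subst fact_prime_to_p[of ?p]) simp_all
    finally have eq: "inverse (fact i :: 'p padic) =
        inverse (of_nat (prime_to_p_fact ?p (Suc i))) * (of_nat ?p powi (- int (i div ?p)) * inverse (fact (i div ?p)))"
      by (simp add: power_int_def nonzero_inverse_mult_distrib mult_ac power_inverse)
    have v: "vge (- int (i div ?p) + - int ((i div ?p) div (?p - 1))) (inverse (fact i) :: 'p padic)"
      unfolding eq by (intro vge_mult_0(2) vge_mult vge_powi less[OF True] vge_inverse_of_nat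
          not_dvd_prime_to_p_fact prime_card)
    \<comment> \<open>With q = i div p: q + q div (p - 1) = (p q) div (p - 1), and p q \<le>
      i.\<close>
    have "i div ?p + (i div ?p) div (?p - 1) = (i div ?p + i div ?p * (?p - 1)) div (?p - 1)"
      using p_gt_1[where 'p='p] by simp
    also have "\<dots> = (i div ?p * ?p) div (?p - 1)"
      using p_gt_1[where 'p='p] by (simp add: algebra_simps diff_mult_distrib2)
    also have "\<dots> \<le> i div (?p - 1)" by (intro div_le_mono) simp
    finally show ?thesis by (intro vge_mono[OF v]) simp
  qed
qed

section \<open>The coefficients of the Dwork exponential\<close>

definition dwork_exp :: "'p::prime_card padic fps" where
  "dwork_exp = fps_exp 1 * (fps_exp (1 / of_nat CARD('p)) oo fps_X ^ CARD('p))"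

text \<open>Integer indices with value 0 below 0 make the recurrence hold without boundary
  cases.\<close>

definition dwork_coeff :: "int \<Rightarrow> 'p::prime_card padic" where
  "dwork_coeff m = (if m < 0 then 0 else fps_nth dwork_exp (nat m))"

lemma fps_exp_X_power_nth:
  assumes "k > 0"
  shows "fps_nth (fps_exp c oo fps_X ^ k) n = (if k dvd n then c ^ (n div k) / fact (n div k) else (0 :: 'a::field_char_0))"
  using assms by (simp add: fps_nth_compose_X_power)

text \<open>The logarithmic derivative of exp(X + X^p/p) is 1 + X^(p-1).\<close>

lemma dwork_coeff_rec:
  "of_int m * dwork_coeff m = dwork_coeff (m - 1) + (dwork_coeff (m - int CARD('p)) :: 'p::prime_card padic)"
proof (cases "m \<le> 0")
  case True
  then have "m = 0 \<or> m < 0" by auto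
  then show ?thesis using p_gt_1[where 'p='p] by (auto simp: dwork_coeff_def)
next
  case False
  let ?p = "CARD('p)"
  define n where "n = nat (m - 1)"
  have m: "m = int (Suc n)" using False by (simp add: n_def)
  have "fps_deriv (fps_exp (1 / of_nat ?p :: 'p padic) oo fps_X ^ ?p)
      = (fps_exp (1 / of_nat ?p) oo fps_X ^ ?p) * fps_X ^ (?p - 1)"
  proof -
    have X0: "fps_nth (fps_X ^ ?p :: 'p padic fps) 0 = 0" by (simp add: fps_X_power_iff)
    have "fps_deriv (fps_exp (1 / of_nat ?p :: 'p padic) oo fps_X ^ ?p) =
        (fps_const (1 / of_nat ?p) * fps_const (of_nat ?p)) * ((fps_exp (1 / of_nat ?p) oo fps_X ^ ?p) * fps_X ^ (?p - 1))"
      by (simp only: fps_compose_deriv[OF X0] fps_exp_deriv fps_compose_mult_distrib[OF X0] fps_const_compose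
          fps_deriv_power fps_deriv_fps_X mult_1_left mult_1_right mult_ac)
    also have "fps_const (1 / of_nat ?p) * fps_const (of_nat ?p) = (1 :: 'p padic fps)"
      by simp
    finally show ?thesis by simp
  qed
  then have "fps_deriv dwork_exp = dwork_exp + (dwork_exp * fps_X ^ (?p - 1) :: 'p padic fps)"
    by (simp add: dwork_exp_def algebra_simps)
  then have "fps_nth (fps_deriv dwork_exp) n = fps_nth (dwork_exp + dwork_exp * fps_X ^ (?p - 1) :: 'p padic fps) n"
    by simp
  then have "of_nat (Suc n) * fps_nth dwork_exp (Suc n) =
      fps_nth dwork_exp n + (if n < ?p - 1 then 0 else fps_nth (dwork_exp :: 'p padic fps) (n - (?p - 1)))"
    by (simp add: fps_X_power_mult_right_nth)
  moreover have "nat (int (Suc n) - int ?p) = n - (?p - 1)" using p_gt_1[where 'p='p] by simp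
  moreover have "int (Suc n) - int ?p < 0 \<longleftrightarrow> n < ?p - 1" using p_gt_1[where 'p='p] by auto
  ultimately show ?thesis unfolding m dwork_coeff_def by (simp only: of_int_of_nat_eq nat_int) simp
qed

text \<open>Since exp(X) is \<open>dwork_exp\<close> times exp(-X^p/p), comparing the coefficients
  of X^(a + p k) gives a Newton series in k. Its left-hand side is a reciprocal gamma value up to
  sign, so information on gamma values passes to Dwork coefficients.\<close>

lemma dwork_coeff_inversion:
  fixes a k :: nat
  assumes "a < CARD('p::prime_card)"
  shows "(- of_nat CARD('p)) ^ k * fact k / fact (a + CARD('p) * k) =
    (\<Sum>i\<le>k. of_nat (k choose i) * ((- of_nat CARD('p)) ^ i * fact i * (dwork_coeff (int (a + CARD('p) * i)) :: 'p padic)))"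
proof -
  let ?p = "CARD('p)"
  let ?P = "of_nat ?p :: 'p padic"
  let ?E = "\<lambda>c. fps_exp (c :: 'p padic) oo fps_X ^ ?p"
  have p0: "?p > 0" by simp
  have "?E (1 / ?P) * ?E (- (1 / ?P)) = (fps_exp (1 / ?P) * fps_exp (- (1 / ?P))) oo fps_X ^ ?p"
    by (simp add: fps_compose_mult_distrib fps_X_power_iff)
  also have "\<dots> = 1" by (simp flip: fps_exp_add_mult)
  finally have "fps_exp 1 = dwork_exp * ?E (- (1 / ?P))"
    by (simp add: dwork_exp_def mult.assoc)
  then have "fps_nth (fps_exp 1) (a + ?p * k) = fps_nth (?E (- (1 / ?P)) * dwork_exp) (a + ?p * k)"
    by (simp add: mult.commute)
  also have "\<dots> = (\<Sum>m=0..a + ?p * k. (if ?p dvd m then (- (1 / ?P)) ^ (m div ?p) / fact (m div ?p) else 0) * fps_nth dwork_exp (a + ?p * k - m))"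
    by (simp only: fps_mult_nth fps_exp_X_power_nth[OF p0])
  also have "\<dots> = (\<Sum>m\<in>{m\<in>{0..a + ?p * k}. ?p dvd m}. (- (1 / ?P)) ^ (m div ?p) / fact (m div ?p) * fps_nth dwork_exp (a + ?p * k - m))"
    by (rule sum.mono_neutral_cong_right) auto
  also have "\<dots> = (\<Sum>j\<in>{0..k}. (- (1 / ?P)) ^ j / fact j * fps_nth dwork_exp (a + ?p * (k - j)))"
  proof (rule sum.reindex_bij_witness[where i = "\<lambda>j. ?p * j" and j = "\<lambda>m. m div ?p"])
    fix m assume m: "m \<in> {m\<in>{0..a + ?p * k}. ?p dvd m}"
    then have "m div ?p \<le> (a + ?p * k) div ?p" by (intro div_le_mono) auto
    then show "m div ?p \<in> {0..k}" using assms by simp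
    then show "(- (1 / ?P)) ^ (m div ?p) / fact (m div ?p) * fps_nth dwork_exp (a + ?p * (k - m div ?p)) =
      (- (1 / ?P)) ^ (m div ?p) / fact (m div ?p) * fps_nth dwork_exp (a + ?p * k - m)"
      using m by (auto simp: diff_mult_distrib2)
  next
    fix j assume "j \<in> {0..k}"
    then have "?p * j \<le> ?p * k" by simp
    then have "?p * j \<le> a + ?p * k" by linarith
    then show "?p * j \<in> {m\<in>{0..a + ?p * k}. ?p dvd m}" by simp
  qed auto
  also have "\<dots> = (\<Sum>i\<le>k. (- (1 / ?P)) ^ (k - i) / fact (k - i) * fps_nth dwork_exp (a + ?p * i))"
    by (rule sum.reindex_bij_witness[where i = "\<lambda>i. k - i" and j = "\<lambda>j. k - j"]) auto
  finally have "1 / fact (a + ?p * k) = (\<Sum>i\<le>k. (- (1 / ?P)) ^ (k - i) / fact (k - i) * fps_nth dwork_exp (a + ?p * i))"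
    by simp
  then have "(- ?P) ^ k * fact k / fact (a + ?p * k) =
    (\<Sum>i\<le>k. (- ?P) ^ k * fact k * ((- (1 / ?P)) ^ (k - i) / fact (k - i) * fps_nth dwork_exp (a + ?p * i)))"
    by (simp add: sum_distrib_left[symmetric] divide_inverse)
  also have "\<dots> = (\<Sum>i\<le>k. of_nat (k choose i) * ((- ?P) ^ i * fact i * dwork_coeff (int (a + ?p * i))))"
  proof (rule sum.cong[OF refl])
    fix i assume "i \<in> {..k}"
    then have i: "i \<le> k" by simp
    have "(- ?P) ^ k = (- ?P) ^ i * (- ?P) ^ (k - i)" using i by (simp flip: power_add)
    moreover have "(- ?P) ^ (k - i) * (- (1 / ?P)) ^ (k - i) = 1"
      by (simp flip: power_mult_distrib)
    moreover have "(fact k :: 'p padic) / fact (k - i) = of_nat (k choose i) * fact i"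
      using i by (simp add: binomial_fact)
    moreover have "dwork_coeff (int (a + ?p * i)) = fps_nth (dwork_exp :: 'p padic fps) (a + ?p * i)"
      unfolding dwork_coeff_def nat_int by (simp del: of_nat_add of_nat_mult)
    ultimately show "(- ?P) ^ k * fact k * ((- (1 / ?P)) ^ (k - i) / fact (k - i) * fps_nth dwork_exp (a + ?p * i)) =
       of_nat (k choose i) * ((- ?P) ^ i * fact i * dwork_coeff (int (a + ?p * i)))"
      by (simp add: divide_inverse mult_ac)
  qed
  finally show ?thesis .
qed

text \<open>For i \<le> n the i-th difference of h has valuation at least (A + i)/2, rounded up.
  Half a power of p per difference is what the factor 1 + Q in the differences of
  \<open>dwork_gamma\<close> permits: its values and its first differences are both known to be
  divisible by p just once.\<close>

primrec diff_vge :: "nat \<Rightarrow> int \<Rightarrow> (nat \<Rightarrow> 'p::prime_card padic) \<Rightarrow> bool" where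
  "diff_vge 0 A h \<longleftrightarrow> (\<forall>k. vge ((A + 1) div 2) (h k))"
| "diff_vge (Suc n) A h \<longleftrightarrow> (\<forall>k. vge ((A + 1) div 2) (h k)) \<and> diff_vge n (A + 1) (\<lambda>k. h (Suc k) - h k)"

lemma diff_vge_value: "diff_vge n A h \<Longrightarrow> vge ((A + 1) div 2) (h k)"
  by (cases n) auto

lemma diff_vge_pred: "diff_vge (Suc n) A h \<Longrightarrow> diff_vge n A h"
proof (induction n arbitrary: A h)
  case (Suc n)
  have "diff_vge n (A + 1) (\<lambda>k. h (Suc k) - h k)"
    by (rule Suc.IH) (use Suc.prems in simp)
  then show ?case using Suc.prems by simp
qed simp

lemma diff_vge_shift: "diff_vge n A h \<Longrightarrow> diff_vge n A (\<lambda>k. h (Suc k))"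
  by (induction n arbitrary: A h) auto

lemma diff_vge_mono: "diff_vge n A h \<Longrightarrow> B \<le> A \<Longrightarrow> diff_vge n B h"
proof (induction n arbitrary: A B h)
  case 0
  have "(B + 1) div 2 \<le> (A + 1) div 2" using 0(2) by (intro zdiv_mono1) auto
  then show ?case using 0 vge_mono by (auto simp only: diff_vge.simps)
next
  case (Suc n)
  have "(B + 1) div 2 \<le> (A + 1) div 2" using Suc.prems(2) by (intro zdiv_mono1) auto
  moreover have "diff_vge n (B + 1) (\<lambda>k. h (Suc k) - h k)"
    by (rule Suc.IH[of "A + 1"]) (use Suc.prems in auto)
  ultimately show ?case using Suc.prems vge_mono by (auto simp only: diff_vge.simps)
qed

lemma diff_vge_zero [simp]: "diff_vge n A (\<lambda>_. 0)"
  by (induction n arbitrary: A) auto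

lemma diff_vge_const: "vge ((A + 1) div 2) c \<Longrightarrow> diff_vge n A (\<lambda>_. c)"
  by (cases n) auto

lemma diff_vge_add: "diff_vge n A g \<Longrightarrow> diff_vge n A h \<Longrightarrow> diff_vge n A (\<lambda>k. g k + h k)"
proof (induction n arbitrary: A g h)
  case (Suc n)
  have "diff_vge n (A + 1) (\<lambda>k. (g (Suc k) - g k) + (h (Suc k) - h k))"
    using Suc.prems by (intro Suc.IH) auto
  then show ?case using Suc.prems by (auto intro: vge_add simp: algebra_simps)
qed (auto intro: vge_add)

text \<open>The discrete Leibniz rule: the difference of g h is \<Delta>g times the shifted h, plus
  g times \<Delta>h. Rounding up is subadditive, so the weights add.\<close>

lemma diff_vge_mult:
  "diff_vge n A g \<Longrightarrow> diff_vge n B h \<Longrightarrow> diff_vge n (A + B) (\<lambda>k. g k * h k)"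
proof (induction n arbitrary: A B g h)
  case 0
  have "vge ((A + B + 1) div 2) (g k * h k)" for k
    by (rule vge_mono[OF vge_mult[OF diff_vge_value[OF 0(1)] diff_vge_value[OF 0(2)]]]) linarith
  then show ?case by simp
next
  case (Suc n)
  have v: "vge ((A + B + 1) div 2) (g k * h k)" for k
    by (rule vge_mono[OF vge_mult[OF diff_vge_value[OF Suc.prems(1)] diff_vge_value[OF Suc.prems(2)]]]) linarith
  have "diff_vge n (A + 1 + B) (\<lambda>k. (g (Suc k) - g k) * h (Suc k))"
    by (rule Suc.IH[OF _ diff_vge_shift[OF diff_vge_pred[OF Suc.prems(2)]]]) (use Suc.prems in simp)
  moreover have "diff_vge n (A + (B + 1)) (\<lambda>k. g k * (h (Suc k) - h k))"
    by (rule Suc.IH[OF diff_vge_pred[OF Suc.prems(1)]]) (use Suc.prems in simp)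
  ultimately have "diff_vge n (A + B + 1) (\<lambda>k. (g (Suc k) - g k) * h (Suc k) + g k * (h (Suc k) - h k))"
    by (intro diff_vge_add) (simp_all add: add_ac)
  then have "diff_vge n (A + B + 1) (\<lambda>k. g (Suc k) * h (Suc k) - g k * h k)"
    by (simp add: algebra_simps)
  then show ?case using v by simp
qed

text \<open>The coefficient \<beta> i is the i-th difference at 0; by Pascal's rule differencing
  shifts the coefficients by one.\<close>

lemma diff_vge_newton:
  "diff_vge n A (\<lambda>k. \<Sum>i\<le>k. of_nat (k choose i) * \<beta> i) \<Longrightarrow> i \<le> n \<Longrightarrow>
    vge ((A + int i + 1) div 2) (\<beta> i :: 'p::prime_card padic)"
proof (induction n arbitrary: A \<beta> i)
  case 0
  then show ?case using diff_vge_value[OF 0(1), of 0] by simp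
next
  case (Suc n)
  show ?case
  proof (cases i)
    case 0
    then show ?thesis using diff_vge_value[OF Suc.prems(1), of 0] by simp
  next
    case (Suc j)
    have "(\<Sum>i\<le>Suc k. of_nat (Suc k choose i) * \<beta> i) - (\<Sum>i\<le>k. of_nat (k choose i) * \<beta> i)
      = (\<Sum>i\<le>k. of_nat (k choose i) * \<beta> (Suc i))" for k
    proof -
      have "(\<Sum>i\<le>Suc k. of_nat (Suc k choose i) * \<beta> i) = \<beta> 0 + (\<Sum>i\<le>k. of_nat (Suc k choose Suc i) * \<beta> (Suc i))"
        by (simp add: sum.atMost_Suc_shift del: sum.atMost_Suc binomial_Suc_Suc)
      also have "\<dots> = (\<beta> 0 + (\<Sum>i\<le>k. of_nat (k choose Suc i) * \<beta> (Suc i))) + (\<Sum>i\<le>k. of_nat (k choose i) * \<beta> (Suc i))"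
        by (simp add: algebra_simps sum.distrib)
      also have "\<beta> 0 + (\<Sum>i\<le>k. of_nat (k choose Suc i) * \<beta> (Suc i)) = (\<Sum>i\<le>Suc k. of_nat (k choose i) * \<beta> i)"
        by (simp add: sum.atMost_Suc_shift del: sum.atMost_Suc)
      also have "\<dots> = (\<Sum>i\<le>k. of_nat (k choose i) * \<beta> i)" by simp
      finally show ?thesis by simp
    qed
    then have "diff_vge n (A + 1) (\<lambda>k. \<Sum>i\<le>k. of_nat (k choose i) * \<beta> (Suc i))"
      using Suc.prems(1) by simp
    from Suc.IH[OF this, of j] show ?thesis using Suc Suc.prems by (simp add: add_ac)
  qed
qed

text \<open>
  A product of factors \<open>c + p k\<close> has first differences divisible by p, and every further
  difference gains another factor p.
\<close>

lemma diff_vge_linear_prod: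
  fixes c :: "nat \<Rightarrow> nat" and s :: "nat \<Rightarrow> bool"
  assumes "finite A"
  defines "f \<equiv> \<lambda>j k. if s j then 1 else of_nat (c j + CARD('p::prime_card) * k) :: 'p padic"
  shows "diff_vge n 0 (\<lambda>k. \<Prod>j\<in>A. f j k)" (is "?V n A")
    and "diff_vge n 2 (\<lambda>k. (\<Prod>j\<in>A. f j (Suc k)) - (\<Prod>j\<in>A. f j k))" (is "?D n A")
proof -
  have Df: "f j (Suc k) - f j k = (if s j then 0 else of_nat CARD('p))" for j k
    by (simp add: f_def algebra_simps)
  have D1: "diff_vge n 2 (\<lambda>k. f j (Suc k) - f j k)" for j n
    unfolding Df by (cases "s j") (auto intro!: diff_vge_const)
  have V1: "diff_vge n 0 (\<lambda>k. f j k)" for j n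
  proof (cases n)
    case (Suc m)
    have "diff_vge m 1 (\<lambda>k. f j (Suc k) - f j k)" by (rule diff_vge_mono[OF D1]) simp
    then show ?thesis using Suc by (simp add: f_def del: of_nat_add of_nat_mult)
  qed (simp add: f_def del: of_nat_add of_nat_mult)
  have "(\<forall>n. ?V n A) \<and> (\<forall>n. ?D n A)"
    using assms(1)
  proof induction
    case empty
    then show ?case by (auto intro!: diff_vge_const)
  next
    case (insert x A)
    have V: "?V n (insert x A)" for n
      using diff_vge_mult[of n 0 "f x" 0 "\<lambda>k. \<Prod>j\<in>A. f j k"] V1[of n x] insert by simp
    have "?D n (insert x A)" for n
    proof -
      have "diff_vge n (2 + 0) (\<lambda>k. (f x (Suc k) - f x k) * (\<Prod>j\<in>A. f j (Suc k)))"
        using insert D1 by (intro diff_vge_mult diff_vge_shift[of n 0 "\<lambda>k. \<Prod>j\<in>A. f j k"]) auto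
      moreover have "diff_vge n (0 + 2) (\<lambda>k. f x k * ((\<Prod>j\<in>A. f j (Suc k)) - (\<Prod>j\<in>A. f j k)))"
        using insert V1 by (intro diff_vge_mult) auto
      ultimately have "diff_vge n 2 (\<lambda>k. (f x (Suc k) - f x k) * (\<Prod>j\<in>A. f j (Suc k)) +
          f x k * ((\<Prod>j\<in>A. f j (Suc k)) - (\<Prod>j\<in>A. f j k)))"
        using diff_vge_add by fastforce
      then show ?thesis using insert by (simp add: algebra_simps)
    qed
    then show ?case using V by simp
  qed
  then show "?V n A" "?D n A" by auto
qed

text \<open>For a < p this is (-1)^(a+1)/Gamma_p(1 + a + p k), written as the quotient to which
  \<open>dwork_coeff_inversion\<close> applies.\<close>

definition dwork_gamma :: "nat \<Rightarrow> nat \<Rightarrow> 'p::prime_card padic" where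
  "dwork_gamma a k = (- of_nat CARD('p)) ^ k * fact k / fact (a + CARD('p) * k)"

lemma to_fract_of_int: "to_fract (of_int k) = (of_int k :: 'a::idom fract)"
  by (rule of_int_fract[symmetric])

text \<open>The factors of (a + p k)! divisible by p make up p^k k!; the others form the gamma
  value. The sign (-1)^k of the numerator cancels against (-1)^(p k), p being odd.\<close>

lemma dwork_gamma_eq_Gamma:
  assumes odd_p: "odd CARD('p::prime_card)" and a: "a < CARD('p)"
  shows "dwork_gamma a k * to_fract (padic_Gamma (of_nat (1 + a + CARD('p) * k) :: 'p padic_int)) = (- 1) ^ (a + 1)"
proof -
  let ?p = "CARD('p)"
  let ?n = "a + ?p * k"
  define U where "U = prime_to_p_fact ?p (Suc ?n)"
  have dv: "?n div ?p = k" using a by simp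
  have "(fact ?n :: 'p padic) = of_nat (fact ?n)" by simp
  also have "\<dots> = of_nat U * of_nat ?p ^ k * fact k"
    by (subst fact_prime_to_p[of ?p]) (simp_all add: dv U_def del: fact_Suc)
  finally have f: "(fact ?n :: 'p padic) = of_nat U * of_nat ?p ^ k * fact k" .
  have U0: "(of_nat U :: 'p padic) \<noteq> 0" using f fact_nonzero[of ?n, where 'a="'p padic"] by auto
  have "(1 :: nat) + a + ?p * k = Suc ?n" by simp
  then have "to_fract (padic_Gamma (of_nat (1 + a + ?p * k) :: 'p padic_int)) = of_int ((- 1) ^ Suc ?n * int U)"
    by (simp only: padic_Gamma_of_nat[OF odd_p] to_fract_of_int U_def)
  also have "\<dots> = (- 1) ^ Suc ?n * of_nat U" by simp
  finally have G: "to_fract (padic_Gamma (of_nat (1 + a + ?p * k) :: 'p padic_int)) = ((- 1) ^ Suc ?n * of_nat U :: 'p padic)" .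
  have "dwork_gamma a k * to_fract (padic_Gamma (of_nat (1 + a + ?p * k) :: 'p padic_int)) =
      (- of_nat ?p) ^ k * (- 1) ^ Suc ?n / of_nat ?p ^ k"
    unfolding G dwork_gamma_def f using U0 by (simp add: field_simps)
  also have "\<dots> = (- 1) ^ k * (- 1) ^ Suc ?n"
    by (subst power_minus) (simp add: field_simps)
  also have "\<dots> = (- 1) ^ (a + 1) * ((- 1) ^ k * ((- 1) ^ ?p) ^ k)"
    by (simp add: power_add power_mult)
  also have "(- 1) ^ ?p = (- 1 :: 'p padic)" using odd_p by simp
  also have "(- 1) ^ k * (- 1) ^ k = (1 :: 'p padic)" by (simp flip: power_mult_distrib)
  finally show ?thesis by simp
qed

lemma dwork_gamma_vge:
  assumes "odd CARD('p::prime_card)" and "a < CARD('p)"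
  shows "vge 0 (dwork_gamma a k :: 'p padic)"
proof -
  let ?G = "padic_Gamma (of_nat (1 + a + CARD('p) * k) :: 'p padic_int)"
  have u: "?G dvd 1" by (rule padic_Gamma_unit[OF assms(1)])
  then have "to_fract ?G \<noteq> 0" by auto
  then have "(dwork_gamma a k :: 'p padic) = (- 1) ^ (a + 1) * inverse (to_fract ?G)"
    using dwork_gamma_eq_Gamma[OF assms, of k] by (simp add: field_simps)
  moreover have "vge 0 ((- 1) ^ (a + 1) * inverse (to_fract ?G))"
    using vge_mult_0(1)[of 0 "(- 1) ^ (a + 1)"] vge_inverse_unit[OF u] vge_of_int[of "(- 1) ^ (a + 1)"] by simp
  ultimately show ?thesis by simp
qed

text \<open>Among the p new factors of the larger factorial exactly one is divisible by p, namely p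
  (k + 1); it cancels, up to sign, against -p and (k + 1)!/k!.\<close>

lemma dwork_gamma_Suc:
  assumes a: "a < CARD('p::prime_card)"
  shows "dwork_gamma a k =
    - (\<Prod>j<CARD('p). if CARD('p) dvd (a + 1 + j) then 1 else of_nat (a + 1 + j + CARD('p) * k)) * (dwork_gamma a (Suc k) :: 'p padic)"
proof -
  let ?p = "CARD('p)"
  define Q where "Q = (\<Prod>j<?p. if ?p dvd (a + 1 + j) then 1 else of_nat (a + 1 + j + ?p * k) :: 'p padic)"
  have fact_add: "fact (n + m) = fact n * (\<Prod>j<m. of_nat (n + 1 + j) :: 'p padic)" for n m
    by (induction m) (simp_all add: mult_ac add_ac)
  let ?j = "?p - 1 - a"
  have j: "?j < ?p" "a + 1 + ?j = ?p" using a by auto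
  have uniq: "?p dvd (a + 1 + j) \<longleftrightarrow> j = ?j" if "j < ?p" for j
  proof
    assume "?p dvd (a + 1 + j)"
    then obtain c where c: "a + 1 + j = ?p * c" by (auto simp: dvd_def)
    moreover have "c \<noteq> 0" using c by (cases c) auto
    moreover have "\<not> c \<ge> 2"
    proof
      assume "c \<ge> 2"
      then have "?p * 2 \<le> ?p * c" by simp
      then show False using c a that by linarith
    qed
    ultimately have "c = 1" by linarith
    then show "j = ?j" using c a by simp
  qed (use a in simp)
  have "fact (a + ?p * Suc k) = fact (a + ?p * k) * (\<Prod>j<?p. of_nat (a + 1 + j + ?p * k) :: 'p padic)"
    using fact_add[of "a + ?p * k" ?p] by (simp add: add_ac)
  also have "(\<Prod>j<?p. of_nat (a + 1 + j + ?p * k) :: 'p padic) =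
     of_nat (a + 1 + ?j + ?p * k) * (\<Prod>j\<in>{..<?p} - {?j}. of_nat (a + 1 + j + ?p * k))"
    using j by (intro prod.remove) auto
  also have "(\<Prod>j\<in>{..<?p} - {?j}. of_nat (a + 1 + j + ?p * k) :: 'p padic) = Q"
    unfolding Q_def using uniq j(1) by (intro prod.mono_neutral_cong_left) auto
  also have "a + 1 + ?j + ?p * k = ?p * Suc k" using j by simp
  finally have f: "fact (a + ?p * Suc k) = fact (a + ?p * k) * (of_nat (?p * Suc k) * Q)" .
  then have "Q \<noteq> 0" using fact_nonzero[of "a + ?p * Suc k", where 'a="'p padic"] by (metis mult_zero_right)
  then have "dwork_gamma a k = - Q * (dwork_gamma a (Suc k) :: 'p padic)"
  proof -
    define M where "M = (of_nat (Suc k) :: 'p padic)"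
    have M: "M \<noteq> 0" "of_nat (?p * Suc k) = of_nat ?p * M" "fact (Suc k) = M * fact k"
      unfolding M_def by (simp_all only: of_nat_mult fact_Suc of_nat_eq_0_iff nat.distinct not_False_eq_True)
    show ?thesis
      unfolding dwork_gamma_def f M(2,3) using \<open>Q \<noteq> 0\<close> M(1) by (simp add: field_simps)
  qed
  then show ?thesis by (simp add: Q_def)
qed

text \<open>By the recursion the difference is \<open>(1 + Q k) * dwork_gamma a (Suc k)\<close>.
  Modulo p, Q k is the product of the nonzero residues, so Wilson's theorem makes 1 + Q k divisible
  by p.\<close>

lemma dwork_gamma_diff_vge:
  assumes odd_p: "odd CARD('p::prime_card)" and a: "a < CARD('p)"
  shows "diff_vge n 0 (dwork_gamma a :: nat \<Rightarrow> 'p padic)"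
proof (induction n)
  case 0
  then show ?case using dwork_gamma_vge[OF assms] by simp
next
  case (Suc n)
  let ?p = "CARD('p)"
  define Q where "Q = (\<lambda>k. \<Prod>j<?p. if ?p dvd (a + 1 + j) then 1 else of_nat (a + 1 + j + ?p * k) :: 'p padic)"
  have g: "dwork_gamma a k = - Q k * (dwork_gamma a (Suc k) :: 'p padic)" for k
    unfolding Q_def by (rule dwork_gamma_Suc[OF a])
  have Q1: "vge 1 (1 + Q k)" for k
  proof -
    define h where "h = (\<lambda>j. if ?p dvd j then 1 else int j)"
    have per: "[h (j + ?p) = h j] (mod int ?p)" for j by (simp add: h_def cong_def)
    have "[(\<Prod>j<?p. h (a + 1 + ?p * k + j)) = (\<Prod>j<?p. h j)] (mod int ?p)"
      by (rule prod_residues_shift[where g = h and q = ?p, OF per])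
    moreover have "[(\<Prod>j<?p. h j) = - 1] (mod int ?p)"
      using wilson_prime_power[OF prime_card[where 'a='p] odd_p, of 1] by (simp add: h_def)
    ultimately have "[(\<Prod>j<?p. h (a + 1 + ?p * k + j)) = - 1] (mod int ?p)" by (rule cong_trans)
    then have "padic_cong 1 (of_int (\<Prod>j<?p. h (a + 1 + ?p * k + j)) :: 'p padic_int) (of_int (- 1))"
      unfolding padic_cong_of_int_iff by simp
    then have "vge (int 1) (to_fract (of_int (\<Prod>j<?p. h (a + 1 + ?p * k + j))) - to_fract (of_int (- 1) :: 'p padic_int))"
      unfolding vge_diff_to_fract_iff .
    moreover have "of_int (\<Prod>j<?p. h (a + 1 + ?p * k + j)) = Q k"
      unfolding Q_def of_int_prod
    proof (rule prod.cong[OF refl])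
      fix j
      have e: "a + 1 + ?p * k + j = a + 1 + j + ?p * k" by simp
      have d: "?p dvd a + 1 + j + ?p * k \<longleftrightarrow> ?p dvd a + 1 + j" by (rule dvd_add_left_iff) simp
      show "of_int (h (a + 1 + ?p * k + j)) = (if ?p dvd (a + 1 + j) then 1 else of_nat (a + 1 + j + ?p * k) :: 'p padic)"
        unfolding h_def e d by (cases "?p dvd a + 1 + j") (simp_all only: if_True if_False of_int_1 of_int_of_nat_eq)
    qed
    ultimately have "vge (int 1) (Q k - of_int (- 1))" by (simp only: to_fract_of_int)
    then show ?thesis by (simp add: add.commute)
  qed
  have lin: "diff_vge n 0 Q" "diff_vge n 2 (\<lambda>k. Q (Suc k) - Q k)" for n
    unfolding Q_def by (rule diff_vge_linear_prod, simp)+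
  \<comment> \<open>The values alone would allow weight 2, but the differences are only known to
    have weight 2, where weight 3 would be required.\<close>
  have "diff_vge n 1 (\<lambda>k. 1 + Q k)"
  proof (cases n)
    case (Suc m)
    have "diff_vge m 2 (\<lambda>k. (1 + Q (Suc k)) - (1 + Q k))" using lin(2) by simp
    then show ?thesis using Suc Q1 by simp
  qed (use Q1 in simp)
  then have "diff_vge n (1 + 0) (\<lambda>k. (1 + Q k) * dwork_gamma a (Suc k))"
    by (rule diff_vge_mult) (rule diff_vge_shift[OF Suc.IH])
  moreover have "(1 + Q k) * dwork_gamma a (Suc k) = dwork_gamma a (Suc k) - dwork_gamma a k" for k
    unfolding g[of k] by (simp add: algebra_simps)
  ultimately show ?case using dwork_gamma_vge[OF assms] by simp
qed

text \<open>These are the Newton coefficients of \<open>dwork_gamma a\<close> up to sign. Estimating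
  the two exponential factors separately would only give the bound 0.\<close>

lemma dwork_coeff_newton_vge:
  assumes "odd CARD('p::prime_card)" and "a < CARD('p)"
  shows "vge ((int i + 1) div 2) (of_nat CARD('p) ^ i * fact i * (dwork_coeff (int (a + CARD('p) * i)) :: 'p padic))"
proof -
  let ?b = "\<lambda>i. (- of_nat CARD('p)) ^ i * fact i * (dwork_coeff (int (a + CARD('p) * i)) :: 'p padic)"
  have "dwork_gamma a = (\<lambda>k. \<Sum>i\<le>k. of_nat (k choose i) * ?b i)"
    unfolding dwork_gamma_def by (rule ext) (rule dwork_coeff_inversion[OF assms(2)])
  then have "vge ((0 + int i + 1) div 2) (?b i)"
    using dwork_gamma_diff_vge[OF assms, of i] by (intro diff_vge_newton[of i]) auto
  then have "vge ((int i + 1) div 2) ((- 1) ^ i * ?b i)"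
    using vge_mult_0(2)[of "(- 1) ^ i"] vge_of_int[of "(- 1) ^ i"] by simp
  moreover have "(- 1) ^ i * (- of_nat CARD('p)) ^ i = (of_nat CARD('p) ^ i :: 'p padic)"
    by (simp flip: power_mult_distrib)
  ultimately show ?thesis by (simp add: mult.assoc[symmetric])
qed

text \<open>Solved for the coefficient, with i = m div p: p^i costs i, the factorial costs i div (p
  - 1), and half of i, rounded up, is regained.\<close>

lemma dwork_coeff_vge_div:
  assumes "odd CARD('p::prime_card)"
  shows "vge (- int (m div CARD('p) div 2) - int (m div CARD('p) div (CARD('p) - 1))) (dwork_coeff (int m) :: 'p padic)"
proof -
  let ?p = "CARD('p)"
  define i where "i = m div ?p"
  have m: "m = m mod ?p + ?p * i" by (simp add: i_def)
  have "vge ((int i + 1) div 2) (of_nat ?p ^ i * fact i * (dwork_coeff (int m) :: 'p padic))"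
    using dwork_coeff_newton_vge[OF assms, of "m mod ?p" i] m by simp
  then have "vge ((- int i) + (- int (i div (?p - 1)) + (int i + 1) div 2))
     (of_nat ?p powi (- int i) * (inverse (fact i) * (of_nat ?p ^ i * fact i * (dwork_coeff (int m) :: 'p padic))))"
    by (intro vge_mult vge_powi vge_inverse_fact)
  moreover have "of_nat ?p powi (- int i) * (inverse (fact i) * (of_nat ?p ^ i * fact i * (dwork_coeff (int m) :: 'p padic))) = dwork_coeff (int m)"
  proof -
    have "of_nat ?p powi (- int i) * of_nat ?p ^ i = (1 :: 'p padic)" by (simp add: power_int_minus)
    moreover have "inverse (fact i) * fact i = (1 :: 'p padic)" by simp
    ultimately have "(of_nat ?p powi (- int i) * of_nat ?p ^ i) * (inverse (fact i) * fact i) * (dwork_coeff (int m) :: 'p padic) = dwork_coeff (int m)"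
      by (simp only: mult_1_left)
    then show ?thesis by (simp only: mult_ac)
  qed
  moreover have "(- int i) + (- int (i div (?p - 1)) + (int i + 1) div 2) = - int (i div 2) - int (i div (?p - 1))"
    by linarith
  ultimately show ?thesis unfolding i_def[symmetric] by (simp only:)
qed

text \<open>With s = p - 1 the preceding bound has slope (1/2 + 1/s)/(s + 1), and this is at most
  2/(3 s) exactly if s \<ge> 2, with equality for p = 3. A slope below 1/(p - 1) means convergence
  at \<pi>.\<close>

lemma dwork_coeff_vge:
  assumes odd_p: "odd CARD('p::prime_card)"
  shows "vge (- int (2 * m div (3 * (CARD('p) - 1)))) (dwork_coeff (int m) :: 'p padic)"
proof (rule vge_mono[OF dwork_coeff_vge_div[OF odd_p, of m]])
  let ?p = "CARD('p)"
  define s i where "s = ?p - 1" and "i = m div ?p"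
  have p3: "?p \<ge> 3" using p_gt_1[where 'p='p] odd_p by (cases "?p = 2") auto
  then have s: "s \<ge> 2" "?p = s + 1" by (auto simp: s_def)
  define x y where "x = i div 2" and "y = i div s"
  have "2 * x \<le> i" "s * y \<le> i" by (simp_all add: x_def y_def)
  then have "3 * s * (2 * x) + 6 * (s * y) \<le> 3 * s * i + 6 * i" by (intro add_mono mult_le_mono2)
  then have "6 * s * (x + y) \<le> (3 * s + 6) * i" by (simp only: distrib_left distrib_right mult_ac)
  also have "\<dots> \<le> (4 * (s + 1)) * i" using s by (intro mult_le_mono) auto
  also have "\<dots> \<le> 4 * m"
  proof -
    have "?p * i \<le> m" by (simp add: i_def)
    then show ?thesis unfolding s(2) by (simp add: algebra_simps)
  qed
  finally have "(x + y) * (3 * s) \<le> 2 * m" by (simp add: algebra_simps)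
  moreover have "3 * s > 0" using s by simp
  ultimately have "x + y \<le> 2 * m div (3 * s)" by (simp add: less_eq_div_iff_mult_less_eq)
  then have "int x + int y \<le> int (2 * m div (3 * s))" by linarith
  then show "- int (2 * m div (3 * (?p - 1))) \<le> - int (m div ?p div 2) - int (m div ?p div (?p - 1))"
    by (simp add: x_def y_def s_def i_def)
qed

section \<open>The Gross-Koblitz formula for Dwork coefficients\<close>

text \<open>
  The telescoping behind the trace formula: with \<open>a = (p - 1) \<alpha>\<close> the recurrence of the coefficients
  reads \<open>(p (\<alpha> + i) - (\<alpha> + l)) w(i, l) = w(i, l + 1) + w(i - 1, l)\<close> for
  \<open>w(i, l) = dwork_coeff (a + p i - l)\<close>; the weights \<open>p^i (-1)^l (\<alpha> + l + 1) \<dots> (\<alpha> + i - 1)\<close>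
  make everything cancel except the diagonal, the column \<open>l = 0\<close> and the last row.
\<close>

lemma dwork_coeff_trace:
  fixes \<alpha> :: "'p::prime_card padic" and a I :: nat
  defines "P \<equiv> of_nat CARD('p) :: 'p padic"
  assumes \<alpha>: "(P - 1) * \<alpha> = of_nat a"
  shows "(1 - P) * (\<Sum>i\<le>I. (- P) ^ i * dwork_coeff (int (a + (CARD('p) - 1) * i)))
     + P ^ Suc I * (\<Sum>l\<le>I. (- 1) ^ l * pochhammer (\<alpha> + of_nat (Suc l)) (I - l) * dwork_coeff (int (a + CARD('p) * I) - int l))
     = (\<Sum>i\<le>I. P ^ i * pochhammer \<alpha> i * dwork_coeff (int (a + CARD('p) * i)))"
proof (induction I)
  case 0
  then show ?case by (simp add: algebra_simps)
next
  case (Suc I)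
  let ?p = "CARD('p)"
  \<comment> \<open>W and w are the rows I + 1 and I. The recurrence is solved for row I, which
    pushes the remainder up by one row.\<close>
  define W where "W = (\<lambda>l. dwork_coeff (int (a + ?p * Suc I) - int l) :: 'p padic)"
  define c where "c = (\<lambda>l. pochhammer (\<alpha> + of_nat l) (Suc I - l))"
  define w where "w = (\<lambda>l. dwork_coeff (int (a + ?p * I) - int l) :: 'p padic)"
  have w: "w l = (P * (\<alpha> + of_nat (Suc I)) - (\<alpha> + of_nat l)) * W l - W (Suc l)" for l
  proof -
    let ?m = "int (a + ?p * Suc I) - int l"
    have e1: "?m - 1 = int (a + ?p * Suc I) - int (Suc l)" by simp
    have e2: "?m - int ?p = int (a + ?p * I) - int l" by simp
    have om: "(of_int ?m :: 'p padic) = P * (\<alpha> + of_nat (Suc I)) - (\<alpha> + of_nat l)"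
      using \<alpha> by (simp add: P_def algebra_simps)
    have "of_int ?m * W l = W (Suc l) + w l"
      unfolding W_def w_def e1[symmetric] e2[symmetric] by (rule dwork_coeff_rec)
    then have "w l = of_int ?m * W l - W (Suc l)" by simp
    then show ?thesis unfolding om .
  qed
  \<comment> \<open>These two identities split the weights of row I into the weights of row I + 1
    and a difference of consecutive terms in l.\<close>
  have c_rec: "c l = (\<alpha> + of_nat l) * c (Suc l)" if "l \<le> I" for l
    using that by (simp add: c_def Suc_diff_le pochhammer_rec add_ac)
  have c_step: "pochhammer (\<alpha> + of_nat (Suc l)) (Suc I - l) = c (Suc l) * (\<alpha> + of_nat (Suc I))" if "l \<le> I" for l
    using that by (simp add: c_def Suc_diff_le pochhammer_Suc add.assoc of_nat_diff)
  have S: "(\<Sum>l\<le>I. (- 1) ^ l * pochhammer (\<alpha> + of_nat (Suc l)) (I - l) * w l) =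
      (\<Sum>l\<le>I. P * ((- 1) ^ l * pochhammer (\<alpha> + of_nat (Suc l)) (Suc I - l) * W l) - ((- 1) ^ l * c l * W l - (- 1) ^ Suc l * c (Suc l) * W (Suc l)))"
  proof (rule sum.cong[OF refl])
    fix l assume "l \<in> {..I}"
    then have l: "l \<le> I" by simp
    have "pochhammer (\<alpha> + of_nat (Suc l)) (I - l) = c (Suc l)" by (simp add: c_def)
    then show "(- 1) ^ l * pochhammer (\<alpha> + of_nat (Suc l)) (I - l) * w l =
      P * ((- 1) ^ l * pochhammer (\<alpha> + of_nat (Suc l)) (Suc I - l) * W l) - ((- 1) ^ l * c l * W l - (- 1) ^ Suc l * c (Suc l) * W (Suc l))"
      unfolding w c_rec[OF l] c_step[OF l] by (simp add: algebra_simps)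
  qed
  also have "\<dots> = P * (\<Sum>l\<le>I. (- 1) ^ l * pochhammer (\<alpha> + of_nat (Suc l)) (Suc I - l) * W l)
      - (\<Sum>l\<le>I. (- 1) ^ l * c l * W l - (- 1) ^ Suc l * c (Suc l) * W (Suc l))"
    by (simp only: sum_subtractf sum_distrib_left)
  also have "(\<Sum>l\<le>I. (- 1) ^ l * c l * W l - (- 1) ^ Suc l * c (Suc l) * W (Suc l)) =
      (- 1) ^ 0 * c 0 * W 0 - (- 1) ^ Suc I * c (Suc I) * W (Suc I)"
    by (rule sum_telescope)
  finally have S: "(\<Sum>l\<le>I. (- 1) ^ l * pochhammer (\<alpha> + of_nat (Suc l)) (I - l) * w l) =
      P * (\<Sum>l\<le>I. (- 1) ^ l * pochhammer (\<alpha> + of_nat (Suc l)) (Suc I - l) * W l)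
      - pochhammer \<alpha> (Suc I) * W 0 + (- 1) ^ Suc I * W (Suc I)"
    by (simp add: c_def)
  define X where "X = (\<Sum>l\<le>I. (- 1) ^ l * pochhammer (\<alpha> + of_nat (Suc l)) (Suc I - l) * W l)"
  have X: "(\<Sum>l\<le>Suc I. (- 1) ^ l * pochhammer (\<alpha> + of_nat (Suc l)) (Suc I - l) * W l) = X + (- 1) ^ Suc I * W (Suc I)"
    by (simp add: X_def)
  have diag: "dwork_coeff (int (a + (?p - 1) * Suc I)) = W (Suc I)"
  proof -
    have "int (?p - 1) = int ?p - 1" using p_gt_1[where 'p='p] by simp
    then have "int (a + (?p - 1) * Suc I) = int (a + ?p * Suc I) - int (Suc I)"
      by (simp only: of_nat_add of_nat_mult) (simp add: algebra_simps)
    then show ?thesis by (simp only: W_def)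
  qed
  have col: "dwork_coeff (int (a + ?p * Suc I)) = W 0" by (simp add: W_def)
  have fold: "(\<Sum>l\<le>Suc I. (- 1) ^ l * pochhammer (\<alpha> + of_nat (Suc l)) (Suc I - l) * dwork_coeff (int (a + ?p * Suc I) - int l)) = X + (- 1) ^ Suc I * W (Suc I)"
    using X unfolding W_def .
  have mP: "(- P) ^ Suc I = (- 1) ^ Suc I * P ^ Suc I" by (rule power_minus)
  define T V where "T = (\<Sum>i\<le>I. (- P) ^ i * dwork_coeff (int (a + (?p - 1) * i)))"
    and "V = (\<Sum>i\<le>I. P ^ i * pochhammer \<alpha> i * dwork_coeff (int (a + ?p * i)))"
  have "(1 - P) * T + P ^ Suc I * (P * X - pochhammer \<alpha> (Suc I) * W 0 + (- 1) ^ Suc I * W (Suc I)) = V"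
    using Suc unfolding S[unfolded w_def] X_def T_def V_def .
  then have V: "V = (1 - P) * T + P ^ Suc I * (P * X - pochhammer \<alpha> (Suc I) * W 0 + (- 1) ^ Suc I * W (Suc I))" ..
  show ?case
    unfolding fold unfolding sum.atMost_Suc diag col mP T_def[symmetric] V_def[symmetric] unfolding V
    by (simp add: algebra_simps)
qed

text \<open>For natural y the quotient is a binomial coefficient. An approximation of y modulo p^i
  transfers the integrality, because the valuation of i! is at most i.\<close>

lemma pochhammer_vge:
  "vge 0 (pochhammer (to_fract y) i / (fact i :: 'p::prime_card padic))"
proof -
  obtain n where n: "padic_cong i y (of_nat n)" using padic_approx_nat by blast
  have poch: "to_fract (pochhammer z i) = pochhammer (to_fract z) i" for z :: "'p padic_int"
    by (induction i) (simp_all add: pochhammer_Suc of_nat_fract)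
  have "padic_cong i (pochhammer y k) (pochhammer (of_nat n) k)" for k
    by (induction k) (auto simp: pochhammer_Suc intro!: padic_cong_mult padic_cong_add n)
  then have "vge (int i) (pochhammer (to_fract y) i - pochhammer (to_fract (of_nat n)) i)"
    unfolding poch[symmetric] vge_diff_to_fract_iff .
  then have "vge (int i + - int (i div (CARD('p) - 1))) ((pochhammer (to_fract y) i - pochhammer (to_fract (of_nat n)) i) * inverse (fact i))"
    by (intro vge_mult vge_inverse_fact)
  then have 1: "vge 0 ((pochhammer (to_fract y) i - pochhammer (to_fract (of_nat n)) i) * inverse (fact i))"
    by (rule vge_mono) simp
  obtain m where m: "pochhammer (int n) i = fact i * m"
    using fact_dvd_pochhammer[of i "int n"] by (auto simp: dvd_def)
  have "pochhammer (to_fract (of_nat n)) i = (of_int (pochhammer (int n) i) :: 'p padic)"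
    by (simp add: of_nat_fract[symmetric] pochhammer_of_int[symmetric])
  then have "pochhammer (to_fract (of_nat n)) i * inverse (fact i) = (of_int m :: 'p padic)"
    by (simp add: m)
  then have "pochhammer (to_fract y) i / fact i =
      (pochhammer (to_fract y) i - pochhammer (to_fract (of_nat n)) i) * inverse (fact i) + (of_int m :: 'p padic)"
    by (simp add: algebra_simps divide_inverse)
  then show ?thesis using vge_add[OF 1 vge_of_int[of m]] by simp
qed

lemma p_power_dvd_fact: "p ^ (n div p) dvd (fact n :: nat)" if "p > 0"
  by (subst fact_prime_to_p[OF that]) simp

text \<open>The value of \<open>dwork_gamma a\<close> continued to k = -y, where (p - 1) y = a:
  there 1 + a + p k becomes 1 - y.\<close>

definition gauss_Gamma :: "nat \<Rightarrow> 'p::prime_card padic_int \<Rightarrow> 'p padic" where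
  "gauss_Gamma a y = (- 1) ^ (a + 1) / to_fract (padic_Gamma (1 - y))"

text \<open>The sum is the Newton series of \<open>dwork_gamma a\<close> at the p-adic point -y.
  Compared with a natural number k near -y there are three errors: the terms beyond I, the change of
  the Pochhammer symbols and the change of the gamma value.\<close>

lemma dwork_newton_sum_approx:
  fixes y :: "'p::prime_card padic_int" and a I N :: nat
  assumes odd_p: "odd CARD('p)" and a: "a < CARD('p)"
    and y: "(of_nat CARD('p) - 1) * y = of_nat a" and I: "I \<ge> 2 * N"
  shows "vge (int N) ((\<Sum>i\<le>I. of_nat CARD('p) ^ i * pochhammer (to_fract y) i * dwork_coeff (int (a + CARD('p) * i))) - gauss_Gamma a y)"
proof -
  let ?p = "CARD('p)"
  let ?P = "of_nat ?p :: 'p padic"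
  \<comment> \<open>N + I digits are needed, since \<open>B i\<close> with i \<le> I may have
    valuation as low as -i.\<close>
  define L where "L = N + I"
  define B where "B = (\<lambda>i. ?P ^ i * (dwork_coeff (int (a + ?p * i)) :: 'p padic))"
  obtain k where k: "padic_cong L (- y) (of_nat k)" "k \<ge> I"
    using padic_approx_pos_nat[of L "- y" I] by metis
  have Bf: "vge ((int i + 1) div 2) (fact i * B i)" for i
    using dwork_coeff_newton_vge[OF odd_p a, of i] by (simp add: B_def mult_ac)
  have B: "vge (- int i) (B i)" for i
  proof -
    have "vge (- int (i div (?p - 1)) + (int i + 1) div 2) (inverse (fact i) * (fact i * B i))"
      by (intro vge_mult vge_inverse_fact Bf)
    then have "vge (- int (i div (?p - 1)) + (int i + 1) div 2) (B i)"
      by (simp add: mult.assoc[symmetric])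
    moreover have "i div (?p - 1) \<le> i" by simp
    then have "- int i \<le> - int (i div (?p - 1)) + (int i + 1) div 2" by linarith
    ultimately show ?thesis by (rule vge_mono)
  qed
  have Bp: "vge ((int i + 1) div 2) (B i * pochhammer (to_fract z) i)" for i and z :: "'p padic_int"
  proof -
    have "vge ((int i + 1) div 2) ((fact i * B i) * (pochhammer (to_fract z) i / fact i))"
      by (rule vge_mult_0(1)[OF Bf pochhammer_vge])
    then show ?thesis by simp
  qed
  have kf: "(- of_nat k :: 'p padic) = to_fract (- of_nat k)" by (simp add: of_nat_fract)
  have g: "dwork_gamma a k = (\<Sum>i\<le>k. B i * pochhammer (- of_nat k) i)"
    unfolding dwork_gamma_def dwork_coeff_inversion[OF a]
  proof (rule sum.cong[OF refl])
    fix i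
    have "of_nat (k choose i) * fact i = ((- 1) ^ i * pochhammer (- of_nat k) i :: 'p padic)"
      by (simp add: binomial_gbinomial gbinomial_pochhammer)
    moreover have "(- ?P) ^ i = (- 1) ^ i * ?P ^ i" by (rule power_minus)
    moreover have "(- 1) ^ i * (- 1) ^ i = (1 :: 'p padic)" by (simp flip: power_mult_distrib)
    moreover have "of_nat (k choose i) * ((- ?P) ^ i * fact i * dwork_coeff (int (a + ?p * i))) =
        (of_nat (k choose i) * fact i) * (- ?P) ^ i * (dwork_coeff (int (a + ?p * i)) :: 'p padic)"
      by (simp only: mult_ac)
    ultimately have "of_nat (k choose i) * ((- ?P) ^ i * fact i * dwork_coeff (int (a + ?p * i))) =
        ((- 1) ^ i * pochhammer (- of_nat k) i) * ((- 1) ^ i * ?P ^ i) * (dwork_coeff (int (a + ?p * i)) :: 'p padic)"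
      by (simp only:)
    also have "\<dots> = ((- 1) ^ i * (- 1) ^ i) * (B i * pochhammer (- of_nat k) i)"
      by (simp only: B_def mult_ac)
    also have "\<dots> = B i * pochhammer (- of_nat k) i"
      using \<open>(- 1) ^ i * (- 1) ^ i = (1 :: 'p padic)\<close> by (simp only: mult_1_left)
    finally show "of_nat (k choose i) * ((- ?P) ^ i * fact i * dwork_coeff (int (a + ?p * i))) = B i * pochhammer (- of_nat k) i" .
  qed
  have split: "(\<Sum>i\<le>k. B i * pochhammer (- of_nat k) i) = (\<Sum>i\<le>I. B i * pochhammer (- of_nat k) i) + (\<Sum>i\<in>{I<..k}. B i * pochhammer (- of_nat k) i)"
    using k(2) by (subst sum.union_disjoint[symmetric]) (auto intro!: sum.cong)
  have tail: "vge (int N) (\<Sum>i\<in>{I<..k}. B i * pochhammer (- of_nat k) i)"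
  proof (rule vge_sum)
    fix i assume "i \<in> {I<..k}"
    then have "2 * N \<le> i" using I by auto
    then have "int N \<le> (int i + 1) div 2" by presburger
    then show "vge (int N) (B i * pochhammer (- of_nat k) i)"
      unfolding kf using Bp vge_mono by blast
  qed
  have head: "vge (int N) ((\<Sum>i\<le>I. B i * pochhammer (to_fract y) i) - (\<Sum>i\<le>I. B i * pochhammer (- of_nat k) i))"
    unfolding sum_subtractf[symmetric] right_diff_distrib[symmetric]
  proof (rule vge_sum)
    fix i assume i: "i \<in> {..I}"
    have poch: "to_fract (pochhammer z i) = pochhammer (to_fract z) i" for z :: "'p padic_int"
      by (induction i) (simp_all add: pochhammer_Suc of_nat_fract)
    have yk: "padic_cong L y (- of_nat k)" using padic_cong_uminus[OF k(1)] by simp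
    have "padic_cong L (pochhammer y j) (pochhammer (- of_nat k) j)" for j
    proof (induction j)
      case (Suc j)
      show ?case unfolding pochhammer_Suc by (intro padic_cong_mult padic_cong_add padic_cong_refl Suc yk)
    qed simp
    then have "vge (int L) (pochhammer (to_fract y) i - pochhammer (- of_nat k) i)"
      unfolding kf poch[symmetric] vge_diff_to_fract_iff .
    then have "vge (- int i + int L) (B i * (pochhammer (to_fract y) i - pochhammer (- of_nat k) i))"
      by (intro vge_mult B)
    then show "vge (int N) (B i * (pochhammer (to_fract y) i - pochhammer (- of_nat k) i))"
      by (rule vge_mono) (use i in \<open>simp add: L_def\<close>)
  qed
  let ?G1 = "padic_Gamma (of_nat (1 + a + ?p * k) :: 'p padic_int)"
  let ?G2 = "padic_Gamma (1 - y)"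
  have "padic_cong L (1 - y) (of_nat (1 + a + ?p * k))"
  proof -
    have "1 - y = 1 + (of_nat ?p - 1) * y + of_nat ?p * (- y)" by (simp add: algebra_simps)
    also have "\<dots> = 1 + of_nat a + of_nat ?p * (- y)" by (simp only: y)
    also have "padic_cong L \<dots> (1 + of_nat a + of_nat ?p * of_nat k)"
      by (intro padic_cong_add padic_cong_mult padic_cong_refl k)
    finally show ?thesis by (simp add: add.assoc)
  qed
  then have G: "vge (int L) (to_fract ?G2 - to_fract ?G1)"
    unfolding vge_diff_to_fract_iff by (rule padic_Gamma_cong[OF odd_p])
  have u: "?G1 dvd 1" "?G2 dvd 1" by (rule padic_Gamma_unit[OF odd_p])+
  then have nz: "to_fract ?G1 \<noteq> 0" "to_fract ?G2 \<noteq> 0" by auto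
  have g1: "dwork_gamma a k = (- 1) ^ (a + 1) / to_fract ?G1"
    unfolding nonzero_eq_divide_eq[OF nz(1)] by (rule dwork_gamma_eq_Gamma[OF odd_p a])
  have "dwork_gamma a k - gauss_Gamma a y =
      of_int ((- 1) ^ (a + 1)) * ((to_fract ?G2 - to_fract ?G1) * (inverse (to_fract ?G1) * inverse (to_fract ?G2)))"
  proof -
    have "e / u - e / v = e * ((v - u) * (inverse u * inverse v))" if "u \<noteq> 0" "v \<noteq> 0" for e u v :: "'p padic"
      using that by (simp add: field_simps)
    from this[OF nz, of "(- 1) ^ (a + 1)"] show ?thesis unfolding g1 gauss_Gamma_def by simp
  qed
  moreover have "vge (int L) \<dots>"
    using vge_mult_0(1)[OF vge_inverse_unit[OF u(1)] vge_inverse_unit[OF u(2)]]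
    by (intro vge_mult_0(2)[OF vge_of_int] vge_mult_0(1)[OF G])
  ultimately have last: "vge (int N) (dwork_gamma a k - gauss_Gamma a y)"
    by (simp only:) (rule vge_mono, assumption, simp add: L_def)
  have "(\<Sum>i\<le>I. ?P ^ i * pochhammer (to_fract y) i * dwork_coeff (int (a + ?p * i))) = (\<Sum>i\<le>I. B i * pochhammer (to_fract y) i)"
    by (intro sum.cong refl) (simp add: B_def mult_ac)
  then have eq: "(\<Sum>i\<le>I. ?P ^ i * pochhammer (to_fract y) i * dwork_coeff (int (a + ?p * i))) - gauss_Gamma a y =
      ((\<Sum>i\<le>I. B i * pochhammer (to_fract y) i) - (\<Sum>i\<le>I. B i * pochhammer (- of_nat k) i))
      - (\<Sum>i\<in>{I<..k}. B i * pochhammer (- of_nat k) i) + (dwork_gamma a k - gauss_Gamma a y)"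
    using g split by (simp add: algebra_simps)
  show ?thesis unfolding eq by (intro vge_add vge_diff head tail last)
qed

text \<open>The power p^(I+1) outweighs the denominators. As l grows from 0 to I, a gain of about (I
  - l)/p from the Pochhammer symbol is traded for a gain of about l/p from the smaller coefficient
  index; the total I/p explains the condition I \<ge> p (N + 1).\<close>

lemma dwork_trace_remainder:
  fixes y :: "'p::prime_card padic_int" and a I N :: nat
  assumes odd_p: "odd CARD('p)" and a: "a < CARD('p)" and I: "I \<ge> CARD('p) * (N + 1)"
  shows "vge (int N) (of_nat CARD('p) ^ Suc I * (\<Sum>l\<le>I. (- 1) ^ l * pochhammer (to_fract y + of_nat (Suc l)) (I - l) * dwork_coeff (int (a + CARD('p) * I) - int l)))"
  unfolding sum_distrib_left
proof (rule vge_sum)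
  let ?p = "CARD('p)"
  let ?P = "of_nat ?p :: 'p padic"
  fix l assume "l \<in> {..I}"
  then have l: "l \<le> I" by simp
  have p3: "?p \<ge> 3" using p_gt_1[where 'p='p] odd_p by (cases "?p = 2") auto
  define m where "m = a + ?p * I - l"
  have "I \<le> ?p * I" using p3 by simp
  then have ml: "l \<le> a + ?p * I" using l by linarith
  then have m: "int (a + ?p * I) - int l = int m" by (simp only: m_def of_nat_diff)
  define i where "i = m div ?p"
  define q where "q = (I - l) div ?p"
  have "vge (int q) (of_nat (fact (I - l)) :: 'p padic)"
    unfolding q_def by (intro vge_of_nat_dvd p_power_dvd_fact) simp
  then have "vge (int q) ((pochhammer (to_fract (y + of_nat (Suc l))) (I - l) / fact (I - l)) * of_nat (fact (I - l)))"
    by (rule vge_mult_0(2)[OF pochhammer_vge])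
  moreover have "to_fract (y + of_nat (Suc l)) = to_fract y + (of_nat (Suc l) :: 'p padic)"
    by (simp only: to_fract_add of_nat_fract)
  ultimately have "vge (int q) (pochhammer (to_fract y + of_nat (Suc l)) (I - l))" by simp
  then have "vge (int (Suc I) + (0 + int q + (- int (i div 2) - int (i div (?p - 1)))))
     (?P ^ Suc I * (of_int ((- 1) ^ l) * pochhammer (to_fract y + of_nat (Suc l)) (I - l) * dwork_coeff (int m)))"
    unfolding i_def by (intro vge_mult vge_p_power vge_of_int dwork_coeff_vge_div[OF odd_p])
  moreover have "int N \<le> int (Suc I) + (0 + int q + (- int (i div 2) - int (i div (?p - 1))))"
  proof -
    have "i div (?p - 1) \<le> i div 2" using p3 by (intro div_le_mono2) auto
    then have 1: "i div 2 + i div (?p - 1) \<le> i" by linarith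
    have 2: "?p * i \<le> a + ?p * I - l" unfolding i_def m_def by simp
    have "?p * q + (I - l) mod ?p = I - l" by (simp add: q_def)
    moreover have "(I - l) mod ?p < ?p" by simp
    ultimately have 3: "I - l < ?p * q + ?p" by linarith
    have "?p * (N + i) < ?p * (Suc I + q)"
    proof -
      have "?p * (N + i) + ?p + l \<le> I + (a + ?p * I)" using I 2 ml by (simp add: algebra_simps)
      then have "?p * (N + i) + ?p \<le> (I - l) + a + ?p * I" using l by linarith
      also have "\<dots> < (?p * q + ?p) + a + ?p * I" using 3 by linarith
      finally show ?thesis using a by (simp add: algebra_simps)
    qed
    then have "N + i < Suc I + q" by (simp only: mult_less_cancel1)
    then show ?thesis using 1 by linarith
  qed
  ultimately show "vge (int N) (?P ^ Suc I * ((- 1) ^ l * pochhammer (to_fract y + of_nat (Suc l)) (I - l) * dwork_coeff (int (a + ?p * I) - int l)))"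
    unfolding m by (rule_tac vge_mono[rotated]) simp_all
qed

text \<open>The limit of the sums in \<open>gauss_coeff_approx\<close>: the coefficient of \<pi>^a
  in the value of the Dwork exponential at \<pi>, reduced by \<pi>^(p-1) = -p.\<close>

definition gauss_coeff :: "nat \<Rightarrow> 'p::prime_card padic_int \<Rightarrow> 'p padic" where
  "gauss_coeff a y = gauss_Gamma a y / (1 - of_nat CARD('p))"

lemma vge_inverse_1_minus_p: "vge 0 (inverse (1 - of_nat CARD('p) :: 'p::prime_card padic))"
proof -
  have "\<not> CARD('p) dvd CARD('p) - 1"
    using p_gt_1[where 'p='p] by (auto dest: dvd_imp_le)
  then have "vge 0 (inverse (of_nat (CARD('p) - 1) :: 'p padic))" by (rule vge_inverse_of_nat)
  moreover have "(of_nat (CARD('p) - 1) :: 'p padic) = - (1 - of_nat CARD('p))"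
    using p_gt_1[where 'p='p] by (simp add: of_nat_diff)
  ultimately have "vge 0 (inverse (- (1 - of_nat CARD('p)) :: 'p padic))" by (simp only:)
  then show ?thesis using vge_uminus[of 0 "inverse (- (1 - of_nat CARD('p)) :: 'p padic)"]
    by (simp only: inverse_minus_eq minus_minus)
qed

lemma one_minus_p_nonzero: "(1 - of_nat CARD('p) :: 'p::prime_card padic) \<noteq> 0"
  using p_gt_1[where 'p='p] by (metis eq_iff_diff_eq_0 nat_neq_iff of_nat_1 of_nat_eq_iff)

lemma gauss_coeff_approx:
  fixes y :: "'p::prime_card padic_int" and a I N :: nat
  assumes odd_p: "odd CARD('p)" and a: "a < CARD('p)"
    and y: "(of_nat CARD('p) - 1) * y = of_nat a" and I: "I \<ge> 2 * N" "I \<ge> CARD('p) * (N + 1)"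
  shows "vge (int N) ((\<Sum>i\<le>I. (- of_nat CARD('p)) ^ i * dwork_coeff (int (a + (CARD('p) - 1) * i))) - gauss_coeff a y)"
proof -
  let ?P = "of_nat CARD('p) :: 'p padic"
  define T where "T = (\<Sum>i\<le>I. (- ?P) ^ i * dwork_coeff (int (a + (CARD('p) - 1) * i)))"
  define R where "R = ?P ^ Suc I * (\<Sum>l\<le>I. (- 1) ^ l * pochhammer (to_fract y + of_nat (Suc l)) (I - l) * dwork_coeff (int (a + CARD('p) * I) - int l))"
  define V where "V = (\<Sum>i\<le>I. ?P ^ i * pochhammer (to_fract y) i * dwork_coeff (int (a + CARD('p) * i)))"
  have "to_fract ((of_nat CARD('p) - 1) * y) = to_fract (of_nat a)" by (simp only: y)
  then have \<alpha>: "(?P - 1) * to_fract y = of_nat a" by (simp add: of_nat_fract)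
  have V: "(1 - ?P) * T + R = V" unfolding T_def R_def V_def by (rule dwork_coeff_trace[OF \<alpha>])
  have "vge (int N) (V - gauss_Gamma a y)"
    unfolding V_def by (rule dwork_newton_sum_approx[OF odd_p a y I(1)])
  moreover have "vge (int N) R" unfolding R_def by (rule dwork_trace_remainder[OF odd_p a I(2)])
  ultimately have *: "vge (int N) ((V - gauss_Gamma a y) - R)" by (rule vge_diff)
  then have "vge (int N) ((1 - ?P) * T - gauss_Gamma a y)" unfolding V[symmetric] by simp
  then have "vge (int N) (((1 - ?P) * T - gauss_Gamma a y) * inverse (1 - ?P))"
    by (intro vge_mult_0(1) vge_inverse_1_minus_p)
  moreover have "((1 - ?P) * T - gauss_Gamma a y) * inverse (1 - ?P) = T - gauss_coeff a y"
    using one_minus_p_nonzero[where 'p='p] by (simp add: gauss_coeff_def field_simps)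
  ultimately show ?thesis by (simp add: T_def)
qed

section \<open>Congruences modulo an Eisenstein polynomial\<close>

text \<open>
  In the field generated by a root \<open>\<pi>\<close> of \<open>X^(p-1) + p\<close>, of which \<open>\<pi>\<close> is a uniformizer,
  \<open>poly_vge r f\<close> says that every term of \<open>f(\<pi>)\<close> is divisible by \<open>\<pi>^r\<close>.
\<close>

definition poly_vge :: "int \<Rightarrow> 'p::prime_card padic poly \<Rightarrow> bool" where
  "poly_vge r f \<longleftrightarrow> (\<forall>m. vge (- ((int m - r) div (int CARD('p) - 1))) (coeff f m))"

definition eisenstein_poly :: "'p::prime_card padic poly" where
  "eisenstein_poly = monom 1 (CARD('p) - 1) + [:of_nat CARD('p):]"

definition qcong :: "'p::prime_card padic poly \<Rightarrow> 'p padic poly \<Rightarrow> bool" where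
  "qcong f g \<longleftrightarrow> eisenstein_poly dvd (f - g)"

lemma qcong_refl [simp]: "qcong f f"
  by (simp add: qcong_def)

lemma qcong_sym: "qcong f g \<Longrightarrow> qcong g f"
  unfolding qcong_def by (subst minus_diff_eq[symmetric]) (simp only: dvd_minus_iff)

lemma qcong_trans [trans]: "qcong f g \<Longrightarrow> qcong g h \<Longrightarrow> qcong f h"
  unfolding qcong_def using dvd_add[of eisenstein_poly "f - g" "g - h"] by simp

lemma qcong_add: "qcong f f' \<Longrightarrow> qcong g g' \<Longrightarrow> qcong (f + g) (f' + g')"
  unfolding qcong_def using dvd_add[of eisenstein_poly "f - f'" "g - g'"] by (simp add: algebra_simps)

lemma qcong_diff: "qcong f f' \<Longrightarrow> qcong g g' \<Longrightarrow> qcong (f - g) (f' - g')"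
  unfolding qcong_def using dvd_diff[of eisenstein_poly "f - f'" "g - g'"] by (simp add: algebra_simps)

lemma qcong_mult: "qcong f f' \<Longrightarrow> qcong g g' \<Longrightarrow> qcong (f * g) (f' * g')"
proof -
  assume "qcong f f'" "qcong g g'"
  then have "eisenstein_poly dvd (f - f') * g + f' * (g - g')"
    unfolding qcong_def by (intro dvd_add dvd_mult dvd_mult2)
  then show ?thesis unfolding qcong_def by (simp add: algebra_simps)
qed

lemma qcong_power: "qcong f g \<Longrightarrow> qcong (f ^ n) (g ^ n)"
  by (induction n) (auto intro: qcong_mult)

lemma qcong_smult: "qcong f g \<Longrightarrow> qcong (smult c f) (smult c g)"
  unfolding qcong_def by (subst smult_diff_right[symmetric]) (rule dvd_smult)

lemma qcong_sum: "(\<And>i. i \<in> A \<Longrightarrow> qcong (f i) (g i)) \<Longrightarrow> qcong (sum f A) (sum g A)"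
  by (induction A rule: infinite_finite_induct) (auto intro: qcong_add)

lemma qcong_monom:
  "qcong (monom c (a + (CARD('p) - 1) * i)) (monom (c * (- of_nat CARD('p)) ^ i) a :: 'p::prime_card padic poly)"
proof -
  let ?s = "CARD('p) - 1"
  have "qcong (monom 1 ?s) ([:- of_nat CARD('p):] :: 'p padic poly)"
    unfolding qcong_def eisenstein_poly_def
    by (simp only: diff_conv_add_uminus minus_pCons minus_minus minus_zero dvd_refl)
  then have "qcong (monom c a * monom 1 ?s ^ i) (monom c a * [:- of_nat CARD('p):] ^ i)"
    by (intro qcong_mult qcong_power qcong_refl)
  moreover have "monom c a * monom 1 ?s ^ i = monom c (a + ?s * i)"
    by (simp add: monom_power mult_monom)
  moreover have "monom c a * [:- of_nat CARD('p):] ^ i = monom (c * (- of_nat CARD('p)) ^ i) a"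
    by (simp add: poly_const_pow mult_ac smult_monom)
  ultimately show ?thesis by (simp only:)
qed

lemma degree_eisenstein_poly: "degree (eisenstein_poly :: 'p::prime_card padic poly) = CARD('p) - 1"
proof -
  have "CARD('p) - 1 > 0" using p_gt_1[where 'p='p] by simp
  then show ?thesis unfolding eisenstein_poly_def
    by (subst degree_add_eq_left) (simp_all add: degree_monom_eq)
qed

text \<open>A multiple of \<open>eisenstein_poly\<close> of degree below p - 1 vanishes. Reduced
  representatives are thus unique, and identities at \<pi> can be read off coefficientwise.\<close>

lemma qcong_reduced_eq:
  fixes f g :: "'p::prime_card padic poly"
  assumes "qcong f g" "\<And>m. m \<ge> CARD('p) - 1 \<Longrightarrow> coeff f m = 0" "\<And>m. m \<ge> CARD('p) - 1 \<Longrightarrow> coeff g m = 0"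
  shows "f = g"
proof (rule ccontr)
  assume "f \<noteq> g"
  then have nz: "f - g \<noteq> 0" by simp
  then have "degree (eisenstein_poly :: 'p padic poly) \<le> degree (f - g)"
    using assms(1) unfolding qcong_def by (intro dvd_imp_degree_le)
  then have "coeff (f - g) (degree (f - g)) = 0"
    using assms(2,3) unfolding degree_eisenstein_poly by simp
  then show False using nz by (simp only: leading_coeff_0_iff)
qed

lemma p_ge_3: "odd CARD('p::prime_card) \<Longrightarrow> CARD('p) \<ge> 3"
  using p_gt_1[where 'p='p] by (cases "CARD('p) = 2") auto

lemma s_pos: "0 < int CARD('p::prime_card) - 1"
  using p_gt_1[where 'p='p] by simp

lemma div_add_le:
  assumes "0 < (s :: int)"
  shows "a div s + b div s \<le> (a + b) div s"
proof -
  have "(a div s + b div s) * s \<le> a + b"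
    unfolding distrib_right minus_mod_eq_div_mult[symmetric]
    using pos_mod_sign[OF assms, of a] pos_mod_sign[OF assms, of b] by linarith
  then have "(a div s + b div s) * s div s \<le> (a + b) div s" using assms by (rule zdiv_mono1)
  then show ?thesis using assms by simp
qed

section \<open>Orders of polynomials at \<pi>\<close>

lemma poly_vge_0 [simp]: "poly_vge r 0"
  by (simp add: poly_vge_def)

lemma poly_vge_add: "poly_vge r f \<Longrightarrow> poly_vge r g \<Longrightarrow> poly_vge r (f + g)"
  by (simp add: poly_vge_def vge_add)

lemma poly_vge_uminus: "poly_vge r f \<Longrightarrow> poly_vge r (- f)"
  by (simp add: poly_vge_def vge_uminus)

lemma poly_vge_diff: "poly_vge r f \<Longrightarrow> poly_vge r g \<Longrightarrow> poly_vge r (f - g)"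
  by (simp add: poly_vge_def vge_diff)

lemma poly_vge_sum: "(\<And>i. i \<in> A \<Longrightarrow> poly_vge r (f i)) \<Longrightarrow> poly_vge r (sum f A)"
  by (induction A rule: infinite_finite_induct) (auto intro: poly_vge_add)

lemma poly_vge_mono:
  assumes "poly_vge r (f :: 'p::prime_card padic poly)" "t \<le> r"
  shows "poly_vge t f"
  unfolding poly_vge_def
proof
  fix m :: nat
  have "(int m - r) div (int CARD('p) - 1) \<le> (int m - t) div (int CARD('p) - 1)"
    using assms(2) s_pos[where 'p='p] by (intro zdiv_mono1) auto
  then show "vge (- ((int m - t) div (int CARD('p) - 1))) (coeff f m)"
    using assms(1) unfolding poly_vge_def by (meson vge_mono neg_le_iff_le)
qed

lemma poly_vge_mult:
  assumes "poly_vge r f" "poly_vge t (g :: 'p::prime_card padic poly)"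
  shows "poly_vge (r + t) (f * g)"
  unfolding poly_vge_def coeff_mult
proof (intro allI vge_sum)
  fix n i :: nat assume "i \<in> {..n}"
  then have i: "int (n - i) = int n - int i" by auto
  let ?s = "int CARD('p) - 1"
  have "vge (- ((int i - r) div ?s) + - ((int (n - i) - t) div ?s)) (coeff f i * coeff g (n - i))"
    using assms by (intro vge_mult) (auto simp: poly_vge_def)
  moreover have "(int i - r) div ?s + (int n - int i - t) div ?s \<le> ((int i - r) + (int n - int i - t)) div ?s"
    by (rule div_add_le[OF s_pos])
  ultimately show "vge (- ((int n - (r + t)) div ?s)) (coeff f i * coeff g (n - i))"
    unfolding i by (elim vge_mono) (simp add: algebra_simps)
qed

lemma poly_vge_monom:
  assumes "vge (- ((int m - r) div (int CARD('p) - 1))) (c :: 'p::prime_card padic)"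
  shows "poly_vge r (monom c m)"
  using assms by (auto simp: poly_vge_def coeff_monom)

lemma poly_vge_one [simp]: "poly_vge 0 (1 :: 'p::prime_card padic poly)"
  using poly_vge_monom[of 0 0 "1 :: 'p padic"] by (simp add: monom_0 one_pCons)

lemma poly_vge_power: "poly_vge r f \<Longrightarrow> poly_vge (int n * r) (f ^ n)"
proof (induction n)
  case (Suc n)
  then show ?case using poly_vge_mult[of r f "int n * r" "f ^ n"] by (simp add: algebra_simps)
qed simp

lemma poly_vge_power_0: "poly_vge 0 f \<Longrightarrow> poly_vge 0 (f ^ n)"
  using poly_vge_power[of 0 f n] by simp

lemma poly_vge_mult_0: "poly_vge 0 f \<Longrightarrow> poly_vge r g \<Longrightarrow> poly_vge r (f * g)" "poly_vge r f \<Longrightarrow> poly_vge 0 g \<Longrightarrow> poly_vge r (f * g)"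
  using poly_vge_mult[of 0 f r g] poly_vge_mult[of r f 0 g] by simp_all

lemma poly_vge_power_diff:
  assumes "poly_vge 0 f" "poly_vge 0 g" "poly_vge r (f - g)"
  shows "poly_vge r (f ^ n - g ^ n)"
proof (induction n)
  case (Suc n)
  have "f ^ Suc n - g ^ Suc n = f * (f ^ n - g ^ n) + (f - g) * g ^ n" by (simp add: algebra_simps)
  also have "poly_vge r \<dots>"
    by (intro poly_vge_add poly_vge_mult_0 assms Suc poly_vge_power_0)
  finally show ?case .
qed simp

text \<open>The prime p has order p - 1 at \<pi>.\<close>

lemma poly_vge_smult:
  assumes "vge n c" "poly_vge r (f :: 'p::prime_card padic poly)"
  shows "poly_vge (r + n * (int CARD('p) - 1)) (smult c f)"
  unfolding poly_vge_def
proof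
  fix m :: nat
  let ?s = "int CARD('p) - 1"
  have "vge (n + - ((int m - r) div ?s)) (c * coeff f m)"
    using assms by (intro vge_mult) (auto simp: poly_vge_def)
  moreover have "(int m - (r + n * ?s)) div ?s = (int m - r) div ?s - n"
  proof -
    have "int m - (r + n * ?s) = (int m - r) + (- n) * ?s" by simp
    then show ?thesis using s_pos[where 'p='p] by (simp only: div_mult_self1)
  qed
  ultimately show "vge (- ((int m - (r + n * ?s)) div ?s)) (coeff (smult c f) m)" by simp
qed

text \<open>Replacing X^(p-1) by -p lowers the exponent by p - 1 and adds a factor p to the
  coefficient, so the order at \<pi> is kept.\<close>

lemma poly_vge_reduce_monom:
  assumes "vge (- ((int m - r) div (int CARD('p) - 1))) (c :: 'p::prime_card padic)"
  obtains g where "\<And>k. k \<ge> CARD('p) - 1 \<Longrightarrow> coeff g k = 0" "poly_vge r g" "qcong (monom c m) g"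
proof -
  let ?s = "CARD('p) - 1"
  have s: "?s > 0" "int ?s = int CARD('p) - 1" using p_gt_1[where 'p='p] by auto
  let ?a = "m mod ?s" and ?i = "m div ?s"
  have "qcong (monom c (?a + ?s * ?i)) (monom (c * (- of_nat CARD('p)) ^ ?i) ?a)"
    by (rule qcong_monom)
  then have "qcong (monom c m) (monom (c * (- of_nat CARD('p)) ^ ?i) ?a)" by simp
  moreover have "poly_vge r (monom (c * (- of_nat CARD('p)) ^ ?i) ?a)"
  proof (rule poly_vge_monom)
    have "vge (int ?i * 1) ((- of_nat CARD('p) :: 'p padic) ^ ?i)"
      by (intro vge_power vge_uminus vge_p)
    then have "vge (- ((int m - r) div (int CARD('p) - 1)) + int ?i) (c * (- of_nat CARD('p)) ^ ?i)"
      using assms by (intro vge_mult) simp_all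
    moreover have "(int m - r) div int ?s = (int ?a - r) div int ?s + int ?i"
    proof -
      have "int m = int ?a + int ?i * int ?s" by (metis mod_div_mult_eq of_nat_add of_nat_mult)
      then have "int m - r = (int ?a - r) + int ?i * int ?s" by linarith
      then show ?thesis using s(1) by (simp only: div_mult_self1)
    qed
    ultimately show "vge (- ((int ?a - r) div (int CARD('p) - 1))) (c * (- of_nat CARD('p)) ^ ?i)"
      unfolding s(2)[symmetric] by simp
  qed
  moreover have "coeff (monom (c * (- of_nat CARD('p)) ^ ?i) ?a) k = 0" if "k \<ge> ?s" for k
    using that mod_less_divisor[OF s(1), of m] by (auto simp: coeff_monom simp del: One_nat_def)
  ultimately show ?thesis using that by blast
qed

lemma poly_vge_reduce:
  assumes "poly_vge r (f :: 'p::prime_card padic poly)"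
  obtains g where "\<And>k. k \<ge> CARD('p) - 1 \<Longrightarrow> coeff g k = 0" "poly_vge r g" "qcong f g"
proof -
  have "\<exists>g. (\<forall>k\<ge>CARD('p) - 1. coeff g k = 0) \<and> poly_vge r g \<and> qcong (\<Sum>i<n. monom (coeff f i) i) g" for n
  proof (induction n)
    case 0
    show ?case by (rule exI[of _ 0]) simp
  next
    case (Suc n)
    then obtain g where g: "\<forall>k\<ge>CARD('p) - 1. coeff g k = 0" "poly_vge r g" "qcong (\<Sum>i<n. monom (coeff f i) i) g"
      by blast
    have "vge (- ((int n - r) div (int CARD('p) - 1))) (coeff f n)" using assms by (simp add: poly_vge_def)
    then obtain h where h: "\<And>k. k \<ge> CARD('p) - 1 \<Longrightarrow> coeff h k = 0" "poly_vge r h" "qcong (monom (coeff f n) n) h"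
      by (rule poly_vge_reduce_monom) (rule that)
    show ?case
    proof (rule exI[of _ "g + h"], intro conjI allI impI)
      show "poly_vge r (g + h)" by (rule poly_vge_add[OF g(2) h(2)])
      show "qcong (\<Sum>i<Suc n. monom (coeff f i) i) (g + h)"
        unfolding sum.lessThan_Suc by (rule qcong_add[OF g(3) h(3)])
    qed (use g(1) h(1) in simp)
  qed
  from this[of "Suc (degree f)"] show ?thesis
    using that poly_as_sum_of_monoms[of f] by (auto simp: lessThan_Suc_atMost)
qed

text \<open>The reduced representative does not depend on n, by uniqueness; so its coefficients are
  divisible by every power of p. This plays the part of passing to the limit at \<pi>.\<close>

lemma qcong_0_if_poly_vge_all:
  fixes f :: "'p::prime_card padic poly"
  assumes "\<And>n :: nat. \<exists>e. poly_vge (int n) e \<and> qcong f e"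
  shows "qcong f 0"
proof -
  obtain e0 where "poly_vge (int 0) e0" "qcong f e0" using assms by blast
  then obtain g where g: "\<And>k. k \<ge> CARD('p) - 1 \<Longrightarrow> coeff g k = 0" "qcong f g"
    using poly_vge_reduce[of "int 0" e0] qcong_trans[of f e0] by metis
  have pv: "poly_vge (int n) g" for n
  proof -
    obtain e where e: "poly_vge (int n) e" "qcong f e" using assms by blast
    obtain h where h: "\<And>k. k \<ge> CARD('p) - 1 \<Longrightarrow> coeff h k = 0" "poly_vge (int n) h" "qcong e h"
      using poly_vge_reduce[OF e(1)] by blast
    have "qcong g h" using g(2) e(2) h(3) qcong_sym qcong_trans by blast
    then have "g = h" using g(1) h(1) by (rule qcong_reduced_eq)
    then show ?thesis using h(2) by simp
  qed
  have "coeff g m = 0" for m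
  proof (rule vge_all_imp_0)
    fix n :: nat
    let ?s = "int CARD('p) - 1"
    \<comment> \<open>The order n (p - 1) + m is chosen so that the bound for the m-th coefficient
      is exactly n.\<close>
    have "vge (- ((int m - int (n * (CARD('p) - 1) + m)) div ?s)) (coeff g m)"
      using pv[of "n * (CARD('p) - 1) + m"] by (simp only: poly_vge_def)
    moreover have "int m - int (n * (CARD('p) - 1) + m) = (- int n) * ?s"
      using p_gt_1[where 'p='p] by (simp add: of_nat_diff)
    moreover have "(- int n) * ?s div ?s = - int n"
      by (rule nonzero_mult_div_cancel_right) (use s_pos[where 'p='p] in simp)
    ultimately show "vge (int n) (coeff g m)" by (simp only: minus_minus)
  qed
  then have "g = 0" by (simp add: poly_eq_iff)
  then show ?thesis using g(2) by simp
qed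

text \<open>Order 2 costs a full factor p at the terms 1 and X, whose own orders 0 and 1 are too
  small, and nothing from X^2 on.\<close>

lemma poly_vge_2I:
  fixes f :: "'p::prime_card padic poly"
  assumes "odd CARD('p)" "vge 1 (coeff f 0)" "vge 1 (coeff f 1)" "\<And>m. m \<ge> 2 \<Longrightarrow> vge 0 (coeff f m)"
  shows "poly_vge 2 f"
  unfolding poly_vge_def
proof
  fix m :: nat
  let ?s = "int CARD('p) - 1"
  have s: "?s \<ge> 2" using p_ge_3[OF assms(1)] by simp
  consider "m = 0" | "m = 1" | "m \<ge> 2" by linarith
  then show "vge (- ((int m - 2) div ?s)) (coeff f m)"
  proof cases
    case 1
    have "(- 2) div ?s = - 1" using s by (intro int_div_pos_eq[where r = "?s - 2"]) auto
    then show ?thesis using 1 assms(2) by simp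
  next
    case 2
    have "(- 1) div ?s = - 1" using s by (intro int_div_pos_eq[where r = "?s - 1"]) auto
    then show ?thesis using 2 assms(3) by simp
  next
    case 3
    have "0 \<le> (int m - 2) div ?s" using 3 s by (simp add: pos_imp_zdiv_nonneg_iff)
    then show ?thesis using vge_mono[OF assms(4)[OF 3]] by simp
  qed
qed

text \<open>For u = 1 + z, dividing u^p - 1 by p leaves z + z w with w of order at least 2. Hence z
  equals -w z at \<pi>, and iterating this makes z arbitrarily small. Order 2 is the right
  threshold: the other p-th roots of unity differ from 1 by order 1.\<close>

lemma qcong_1_if_root_of_unity:
  fixes u :: "'p::prime_card padic poly"
  assumes odd_p: "odd CARD('p)" and root: "qcong (u ^ CARD('p)) 1" and u: "poly_vge 2 (u - 1)"
  shows "qcong u 1"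
proof -
  let ?p = "CARD('p)"
  let ?P = "of_nat ?p :: 'p padic"
  have p3: "?p \<ge> 3" by (rule p_ge_3[OF odd_p])
  define z where "z = u - 1"
  have z: "poly_vge 2 z" using u by (simp add: z_def)
  have z0: "poly_vge 0 z" by (rule poly_vge_mono[OF z]) simp
  define w where "w = (\<Sum>k\<in>{2..?p}. smult (of_nat (?p choose k) / ?P) (z ^ (k - 1)))"
  have w: "poly_vge 2 w"
    unfolding w_def
  proof (rule poly_vge_sum)
    fix k assume k: "k \<in> {2..?p}"
    have zk: "poly_vge (int (k - 1) * 2) (z ^ (k - 1))" by (rule poly_vge_power[OF z])
    show "poly_vge 2 (smult (of_nat (?p choose k) / ?P) (z ^ (k - 1)))"
    proof (cases "k = ?p")
      case True
      \<comment> \<open>For k = p the division by p takes p - 1 from the order 2 (p - 1); what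
        remains is p - 1 \<ge> 2.\<close>
      have "vge (- 1) (of_nat (?p choose k) / ?P)"
        using vge_powi[of "- 1", where 'p='p] True by (simp add: power_int_def divide_inverse)
      from poly_vge_smult[OF this zk]
      show ?thesis by (rule poly_vge_mono) (use True p3 in \<open>simp add: of_nat_diff\<close>)
    next
      case False
      then have "?p dvd (?p choose k)" using k prime_card[where 'a='p] by (intro dvd_choose_prime) auto
      then obtain c where "?p choose k = ?p * c" by (auto simp: dvd_def)
      then have "of_nat (?p choose k) / ?P = of_nat c" by simp
      then have "vge 0 (of_nat (?p choose k) / ?P)" by simp
      from poly_vge_smult[OF this zk]
      show ?thesis by (rule poly_vge_mono) (use k in simp)
    qed
  qed
  have "u ^ ?p = (z + 1) ^ ?p" by (simp add: z_def)
  also have "\<dots> = (\<Sum>k\<le>?p. of_nat (?p choose k) * z ^ k)" by (simp add: binomial_ring)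
  also have "{..?p} = insert 0 (insert 1 {2..?p})" using p3 by auto
  also have "(\<Sum>k\<in>insert 0 (insert 1 {2..?p}). of_nat (?p choose k) * z ^ k) =
      1 + (of_nat ?p * z + (\<Sum>k\<in>{2..?p}. of_nat (?p choose k) * z ^ k))"
    by (subst sum.insert; simp)+
  also have "(\<Sum>k\<in>{2..?p}. of_nat (?p choose k) * z ^ k) = smult ?P (z * w)"
    unfolding w_def sum_distrib_left smult_sum2
  proof (rule sum.cong[OF refl])
    fix k assume "k \<in> {2..?p}"
    then have "z * z ^ (k - 1) = z ^ k" by (cases k) auto
    then show "of_nat (?p choose k) * z ^ k = smult ?P (z * smult (of_nat (?p choose k) / ?P) (z ^ (k - 1)))"
      by (simp add: of_nat_poly)
  qed
  finally have "u ^ ?p - 1 = smult ?P (z + z * w)"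
    by (simp add: smult_add_right of_nat_poly)
  then have "eisenstein_poly dvd smult ?P (z + z * w)" using root by (simp add: qcong_def)
  then have "eisenstein_poly dvd z + z * w" by (simp add: dvd_smult_iff)
  then have zw: "qcong z (- w * z)" unfolding qcong_def by (simp add: mult.commute)
  have "\<exists>e. poly_vge (int n * 2) e \<and> qcong z e" for n
  proof (induction n)
    case 0
    show ?case using z0 by auto
  next
    case (Suc n)
    then obtain e where e: "poly_vge (int n * 2) e" "qcong z e" by blast
    have "poly_vge (2 + int n * 2) (- w * e)" by (intro poly_vge_mult poly_vge_uminus w e)
    moreover have "qcong z (- w * e)"
      by (rule qcong_trans[OF zw]) (intro qcong_mult qcong_refl e)
    ultimately show ?case by (auto simp: algebra_simps)
  qed
  then have "\<exists>e. poly_vge (int n) e \<and> qcong z e" for n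
    using poly_vge_mono[of "int n * 2" _ "int n"] by fastforce
  then have "qcong z 0" by (rule qcong_0_if_poly_vge_all)
  then show ?thesis by (simp add: qcong_def z_def)
qed

section \<open>Gauss sums\<close>

text \<open>
  Polynomials whose coefficients satisfy this bound form a ring, and those of them with only terms
  of high degree are small.
\<close>

definition growth_bounded :: "'p::prime_card padic poly \<Rightarrow> bool" where
  "growth_bounded f \<longleftrightarrow> (\<forall>m. vge (- int (2 * m div (3 * (CARD('p) - 1)))) (coeff f m))"

lemma growth_bounded_diff: "growth_bounded f \<Longrightarrow> growth_bounded g \<Longrightarrow> growth_bounded (f - g)"
  by (simp add: growth_bounded_def vge_diff)

lemma growth_bounded_one [simp]: "growth_bounded (1 :: 'p::prime_card padic poly)"
proof -
  have "vge (- int k) (coeff 1 m :: 'p padic)" for k m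
    using vge_mono[OF vge_1, of "- int k", where 'p='p] by (simp add: coeff_1)
  then show ?thesis by (simp add: growth_bounded_def)
qed

lemma growth_bounded_mult:
  assumes "growth_bounded f" "growth_bounded (g :: 'p::prime_card padic poly)"
  shows "growth_bounded (f * g)"
  unfolding growth_bounded_def coeff_mult
proof (intro allI vge_sum)
  fix n i :: nat assume "i \<in> {..n}"
  then have i: "i \<le> n" by simp
  let ?t = "3 * (CARD('p) - 1)"
  have "vge (- int (2 * i div ?t) + - int (2 * (n - i) div ?t)) (coeff f i * coeff g (n - i))"
    using assms by (intro vge_mult) (auto simp: growth_bounded_def)
  moreover have "2 * i div ?t + 2 * (n - i) div ?t \<le> 2 * n div ?t"
  proof -
    have "2 * i div ?t + 2 * (n - i) div ?t \<le> (2 * i + 2 * (n - i)) div ?t"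
      by (subst div_add1_eq[of "2 * i"]) simp
    moreover have "2 * i + 2 * (n - i) = 2 * n" using i by simp
    ultimately show ?thesis by (simp only:)
  qed
  then have "- int (2 * n div ?t) \<le> - int (2 * i div ?t) + - int (2 * (n - i) div ?t)" by linarith
  ultimately show "vge (- int (2 * n div ?t)) (coeff f i * coeff g (n - i))" by (rule vge_mono)
qed

lemma growth_bounded_power: "growth_bounded f \<Longrightarrow> growth_bounded (f ^ n)"
  by (induction n) (auto intro: growth_bounded_mult)

text \<open>In degree m the coefficient loses at most 2m/3 in order, so m/3 is left, which is at
  least r from degree 3 r on.\<close>

lemma growth_bounded_imp_poly_vge:
  assumes "growth_bounded (f :: 'p::prime_card padic poly)" "\<And>m. m < 3 * r \<Longrightarrow> coeff f m = 0"
  shows "poly_vge (int r) f"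
  unfolding poly_vge_def
proof
  fix m :: nat
  let ?s = "CARD('p) - 1"
  have s: "int CARD('p) - 1 = int ?s" using p_gt_1[where 'p='p] by simp
  show "vge (- ((int m - int r) div (int CARD('p) - 1))) (coeff f m)"
  proof (cases "m < 3 * r")
    case False
    then have "2 * m div (3 * ?s) \<le> (3 * (m - r)) div (3 * ?s)" by (intro div_le_mono) linarith
    then have "2 * m div (3 * ?s) \<le> (m - r) div ?s" by simp
    moreover have "(int m - int r) div int ?s = int ((m - r) div ?s)"
      using False by (simp add: zdiv_int of_nat_diff)
    ultimately have "- ((int m - int r) div int ?s) \<le> - int (2 * m div (3 * ?s))" by linarith
    then show ?thesis
      unfolding s using assms(1) by (rule_tac vge_mono[of "- int (2 * m div (3 * ?s))"]) (auto simp: growth_bounded_def)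
  qed (use assms(2) in simp)
qed

definition trunc_poly :: "nat \<Rightarrow> 'a::comm_ring_1 fps \<Rightarrow> 'a poly" where
  "trunc_poly L F = (\<Sum>m<L. monom (fps_nth F m) m)"

lemma coeff_trunc_poly: "coeff (trunc_poly L F) m = (if m < L then fps_nth F m else 0)"
  by (simp add: trunc_poly_def coeff_sum coeff_monom)

text \<open>Products of truncations are no truncations, but they still have the right low
  coefficients.\<close>

definition agree_below :: "nat \<Rightarrow> 'a::comm_ring_1 poly \<Rightarrow> 'a fps \<Rightarrow> bool" where
  "agree_below L f F \<longleftrightarrow> (\<forall>m<L. coeff f m = fps_nth F m)"

lemma agree_below_trunc_poly [simp]: "agree_below L (trunc_poly L F) F"
  by (simp add: agree_below_def coeff_trunc_poly)

lemma agree_below_mult: "agree_below L f F \<Longrightarrow> agree_below L g G \<Longrightarrow> agree_below L (f * g) (F * G)"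
  unfolding agree_below_def coeff_mult fps_mult_nth
  by (auto intro!: sum.cong simp: atLeast0AtMost)

lemma agree_below_one [simp]: "agree_below L 1 1"
  by (simp add: agree_below_def coeff_1)

lemma agree_below_power: "agree_below L f F \<Longrightarrow> agree_below L (f ^ n) (F ^ n)"
  by (induction n) (auto intro: agree_below_mult)

text \<open>This transports identities of power series to \<pi>: different polynomial approximations
  of one series differ by a polynomial of high order.\<close>

lemma agree_below_imp_poly_vge:
  assumes "growth_bounded f" "growth_bounded g" "agree_below (3 * r) f F" "agree_below (3 * r) g F"
  shows "poly_vge (int r) (f - g)"
  using assms by (intro growth_bounded_imp_poly_vge growth_bounded_diff) (auto simp: agree_below_def)

lemma growth_bounded_trunc_exp:
  assumes "odd CARD('p::prime_card)" and "c = of_nat CARD('p) \<or> c = - of_nat CARD('p)"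
  shows "growth_bounded (trunc_poly L (fps_exp (c :: 'p padic)))"
  unfolding growth_bounded_def
proof
  fix m :: nat
  have "vge 1 c" using assms(2) vge_uminus[OF vge_p] by auto
  then have "vge (int m * 1 + - int (m div (CARD('p) - 1))) (c ^ m * inverse (fact m))"
    by (intro vge_mult vge_power vge_inverse_fact)
  moreover have "m div (CARD('p) - 1) \<le> m" by simp
  then have "- int (2 * m div (3 * (CARD('p) - 1))) \<le> int m * 1 + - int (m div (CARD('p) - 1))" by linarith
  ultimately have "vge (- int (2 * m div (3 * (CARD('p) - 1)))) (c ^ m * inverse (fact m))" by (rule vge_mono)
  then show "vge (- int (2 * m div (3 * (CARD('p) - 1)))) (coeff (trunc_poly L (fps_exp c)) m)"
    by (simp add: coeff_trunc_poly divide_inverse)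
qed

lemma growth_bounded_trunc_exp_X_power:
  assumes odd_p: "odd CARD('p::prime_card)"
  shows "growth_bounded (trunc_poly L (fps_exp 1 oo fps_X ^ CARD('p)) :: 'p padic poly)"
  unfolding growth_bounded_def
proof
  fix m :: nat
  let ?p = "CARD('p)"
  have "vge (- int (2 * m div (3 * (?p - 1)))) (fps_nth (fps_exp 1 oo fps_X ^ ?p :: 'p padic fps) m)"
  proof (cases "?p dvd m")
    case True
    then obtain j where j: "m = ?p * j" by (auto simp: dvd_def)
    have "3 * j \<le> 2 * m" using p_ge_3[OF odd_p] j by simp
    then have "(3 * j) div (3 * (?p - 1)) \<le> 2 * m div (3 * (?p - 1))" by (rule div_le_mono)
    then have "j div (?p - 1) \<le> 2 * m div (3 * (?p - 1))" by simp
    then have "vge (- int (2 * m div (3 * (?p - 1)))) (inverse (fact j) :: 'p padic)"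
      by (intro vge_mono[OF vge_inverse_fact]) simp
    then show ?thesis using j by (simp add: fps_exp_X_power_nth divide_inverse)
  qed (simp add: fps_exp_X_power_nth)
  then show "vge (- int (2 * m div (3 * (?p - 1)))) (coeff (trunc_poly L (fps_exp 1 oo fps_X ^ ?p)) m :: 'p padic)"
    by (simp add: coeff_trunc_poly)
qed

lemma growth_bounded_trunc_dwork:
  assumes odd_p: "odd CARD('p::prime_card)"
  shows "growth_bounded (trunc_poly L dwork_exp :: 'p padic poly)"
  unfolding growth_bounded_def coeff_trunc_poly
  using dwork_coeff_vge[OF odd_p] by (simp add: dwork_coeff_def)

lemma dwork_exp_power_p:
  "dwork_exp ^ CARD('p) = (fps_exp (of_nat CARD('p)) * (fps_exp 1 oo fps_X ^ CARD('p)) :: 'p::prime_card padic fps)"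
proof -
  have X0: "fps_nth (fps_X ^ CARD('p) :: 'p padic fps) 0 = 0" by (simp add: fps_X_power_iff)
  show ?thesis
    by (simp add: dwork_exp_def power_mult_distrib fps_compose_power[OF X0] fps_exp_power_mult)
qed

text \<open>At a root \<open>\<pi>\<close> of \<open>X^(p-1) + p\<close> the p-th power \<open>exp(p X + X^p)\<close> is \<open>exp 0\<close>.\<close>

lemma trunc_dwork_power_p:
  assumes odd_p: "odd CARD('p::prime_card)" and L: "L \<ge> 3 * r"
  obtains e where "poly_vge (int r) e" "qcong (trunc_poly L dwork_exp ^ CARD('p)) (1 + e :: 'p padic poly)"
proof -
  let ?p = "CARD('p)"
  let ?P = "of_nat ?p :: 'p padic"
  let ?\<theta> = "trunc_poly L dwork_exp :: 'p padic poly"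
  define M where "M = 3 * r"
  \<comment> \<open>\<open>e2\<close> is cut at p M since it lives in the degrees p j: at \<pi>,
    X^(p j) becomes (-p)^j X^j, which turns it into \<open>e3\<close> term by term.\<close>
  define e1 e2 e3 where "e1 = trunc_poly M (fps_exp ?P)"
    and "e2 = (trunc_poly (?p * M) (fps_exp 1 oo fps_X ^ ?p) :: 'p padic poly)"
    and "e3 = trunc_poly M (fps_exp (- ?P))"
  have mono: "agree_below M f F" if "agree_below K f F" "M \<le> K" for f :: "'p padic poly" and F K
    using that by (auto simp: agree_below_def)
  have gb: "growth_bounded ?\<theta>" "growth_bounded e1" "growth_bounded e2" "growth_bounded e3"
    unfolding e1_def e2_def e3_def using odd_p
    by (auto intro: growth_bounded_trunc_exp growth_bounded_trunc_exp_X_power growth_bounded_trunc_dwork)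
  have "agree_below M (?\<theta> ^ ?p) (fps_exp ?P * (fps_exp 1 oo fps_X ^ ?p))"
    unfolding dwork_exp_power_p[symmetric]
    by (intro agree_below_power mono[OF agree_below_trunc_poly]) (use L in \<open>simp add: M_def\<close>)
  moreover have "agree_below M (e1 * e2) (fps_exp ?P * (fps_exp 1 oo fps_X ^ ?p))"
    unfolding e1_def e2_def by (intro agree_below_mult mono[OF agree_below_trunc_poly]) simp_all
  ultimately have 1: "poly_vge (int r) (?\<theta> ^ ?p - e1 * e2)"
    unfolding M_def by (intro agree_below_imp_poly_vge growth_bounded_power growth_bounded_mult gb)
  have "agree_below M (e1 * e3) (fps_exp ?P * fps_exp (- ?P))"
    unfolding e1_def e3_def by (intro agree_below_mult agree_below_trunc_poly)
  also have "fps_exp ?P * fps_exp (- ?P) = 1" by (simp flip: fps_exp_add_mult)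
  finally have 2: "poly_vge (int r) (e1 * e3 - 1)"
    unfolding M_def by (rule agree_below_imp_poly_vge[rotated 2]) (auto intro: growth_bounded_mult gb)
  have "e2 = (\<Sum>m\<in>{m\<in>{..<?p * M}. ?p dvd m}. monom (1 / fact (m div ?p)) m)"
    unfolding e2_def trunc_poly_def
    by (rule sum.mono_neutral_cong_right) (auto simp: fps_exp_X_power_nth)
  also have "\<dots> = (\<Sum>j<M. monom (1 / fact j) (?p * j))"
    by (rule sum.reindex_bij_witness[where i = "\<lambda>j. ?p * j" and j = "\<lambda>m. m div ?p"]) auto
  also have "qcong \<dots> e3"
    unfolding e3_def trunc_poly_def
  proof (rule qcong_sum)
    fix j :: nat
    have "?p * j = j + (?p - 1) * j" using p_gt_1[where 'p='p] by (simp add: algebra_simps diff_mult_distrib)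
    then show "qcong (monom (1 / fact j) (?p * j)) (monom (fps_nth (fps_exp (- ?P)) j) j)"
      using qcong_monom[of "1 / fact j :: 'p padic" j j] by simp
  qed
  finally have e23: "qcong e2 e3" .
  have "qcong (?\<theta> ^ ?p) ((?\<theta> ^ ?p - e1 * e2) + e1 * e3)"
    using qcong_add[OF qcong_refl[of "?\<theta> ^ ?p - e1 * e2"] qcong_mult[OF qcong_refl[of e1] e23]] by simp
  moreover have "(?\<theta> ^ ?p - e1 * e2) + e1 * e3 = 1 + ((?\<theta> ^ ?p - e1 * e2) + (e1 * e3 - 1))" by simp
  ultimately show ?thesis using that[OF poly_vge_add[OF 1 2]] by simp
qed

lemma sum_block: "(\<Sum>m\<in>{i * s..<i * s + s}. f m) = (\<Sum>a<s. f (a + s * i))" for s :: nat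
  using sum.shift_bounds_nat_ivl[of f 0 "i * s" s]
  by (simp add: atLeast0LessThan mult.commute add.commute)

section \<open>A p-th root of unity whose coefficients are gamma values\<close>

definition inv_p_minus_1 :: "'p::prime_card padic_int" where
  "inv_p_minus_1 = (SOME z. (of_nat CARD('p) - 1) * z = 1)"

lemma inv_p_minus_1: "(of_nat CARD('p) - 1) * (inv_p_minus_1 :: 'p::prime_card padic_int) = 1"
proof -
  have "\<not> padic_cong 1 (of_nat (CARD('p) - 1) :: 'p padic_int) (of_nat 0)"
    unfolding padic_cong_of_nat_iff using p_gt_1[where 'p='p] by (auto simp: cong_def)
  then obtain z where "of_nat (CARD('p) - 1) * z = (1 :: 'p padic_int)"
    using padic_inverse_exists by (metis of_nat_0)
  then have "(of_nat CARD('p) - 1) * z = (1 :: 'p padic_int)"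
    using p_gt_1[where 'p='p] by (simp add: of_nat_diff)
  then show ?thesis unfolding inv_p_minus_1_def by (rule someI)
qed

definition gauss_number :: "nat \<Rightarrow> 'p::prime_card padic" where
  "gauss_number a = gauss_coeff a (of_nat a * inv_p_minus_1)"

text \<open>\<open>gauss_poly\<close> represents a p-th root of unity; its coefficients are normalized Gauss sums.\<close>

definition gauss_poly :: "'p::prime_card padic poly" where
  "gauss_poly = (\<Sum>a<CARD('p) - 1. monom (gauss_number a) a)"

lemma coeff_gauss_poly:
  "coeff (gauss_poly :: 'p::prime_card padic poly) a = (if a < CARD('p) - 1 then gauss_number a else 0)"
  by (simp add: gauss_poly_def coeff_sum coeff_monom)

lemma gauss_number_arg: "(of_nat CARD('p) - 1) * (of_nat a * inv_p_minus_1) = (of_nat a :: 'p::prime_card padic_int)"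
  by (metis inv_p_minus_1 mult.left_commute mult.right_neutral)

lemma gauss_Gamma_vge:
  assumes "odd CARD('p::prime_card)"
  shows "vge 0 (gauss_Gamma a (y :: 'p padic_int))"
proof -
  have "vge 0 (of_int ((- 1) ^ (a + 1)) * inverse (to_fract (padic_Gamma (1 - y))))"
    by (intro vge_mult_0(1) vge_of_int vge_inverse_unit padic_Gamma_unit assms)
  then show ?thesis by (simp add: gauss_Gamma_def divide_inverse)
qed

lemma gauss_number_vge:
  assumes "odd CARD('p::prime_card)"
  shows "vge 0 (gauss_number a :: 'p padic)"
  unfolding gauss_number_def gauss_coeff_def divide_inverse
  by (intro vge_mult_0(1) gauss_Gamma_vge assms vge_inverse_1_minus_p)

lemma gauss_poly_vge:
  assumes odd_p: "odd CARD('p::prime_card)"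
  shows "poly_vge 0 (gauss_poly :: 'p padic poly)"
  unfolding poly_vge_def coeff_gauss_poly
proof
  fix m :: nat
  have "0 \<le> (int m - 0) div (int CARD('p) - 1)"
    using s_pos[where 'p='p] by (simp add: pos_imp_zdiv_nonneg_iff)
  then show "vge (- ((int m - 0) div (int CARD('p) - 1))) (if m < CARD('p) - 1 then gauss_number m else 0 :: 'p padic)"
    using vge_mono[OF gauss_number_vge[OF odd_p]] by simp
qed

text \<open>A truncation of length (p - 1)(I + 1) has exactly I + 1 terms in each class of degrees
  modulo p - 1; folding them gives the partial sums of \<open>gauss_coeff_approx\<close>.\<close>

lemma trunc_dwork_approx:
  assumes odd_p: "odd CARD('p::prime_card)" and I: "I \<ge> 2 * N" "I \<ge> CARD('p) * (N + 1)"
  obtains h where "poly_vge (int N) h" "qcong (trunc_poly ((CARD('p) - 1) * Suc I) dwork_exp) (gauss_poly + h :: 'p padic poly)"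
proof -
  let ?s = "CARD('p) - 1"
  let ?P = "of_nat CARD('p) :: 'p padic"
  define T where "T = (\<lambda>a. \<Sum>i\<le>I. (- ?P) ^ i * dwork_coeff (int (a + ?s * i)))"
  define h where "h = (\<Sum>a<?s. monom (T a - gauss_number a) a)"
  have s: "int CARD('p) - 1 = int ?s" "?s > 0" using p_gt_1[where 'p='p] by auto
  have "poly_vge (int N) h"
    unfolding h_def
  proof (rule poly_vge_sum, rule poly_vge_monom)
    fix a assume "a \<in> {..<?s}"
    then have a: "a < CARD('p)" by auto
    have "vge (int N) (T a - gauss_number a)"
      unfolding T_def gauss_number_def by (rule gauss_coeff_approx[OF odd_p a gauss_number_arg I])
    moreover have "- int N \<le> (int a - int N) div int ?s"
    proof -
      have "(- int N) * int ?s \<le> int a - int N"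
      proof -
        have "int N * 1 \<le> int N * int ?s" using s(2) by (intro mult_left_mono) auto
        then show ?thesis by simp
      qed
      then have "(- int N) * int ?s div int ?s \<le> (int a - int N) div int ?s"
        using s(2) by (intro zdiv_mono1) auto
      moreover have "(- int N) * int ?s div int ?s = - int N"
        by (rule nonzero_mult_div_cancel_right) (use s(2) in simp)
      ultimately show ?thesis by (simp only:)
    qed
    ultimately show "vge (- ((int a - int N) div (int CARD('p) - 1))) (T a - gauss_number a)"
      unfolding s(1) by (rule_tac vge_mono) (assumption, linarith)
  qed
  moreover have "qcong (trunc_poly (?s * Suc I) dwork_exp) (gauss_poly + h)"
  proof -
    define S1 S2 where "S1 = (\<Sum>i<Suc I. \<Sum>a<?s. monom (dwork_coeff (int (a + ?s * i)) :: 'p padic) (a + ?s * i))"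
      and "S2 = (\<Sum>i<Suc I. \<Sum>a<?s. monom (dwork_coeff (int (a + ?s * i)) * (- ?P) ^ i) a)"
    have "trunc_poly (?s * Suc I) dwork_exp = (\<Sum>m<Suc I * ?s. monom (dwork_coeff (int m) :: 'p padic) m)"
      unfolding trunc_poly_def dwork_coeff_def mult.commute[of ?s] by simp
    also have "\<dots> = (\<Sum>i<Suc I. \<Sum>m\<in>{i * ?s..<i * ?s + ?s}. monom (dwork_coeff (int m)) m)"
      by (rule sum.nat_group[symmetric])
    finally have 1: "trunc_poly (?s * Suc I) dwork_exp = S1" unfolding sum_block S1_def .
    have "S2 = (\<Sum>a<?s. \<Sum>i<Suc I. monom (dwork_coeff (int (a + ?s * i)) * (- ?P) ^ i) a)"
      unfolding S2_def by (rule sum.swap)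
    also have "\<dots> = (\<Sum>a<?s. monom (T a) a)"
      unfolding T_def monom_sum lessThan_Suc_atMost by (intro sum.cong refl) (simp only: mult.commute)
    also have "\<dots> = gauss_poly + h"
      unfolding gauss_poly_def h_def sum.distrib[symmetric] add_monom by simp
    finally have 2: "S2 = gauss_poly + h" .
    have "qcong S1 S2"
      unfolding S1_def S2_def by (intro qcong_sum qcong_monom)
    then show ?thesis unfolding 1 2 .
  qed
  ultimately show ?thesis by (rule that)
qed

lemma gauss_poly_root_of_unity:
  assumes odd_p: "odd CARD('p::prime_card)"
  shows "qcong (gauss_poly ^ CARD('p)) (1 :: 'p padic poly)"
proof -
  let ?g = "gauss_poly :: 'p padic poly"
  have "qcong (?g ^ CARD('p) - 1) 0"
  proof (rule qcong_0_if_poly_vge_all)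
    fix n :: nat
    \<comment> \<open>Large enough for both conditions of \<open>trunc_dwork_approx\<close> and for
      the truncation length 3 n.\<close>
    define I where "I = 3 * n + CARD('p) * (n + 1)"
    let ?\<theta> = "trunc_poly ((CARD('p) - 1) * Suc I) dwork_exp :: 'p padic poly"
    obtain h where h: "poly_vge (int n) h" "qcong ?\<theta> (?g + h)"
      by (rule trunc_dwork_approx[OF odd_p, of n I]) (auto simp: I_def)
    have "3 * n \<le> 1 * Suc I" by (simp add: I_def)
    also have "\<dots> \<le> (CARD('p) - 1) * Suc I" using p_gt_1[where 'p='p] by (intro mult_le_mono1) auto
    finally obtain e where e: "poly_vge (int n) e" "qcong (?\<theta> ^ CARD('p)) (1 + e)"
      by (rule trunc_dwork_power_p[OF odd_p])
    have h0: "poly_vge 0 h" by (rule poly_vge_mono[OF h(1)]) simp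
    define d where "d = (?g + h) ^ CARD('p) - ?g ^ CARD('p)"
    have d: "poly_vge (int n) d"
      unfolding d_def by (intro poly_vge_power_diff poly_vge_add gauss_poly_vge odd_p h0) (use h in simp)
    have "qcong (?g ^ CARD('p) + d) (1 + e)"
      using qcong_trans[OF qcong_sym[OF qcong_power[OF h(2)]] e(2)] by (simp add: d_def)
    then have "qcong (?g ^ CARD('p) + d - (1 + d)) (1 + e - (1 + d))"
      by (rule qcong_diff) simp
    then have "qcong (?g ^ CARD('p) - 1) (e - d)" by simp
    moreover have "poly_vge (int n) (e - d)" by (rule poly_vge_diff[OF e(1) d])
    ultimately show "\<exists>e. poly_vge (int n) e \<and> qcong (?g ^ CARD('p) - 1) e" by blast
  qed
  then show ?thesis by (simp add: qcong_def)
qed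

text \<open>By \<open>gauss_number_eq\<close> the Gauss sums are minus these numbers times X^a. That
  they equal Gamma_p(a/(p - 1)) is the reflection formula, which follows from Jacobi sums.\<close>

definition gamma_number :: "nat \<Rightarrow> 'p::prime_card padic" where
  "gamma_number a = gauss_Gamma a (of_nat a * inv_p_minus_1)"

lemma gauss_number_eq: "(of_nat CARD('p) - 1) * gauss_number a = - (gamma_number a :: 'p::prime_card padic)"
proof -
  have "(1 - of_nat CARD('p)) * gauss_number a = (gamma_number a :: 'p padic)"
    using one_minus_p_nonzero[where 'p='p] by (simp add: gauss_number_def gauss_coeff_def gamma_number_def)
  then show ?thesis by (simp add: algebra_simps)
qed

lemma gamma_number_0: 
  assumes "odd CARD('p::prime_card)"
  shows "gamma_number 0 = (1 :: 'p padic)"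
proof -
  have "padic_Gamma (1 :: 'p padic_int) = - 1"
    using padic_Gamma_of_nat[OF assms, of 1] by (simp add: prime_to_p_fact_Suc)
  then show ?thesis by (simp add: gamma_number_def gauss_Gamma_def)
qed

lemma gamma_number_nonzero:
  assumes "odd CARD('p::prime_card)"
  shows "gamma_number a \<noteq> (0 :: 'p padic)"
proof -
  have "padic_Gamma (1 - of_nat a * inv_p_minus_1 :: 'p padic_int) dvd 1" by (rule padic_Gamma_unit[OF assms])
  then have "padic_Gamma (1 - of_nat a * inv_p_minus_1 :: 'p padic_int) \<noteq> 0" by auto
  then show ?thesis by (simp add: gamma_number_def gauss_Gamma_def)
qed

lemma gauss_number_0_approx:
  assumes "odd CARD('p::prime_card)"
  shows "vge 1 (gauss_number 0 - 1 :: 'p padic)"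
proof -
  have "gauss_number 0 - 1 = of_nat CARD('p) * inverse (1 - of_nat CARD('p) :: 'p padic)"
    using gamma_number_0[OF assms] one_minus_p_nonzero[where 'p='p]
    by (simp add: gauss_number_def gauss_coeff_def gamma_number_def field_simps)
  then show ?thesis using vge_mult_0(1)[OF vge_p vge_inverse_1_minus_p] by simp
qed

text \<open>Modulo p, 1/(p - 1) is -1, so the gamma value is congruent to Gamma_p(2) = 1. With the
  constant term this shows that \<open>gauss_poly\<close> is 1 + X up to order 2.\<close>

lemma gauss_number_1_approx:
  assumes odd_p: "odd CARD('p::prime_card)"
  shows "vge 1 (gauss_number 1 - 1 :: 'p padic)"
proof -
  let ?y = "inv_p_minus_1 :: 'p padic_int"
  let ?P = "of_nat CARD('p) :: 'p padic"
  define g where "g = to_fract (padic_Gamma (1 - ?y))"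
  have "of_nat CARD('p) dvd (1 - ?y) - of_nat 2"
  proof -
    have "(1 - ?y) - of_nat 2 = of_nat CARD('p) * (- ?y)"
      using inv_p_minus_1[where 'p='p] by (simp add: algebra_simps)
    then show ?thesis by simp
  qed
  then have "padic_cong 1 (1 - ?y) (of_nat 2)" by (simp add: padic_cong_iff_dvd)
  then have "padic_cong 1 (padic_Gamma (1 - ?y)) (padic_Gamma (of_nat 2))" by (rule padic_Gamma_cong[OF odd_p])
  also have "padic_Gamma (of_nat 2) = (1 :: 'p padic_int)"
    by (simp only: padic_Gamma_of_nat[OF odd_p]) (simp add: numeral_2_eq_2 prime_to_p_fact_Suc)
  finally have "vge (int 1) (g - to_fract 1)" unfolding g_def vge_diff_to_fract_iff .
  then have g1: "vge 1 (g - 1)" by simp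
  have u: "padic_Gamma (1 - ?y) dvd 1" by (rule padic_Gamma_unit[OF odd_p])
  then have g0: "g \<noteq> 0" unfolding g_def by auto
  have G: "gauss_number 1 = inverse g * inverse (1 - ?P)"
    by (simp add: gauss_number_def gauss_coeff_def gauss_Gamma_def g_def divide_inverse)
  have "gauss_number 1 - 1 = gauss_number 1 * (g * ?P - (g - 1))"
    unfolding G using g0 one_minus_p_nonzero[where 'p='p] by (simp add: field_simps)
  also have "vge 1 \<dots>"
    by (intro vge_mult_0(2)[OF gauss_number_vge[OF odd_p]] vge_diff g1 vge_mult_0(2)[OF _ vge_p])
      (simp add: g_def)
  finally show ?thesis .
qed

text \<open>The first-order term at \<pi>, which tells p-th roots of unity apart.\<close>

definition lin_approx :: "'p::prime_card padic \<Rightarrow> 'p padic poly \<Rightarrow> bool" where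
  "lin_approx c f \<longleftrightarrow> poly_vge 2 (f - [:1, c:])"

lemma poly_vge_0_linear:
  assumes "odd CARD('p)" "vge 0 (c :: 'p::prime_card padic)"
  shows "poly_vge 0 [:1, c:]"
  unfolding poly_vge_def
proof
  fix m :: nat
  have "0 \<le> (int m - 0) div (int CARD('p) - 1)"
    using s_pos[where 'p='p] by (simp add: pos_imp_zdiv_nonneg_iff)
  moreover have "vge 0 (coeff [:1, c:] m)" using assms by (simp add: coeff_pCons split: nat.splits)
  ultimately show "vge (- ((int m - 0) div (int CARD('p) - 1))) (coeff [:1, c:] m)"
    by (rule_tac vge_mono[of 0]) auto
qed

lemma lin_approx_mult:
  assumes odd_p: "odd CARD('p::prime_card)" and c: "vge 0 (c :: 'p padic)" and d: "vge 0 d"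
    and f: "lin_approx c f" and g: "lin_approx d g"
  shows "lin_approx (c + d) (f * g)"
proof -
  have g0: "poly_vge 0 g"
    using poly_vge_add[OF poly_vge_mono[OF g[unfolded lin_approx_def], of 0] poly_vge_0_linear[OF odd_p d]] by simp
  have "poly_vge 2 (monom (c * d) 2)"
    by (rule poly_vge_2I[OF odd_p]) (use vge_mult_0(1)[OF c d] in \<open>auto simp: coeff_monom\<close>)
  then have "poly_vge 2 ((f - [:1, c:]) * g + [:1, c:] * (g - [:1, d:]) + monom (c * d) 2)"
    using f g unfolding lin_approx_def
    by (intro poly_vge_add poly_vge_mult_0(2)[OF _ g0] poly_vge_mult_0(1)[OF poly_vge_0_linear[OF odd_p c]])
  moreover have "[:1, c:] * [:1, d:] = [:1, c + d:] + monom (c * d) 2"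
    by (simp add: monom_altdef numeral_2_eq_2)
  then have "(f - [:1, c:]) * g + [:1, c:] * (g - [:1, d:]) + monom (c * d) 2 = f * g - [:1, c + d:]"
    by (simp add: algebra_simps)
  ultimately show ?thesis unfolding lin_approx_def by (simp only:)
qed

lemma lin_approx_power:
  assumes odd_p: "odd CARD('p::prime_card)" and c: "vge 0 (c :: 'p padic)" and f: "lin_approx c f"
  shows "lin_approx (of_nat n * c) (f ^ n)"
proof (induction n)
  case 0
  show ?case by (simp add: lin_approx_def one_pCons)
next
  case (Suc n)
  have "lin_approx (c + of_nat n * c) (f * f ^ n)"
    by (rule lin_approx_mult[OF odd_p c vge_mult_0(1)[OF vge_of_nat c] f Suc])
  then show ?case by (simp add: algebra_simps)
qed

text \<open>If z^(p-1) = 1, the substitution of z X for X fixes \<open>eisenstein_poly\<close> and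
  represents the automorphism taking \<pi> to z \<pi>.\<close>

definition gauss_twist :: "'p::prime_card padic \<Rightarrow> 'p padic poly" where
  "gauss_twist z = pcompose gauss_poly [:0, z:]"

lemma pcompose_monom_linear: "pcompose (monom c n) [:0, z:] = monom (c * z ^ n) n" for c :: "'a::comm_ring_1"
proof (induction n)
  case (Suc n)
  then show ?case by (simp add: monom_Suc pcompose_pCons smult_monom mult_ac)
qed (simp add: monom_0)

lemma gauss_twist_eq: "gauss_twist z = (\<Sum>a<CARD('p) - 1. monom (gauss_number a * z ^ a) a :: 'p::prime_card padic poly)"
  unfolding gauss_twist_def gauss_poly_def pcompose_sum pcompose_monom_linear ..

lemma coeff_gauss_twist:
  "coeff (gauss_twist z :: 'p::prime_card padic poly) a = (if a < CARD('p) - 1 then gauss_number a * z ^ a else 0)"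
  by (simp add: gauss_twist_eq coeff_sum coeff_monom)

lemma gauss_twist_root_of_unity:
  assumes odd_p: "odd CARD('p::prime_card)" and z: "z ^ (CARD('p) - 1) = 1"
  shows "qcong (gauss_twist z ^ CARD('p)) (1 :: 'p padic poly)"
proof -
  obtain k where k: "gauss_poly ^ CARD('p) - 1 = eisenstein_poly * (k :: 'p padic poly)"
    using gauss_poly_root_of_unity[OF odd_p] by (auto simp: qcong_def dvd_def)
  have pw: "pcompose (f ^ n) g = pcompose f g ^ n" for f g :: "'p padic poly" and n
    by (induction n) (simp_all add: pcompose_mult pcompose_1)
  have "gauss_twist z ^ CARD('p) - 1 = pcompose (gauss_poly ^ CARD('p) - 1) [:0, z:]"
    by (simp add: gauss_twist_def pcompose_diff pw pcompose_1)
  also have "\<dots> = pcompose eisenstein_poly [:0, z:] * pcompose k [:0, z:]"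
    by (simp add: k pcompose_mult)
  also have "pcompose eisenstein_poly [:0, z:] = (eisenstein_poly :: 'p padic poly)"
    using z by (simp add: eisenstein_poly_def pcompose_add pcompose_monom_linear)
  finally show ?thesis by (simp add: qcong_def)
qed

lemma lin_approx_gauss_twist:
  assumes odd_p: "odd CARD('p::prime_card)" and z: "vge 0 (z :: 'p padic)"
  shows "lin_approx z (gauss_twist z)"
  unfolding lin_approx_def
proof (rule poly_vge_2I[OF odd_p])
  have p: "0 < CARD('p) - 1" "1 < CARD('p) - 1" using p_ge_3[OF odd_p] by auto
  show "vge 1 (coeff (gauss_twist z - [:1, z:]) 0)"
    using gauss_number_0_approx[OF odd_p] p by (simp add: coeff_gauss_twist)
  have "vge 1 ((gauss_number 1 - 1) * z)" by (rule vge_mult_0(1)[OF gauss_number_1_approx[OF odd_p] z])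
  then show "vge 1 (coeff (gauss_twist z - [:1, z:]) 1)"
    using p by (simp add: coeff_gauss_twist algebra_simps)
  fix m :: nat assume "m \<ge> 2"
  then have "coeff [:1, z:] m = 0" by (simp add: coeff_pCons split: nat.splits)
  moreover have "vge 0 (z ^ m)" using vge_power[OF z, of m] by simp
  ultimately show "vge 0 (coeff (gauss_twist z - [:1, z:]) m)"
    using vge_mult_0(1)[OF gauss_number_vge[OF odd_p, of m]] by (simp add: coeff_gauss_twist)
qed

section \<open>The Teichmueller character, twists and orthogonality\<close>

definition teich :: "'p::prime_card mod_ring \<Rightarrow> 'p padic" where
  "teich x = to_fract (teichmuller x)"

lemma teich_power_card:
  assumes "x \<noteq> 0"
  shows "teich x ^ (CARD('p) - 1) = (1 :: 'p::prime_card padic)"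
  unfolding teich_def to_fract_power[symmetric] teichmuller_power_card[OF assms] by (rule to_fract_1)

lemma teich_mult: "x \<noteq> 0 \<Longrightarrow> y \<noteq> 0 \<Longrightarrow> teich (x * y) = teich x * teich y"
  by (simp add: teich_def teichmuller_mult)

lemma teich_power: "x \<noteq> 0 \<Longrightarrow> teich (x ^ n) = teich x ^ n"
  by (simp add: teich_def teichmuller_power to_fract_power)

lemma teich_1 [simp]: "teich 1 = 1"
  by (simp add: teich_def)

lemma teich_nonzero: "x \<noteq> 0 \<Longrightarrow> teich (x :: 'p::prime_card mod_ring) \<noteq> 0"
  using teich_power_card[of x] p_gt_1[where 'p='p] by (auto simp: power_0_left)

lemma teich_inverse: "x \<noteq> 0 \<Longrightarrow> teich (inverse x) = inverse (teich (x :: 'p::prime_card mod_ring))"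
  using teich_mult[of x "inverse x"] by (simp add: inverse_unique)

lemma teich_eq_1_iff: "x \<noteq> 0 \<Longrightarrow> teich x = 1 \<longleftrightarrow> x = (1 :: 'p::prime_card mod_ring)"
proof
  assume x: "x \<noteq> 0" "teich x = 1"
  then have "teichmuller x = 1" unfolding teich_def by (metis to_fract_1 to_fract_eq_iff)
  then show "x = 1" using padic_reduce_teichmuller[OF x(1)] padic_reduce_one by metis
qed simp

lemma of_nat_mod_ring_eq_iff: "(of_nat k :: 'p::prime_card mod_ring) = of_nat l \<longleftrightarrow> [k = l] (mod CARD('p))"
proof -
  have "(of_nat k :: 'p mod_ring) = of_nat l \<longleftrightarrow> padic_reduce (of_nat k :: 'p padic_int) = padic_reduce (of_nat l)"
    by (simp only: padic_reduce_of_nat)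
  then show ?thesis unfolding padic_reduce_eq_iff padic_cong_of_nat_iff by simp
qed

lemma gauss_poly_power_cong:
  assumes odd_p: "odd CARD('p::prime_card)" and "(of_nat k :: 'p mod_ring) = of_nat l"
  shows "qcong (gauss_poly ^ k) (gauss_poly ^ l :: 'p padic poly)"
proof -
  have red: "qcong (gauss_poly ^ n) (gauss_poly ^ (n mod CARD('p)) :: 'p padic poly)" for n
  proof -
    have "qcong ((gauss_poly ^ CARD('p)) ^ (n div CARD('p)) * gauss_poly ^ (n mod CARD('p)))
        (1 ^ (n div CARD('p)) * gauss_poly ^ (n mod CARD('p)) :: 'p padic poly)"
      by (intro qcong_mult qcong_power qcong_refl gauss_poly_root_of_unity[OF odd_p])
    moreover have "(gauss_poly ^ CARD('p)) ^ (n div CARD('p)) * gauss_poly ^ (n mod CARD('p)) = (gauss_poly ^ n :: 'p padic poly)"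
      by (simp flip: power_mult power_add)
    ultimately show ?thesis by simp
  qed
  have "k mod CARD('p) = l mod CARD('p)" using assms(2) by (simp add: of_nat_mod_ring_eq_iff cong_def)
  then show ?thesis using qcong_trans[OF red[of k] qcong_sym[OF red[of l, folded \<open>k mod CARD('p) = l mod CARD('p)\<close>]]] by simp
qed

text \<open>Both sides are p-th roots of unity and agree with 1 + k \<pi> up to order 2, because
  \<omega>(x) is congruent to k. So their quotient u is 1.\<close>

lemma gauss_twist_teich:
  assumes odd_p: "odd CARD('p::prime_card)" and k: "of_nat k = x" and x: "x \<noteq> (0 :: 'p mod_ring)"
  shows "qcong (gauss_twist (teich x)) (gauss_poly ^ k)"
proof -
  let ?p = "CARD('p)"
  let ?z = "teich x"
  let ?g = "gauss_poly :: 'p padic poly"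
  \<comment> \<open>The exponent k (p - 1) serves as -k, the p-th power of \<open>gauss_poly\<close>
    being 1; in this way u is a quotient formed without division.\<close>
  define n where "n = k * (?p - 1)"
  define u where "u = gauss_twist ?z * ?g ^ n"
  have z: "vge 0 ?z" by (simp add: teich_def)
  have "gauss_twist 1 = ?g" by (simp add: gauss_twist_eq gauss_poly_def)
  then have g: "lin_approx 1 ?g" using lin_approx_gauss_twist[OF odd_p vge_1] by simp
  have "qcong (u ^ ?p) (1 * 1 ^ n)"
    unfolding u_def power_mult_distrib power_mult[symmetric] mult.commute[of n] 
    unfolding power_mult
    by (intro qcong_mult qcong_power gauss_twist_root_of_unity gauss_poly_root_of_unity odd_p teich_power_card x)
  then have root: "qcong (u ^ ?p) 1" by simp
  have lu: "lin_approx (?z + of_nat n * 1) u"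
    unfolding u_def using z
    by (intro lin_approx_mult lin_approx_gauss_twist lin_approx_power odd_p g vge_mult_0(1)) simp_all
  have "vge 1 (?z + of_nat n)"
  proof -
    have "padic_reduce (teichmuller x) = padic_reduce (of_nat k)"
      using padic_reduce_teichmuller[OF x] k by (simp add: padic_reduce_of_nat)
    then have "padic_cong 1 (teichmuller x) (of_nat k)" by (simp only: padic_reduce_eq_iff)
    then have "vge (int 1) (to_fract (teichmuller x) - to_fract (of_nat k))" unfolding vge_diff_to_fract_iff .
    then have "vge 1 (?z - of_nat k)" by (simp add: teich_def of_nat_fract)
    moreover have "vge 1 (of_nat k * of_nat ?p :: 'p padic)" by (rule vge_mult_0(2)[OF vge_of_nat vge_p])
    ultimately have "vge 1 ((?z - of_nat k) + of_nat k * of_nat ?p)" by (rule vge_add)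
    moreover have n: "of_nat n = of_nat k * of_nat ?p - (of_nat k :: 'p padic)"
      unfolding n_def using p_gt_1[where 'p='p] by (simp add: of_nat_diff algebra_simps)
    have "?z + of_nat n = (?z - of_nat k) + of_nat k * of_nat ?p" unfolding n by simp
    ultimately show ?thesis by (simp only:)
  qed
  then have "poly_vge 2 [:0, ?z + of_nat n * 1:]"
    by (intro poly_vge_2I[OF odd_p]) (auto simp: coeff_pCons split: nat.splits)
  then have "poly_vge 2 ((u - [:1, ?z + of_nat n * 1:]) + [:0, ?z + of_nat n * 1:])"
    using lu unfolding lin_approx_def by (intro poly_vge_add)
  moreover have "(u - [:1, ?z + of_nat n * 1:]) + [:0, ?z + of_nat n * 1:] = u - 1"
    by (simp add: one_pCons)
  ultimately have "qcong u 1" by (intro qcong_1_if_root_of_unity[OF odd_p root]) (simp only:)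
  then have "qcong (u * ?g ^ k) (1 * ?g ^ k)" by (intro qcong_mult qcong_refl)
  then have 1: "qcong (u * ?g ^ k) (?g ^ k)" by simp
  have "n + k = ?p * k" unfolding n_def using p_gt_1[where 'p='p] by (simp add: algebra_simps diff_mult_distrib2)
  then have "u * ?g ^ k = gauss_twist ?z * (?g ^ ?p) ^ k"
    unfolding u_def mult.assoc power_add[symmetric] power_mult[symmetric] by simp
  moreover have "qcong (gauss_twist ?z * (?g ^ ?p) ^ k) (gauss_twist ?z * 1 ^ k)"
    by (intro qcong_mult qcong_power qcong_refl gauss_poly_root_of_unity[OF odd_p])
  ultimately have "qcong (u * ?g ^ k) (gauss_twist ?z)" by simp
  from qcong_trans[OF qcong_sym[OF this] 1] show ?thesis .
qed

text \<open>Otherwise X^r - 1 with r = k mod (p - 1) would have p - 1 > r roots.\<close>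

lemma exists_power_neq_1:
  assumes "\<not> (CARD('p::prime_card) - 1) dvd k"
  shows "\<exists>x :: 'p mod_ring. x \<noteq> 0 \<and> x ^ k \<noteq> 1"
proof (rule ccontr)
  assume "\<not> ?thesis"
  then have all: "x ^ k = 1" if "x \<noteq> 0" for x :: "'p mod_ring" using that by blast
  let ?s = "CARD('p) - 1"
  define r where "r = k mod ?s"
  have r: "0 < r" "r < ?s" using assms p_gt_1[where 'p='p] by (auto simp: r_def mod_greater_zero_iff_not_dvd)
  have one: "x ^ r = 1" if "x \<noteq> 0" for x :: "'p mod_ring"
  proof -
    have "x ^ k = (x ^ ?s) ^ (k div ?s) * x ^ r" unfolding r_def by (simp flip: power_mult power_add)
    then show ?thesis using all[OF that] fermat_mod_ring[OF that] by simp
  qed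
  define f :: "'p mod_ring poly" where "f = monom 1 r - 1"
  have deg: "degree f \<le> r"
    unfolding f_def by (intro degree_diff_le degree_monom_le) simp
  have "coeff f r = 1" using r(1) by (simp add: f_def coeff_1)
  then have f0: "f \<noteq> 0" by auto
  have "UNIV - {0} \<subseteq> {x. poly f x = 0}" using one by (auto simp: f_def poly_monom)
  then have "card (UNIV - {0 :: 'p mod_ring}) \<le> card {x. poly f x = 0}"
    by (intro card_mono) simp_all
  also have "\<dots> \<le> degree f" by (rule card_poly_roots_bound[OF f0])
  finally show False using r(2) deg by (simp add: card_Diff_singleton)
qed

lemma sum_teich_power:
  "(\<Sum>x\<in>UNIV - {0}. teich x ^ k) = (if (CARD('p) - 1) dvd k then of_nat (CARD('p) - 1) else (0 :: 'p::prime_card padic))"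
proof (cases "(CARD('p) - 1) dvd k")
  case True
  then obtain j where j: "k = (CARD('p) - 1) * j" by (auto simp: dvd_def)
  have "(\<Sum>x\<in>UNIV - {0 :: 'p mod_ring}. teich x ^ k) = (\<Sum>x\<in>UNIV - {0 :: 'p mod_ring}. 1)"
  proof (rule sum.cong[OF refl])
    fix x :: "'p mod_ring" assume "x \<in> UNIV - {0}"
    then have "teich x ^ (CARD('p) - 1) = 1" by (intro teich_power_card) simp
    then show "teich x ^ k = 1" unfolding j power_mult by (simp only: power_one)
  qed
  then show ?thesis using True by (simp add: card_Diff_singleton)
next
  case False
  then obtain y :: "'p mod_ring" where y: "y \<noteq> 0" "y ^ k \<noteq> 1" using exists_power_neq_1 by blast
  define S where "S = (\<Sum>x\<in>UNIV - {0 :: 'p mod_ring}. teich x ^ k)"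
  have "S = (\<Sum>x\<in>UNIV - {0 :: 'p mod_ring}. teich (y * x) ^ k)"
    unfolding S_def
    by (rule sum.reindex_bij_witness[where i = "\<lambda>x. y * x" and j = "\<lambda>x. x / y"]) (use y in auto)
  also have "\<dots> = (\<Sum>x\<in>UNIV - {0 :: 'p mod_ring}. teich y ^ k * teich x ^ k)"
    using y by (intro sum.cong refl) (simp add: teich_mult power_mult_distrib)
  also have "\<dots> = teich y ^ k * S" by (simp add: S_def sum_distrib_left)
  finally have "(teich y ^ k - 1) * S = 0" by (simp add: algebra_simps)
  moreover have "teich y ^ k \<noteq> 1" using y teich_eq_1_iff[of "y ^ k"] by (simp add: teich_power)
  ultimately show ?thesis using False by (simp add: S_def)
qed

text \<open>This is the Gross-Koblitz formula: the Gauss sum on the left reduces by orthogonality to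
  its monomial of degree c, with coefficient \<open>- gamma_number c\<close>.\<close>

lemma sum_gauss_twist:
  assumes c: "c < CARD('p::prime_card) - 1" "(CARD('p) - 1) dvd (k + c)"
  shows "(\<Sum>x\<in>UNIV - {0 :: 'p mod_ring}. smult (teich x ^ k) (gauss_twist (teich x))) =
    monom (of_nat (CARD('p) - 1) * gauss_number c) c"
proof (rule poly_eqI)
  fix m
  let ?s = "CARD('p) - 1"
  have "coeff (\<Sum>x\<in>UNIV - {0 :: 'p mod_ring}. smult (teich x ^ k) (gauss_twist (teich x))) m =
     (if m < ?s then gauss_number m * (\<Sum>x\<in>UNIV - {0 :: 'p mod_ring}. teich x ^ (k + m)) else 0)"
    by (simp add: coeff_sum coeff_gauss_twist sum_distrib_left power_add mult_ac)
  also have "\<dots> = (if m = c then gauss_number m * of_nat ?s else 0)"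
  proof (cases "m < ?s")
    case True
    have "?s dvd (k + m) \<longleftrightarrow> m = c"
    proof
      assume "?s dvd (k + m)"
      then have "[k + m = k + c] (mod ?s)" using c(2) by (simp add: cong_def dvd_eq_mod_eq_0)
      then have "[m = c] (mod ?s)" by (simp add: cong_add_lcancel_nat)
      then show "m = c" using True c(1) by (simp add: cong_def)
    qed (use c in simp)
    then show ?thesis using True by (simp only: sum_teich_power) simp
  qed (use c in auto)
  finally show "coeff (\<Sum>x\<in>UNIV - {0 :: 'p mod_ring}. smult (teich x ^ k) (gauss_twist (teich x))) m =
     coeff (monom (of_nat ?s * gauss_number c) c) m"
    by (simp add: coeff_monom mult.commute)
qed

section \<open>Jacobi sums\<close>

text \<open>The Jacobi sum of \<omega>^(-a) and \<omega>^(-b), with exponents made natural; a = 0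
  gives the trivial character.\<close>

definition jacobi_sum :: "nat \<Rightarrow> nat \<Rightarrow> 'p::prime_card padic" where
  "jacobi_sum a b = (\<Sum>t\<in>UNIV - {0, 1}. teich t ^ (CARD('p) - 1 - a) * teich (1 - t) ^ (CARD('p) - 1 - b))"

text \<open>Pairs with x + y = 0 are set apart; the others are x = z t, y = z (1 - t) with z = x +
  y.\<close>

lemma sum_pairs_nonzero:
  fixes H :: "'a::{field, finite} \<Rightarrow> 'a \<Rightarrow> 'b::comm_monoid_add"
  shows "(\<Sum>x\<in>UNIV - {0}. \<Sum>y\<in>UNIV - {0}. H x y) =
    (\<Sum>x\<in>UNIV - {0}. H x (- x)) + (\<Sum>z\<in>UNIV - {0}. \<Sum>t\<in>UNIV - {0, 1}. H (z * t) (z * (1 - t)))"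
proof -
  have "(\<Sum>y\<in>UNIV - {0}. H x y) = H x (- x) + (\<Sum>y\<in>UNIV - {0, - x}. H x y)" if "x \<in> UNIV - {0}" for x
  proof -
    have "UNIV - {0} - {- x} = UNIV - {0, - x}" by blast
    then show ?thesis using that sum.remove[of "UNIV - {0}" "- x" "H x"] by simp
  qed
  then have "(\<Sum>x\<in>UNIV - {0}. \<Sum>y\<in>UNIV - {0}. H x y) =
      (\<Sum>x\<in>UNIV - {0}. H x (- x)) + (\<Sum>x\<in>UNIV - {0}. \<Sum>y\<in>UNIV - {0, - x}. H x y)"
    by (simp add: sum.distrib)
  also have "(\<Sum>x\<in>UNIV - {0}. \<Sum>y\<in>UNIV - {0, - x}. H x y) = (\<Sum>(x, y)\<in>Sigma (UNIV - {0}) (\<lambda>x. UNIV - {0, - x}). H x y)"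
    by (rule sum.Sigma) simp_all
  also have "\<dots> = (\<Sum>(z, t)\<in>(UNIV - {0}) \<times> (UNIV - {0, 1}). H (z * t) (z * (1 - t)))"
  proof (rule sum.reindex_bij_witness[where i = "\<lambda>(z, t). (z * t, z * (1 - t))" and j = "\<lambda>(x, y). (x + y, x / (x + y))"])
    fix v :: "'a \<times> 'a" assume v: "v \<in> Sigma (UNIV - {0}) (\<lambda>x. UNIV - {0, - x})"
    obtain x y where xy: "v = (x, y)" by (cases v)
    have nz: "x \<noteq> 0" "y \<noteq> 0" "x + y \<noteq> 0" using v xy by (auto simp: add_eq_0_iff)
    then have e: "(x + y) * (x / (x + y)) = x" "(x + y) * (1 - x / (x + y)) = y" by (simp_all add: right_diff_distrib)
    show "(case case v of (x, y) \<Rightarrow> (x + y, x / (x + y)) of (z, t) \<Rightarrow> (z * t, z * (1 - t))) = v"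
      by (simp only: xy prod.case e)
    show "(case v of (x, y) \<Rightarrow> (x + y, x / (x + y))) \<in> (UNIV - {0}) \<times> (UNIV - {0, 1})"
      using nz by (simp add: xy)
    show "(case case v of (x, y) \<Rightarrow> (x + y, x / (x + y)) of (z, t) \<Rightarrow> H (z * t) (z * (1 - t))) = (case v of (x, y) \<Rightarrow> H x y)"
      by (simp only: xy prod.case e)
  next
    fix w :: "'a \<times> 'a" assume w: "w \<in> (UNIV - {0 :: 'a}) \<times> (UNIV - {0, 1 :: 'a})"
    obtain z t where zt: "w = (z, t)" by (cases w)
    have nz: "z \<noteq> 0" "t \<noteq> 0" "1 - t \<noteq> 0" using w zt by auto
    have e: "z * t + z * (1 - t) = z" by (simp add: right_diff_distrib)
    show "(case case w of (z, t) \<Rightarrow> (z * t, z * (1 - t)) of (x, y) \<Rightarrow> (x + y, x / (x + y))) = w"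
      using nz by (simp only: zt prod.case e) simp
    have "z * (1 - t) \<noteq> - (z * t)" using e nz(1) by (metis add_eq_0_iff)
    then show "(case w of (z, t) \<Rightarrow> (z * t, z * (1 - t))) \<in> Sigma (UNIV - {0}) (\<lambda>x. UNIV - {0, - x})"
      using nz by (simp add: zt)
  qed
  also have "\<dots> = (\<Sum>z\<in>UNIV - {0}. \<Sum>t\<in>UNIV - {0, 1}. H (z * t) (z * (1 - t)))"
    by (rule sum.cartesian_product[symmetric])
  finally show ?thesis .
qed

text \<open>The additive character of the prime field with \<open>gauss_poly\<close> in the role of
  the root of unity; it is additive only modulo \<open>eisenstein_poly\<close>.\<close>

definition gauss_char :: "'p::prime_card mod_ring \<Rightarrow> 'p padic poly" where
  "gauss_char x = gauss_poly ^ nat (to_int_mod_ring x)"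

lemma of_nat_nat_to_int_mod_ring: "of_nat (nat (to_int_mod_ring x)) = (x :: 'p::prime_card mod_ring)"
proof -
  have "to_int_mod_ring x \<in> {0..<int CARD('p)}" using range_to_int_mod_ring[where 'a='p] by blast
  then have "of_nat (nat (to_int_mod_ring x)) = (of_int (to_int_mod_ring x) :: 'p mod_ring)" by simp
  then show ?thesis by (simp add: of_int_of_int_mod_ring)
qed

lemma gauss_char_twist:
  assumes "odd CARD('p::prime_card)" "x \<noteq> (0 :: 'p mod_ring)"
  shows "qcong (gauss_twist (teich x)) (gauss_char x)"
  unfolding gauss_char_def by (rule gauss_twist_teich[OF assms(1) of_nat_nat_to_int_mod_ring assms(2)])

lemma gauss_char_add:
  assumes odd_p: "odd CARD('p::prime_card)"
  shows "qcong (gauss_char x * gauss_char y) (gauss_char (x + y :: 'p mod_ring))"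
  unfolding gauss_char_def power_add[symmetric]
  by (rule gauss_poly_power_cong[OF odd_p]) (simp only: of_nat_add of_nat_nat_to_int_mod_ring)

lemma gauss_char_0 [simp]: "gauss_char 0 = 1"
  by (simp add: gauss_char_def)

text \<open>The classical product of two Gauss sums, sorted by x + y; pairs with x + y = 0 give the
  constant. Here c is the residue of a + b modulo p - 1, and X^(a + b) stays unreduced because its
  reduction depends on the size of a + b.\<close>

lemma jacobi_sum_qcong:
  assumes odd_p: "odd CARD('p::prime_card)"
    and ab: "a < CARD('p) - 1" "b < CARD('p) - 1"
    and c: "c < CARD('p) - 1" "(CARD('p) - 1) dvd ((CARD('p) - 1 - a) + (CARD('p) - 1 - b) + c)"
  shows "qcong (monom ((of_nat CARD('p) - 1) ^ 2 * (gauss_number a * gauss_number b)) (a + b))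
    (smult (jacobi_sum a b) (monom ((of_nat CARD('p) - 1) * gauss_number c) c) +
      [:\<Sum>x\<in>UNIV - {0 :: 'p mod_ring}. teich x ^ (CARD('p) - 1 - a) * teich (- x) ^ (CARD('p) - 1 - b):])"
proof -
  let ?s = "CARD('p) - 1"
  let ?S = "of_nat ?s :: 'p padic"
  let ?D = "UNIV - {0 :: 'p mod_ring}"
  define f where "f = (\<lambda>x y :: 'p mod_ring. teich x ^ (?s - a) * teich y ^ (?s - b))"
  define k where "k = (?s - a) + (?s - b)"
  have S: "?S = of_nat CARD('p) - 1" using p_gt_1[where 'p='p] by (simp add: of_nat_diff)
  have exps: "?s dvd (?s - a + a)" "?s dvd (?s - b + b)" using ab by simp_all
  define U V where "U = (\<Sum>x\<in>?D. smult (teich x ^ (?s - a)) (gauss_twist (teich x)))"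
    and "V = (\<Sum>y\<in>?D. smult (teich y ^ (?s - b)) (gauss_twist (teich y)))"
  have "U * V = (\<Sum>x\<in>?D. \<Sum>y\<in>?D. smult (f x y) (gauss_twist (teich x) * gauss_twist (teich y)))"
    unfolding U_def V_def sum_product by (intro sum.cong refl) (simp add: f_def mult.commute)
  moreover have "U * V = monom (?S * gauss_number a) a * monom (?S * gauss_number b) b"
    unfolding U_def V_def sum_gauss_twist[OF ab(1) exps(1)] sum_gauss_twist[OF ab(2) exps(2)] ..
  moreover have "monom (?S * gauss_number a) a * monom (?S * gauss_number b) b = monom (?S ^ 2 * (gauss_number a * gauss_number b)) (a + b)"
    by (simp add: mult_monom power2_eq_square mult_ac)
  ultimately have lhs: "monom (?S ^ 2 * (gauss_number a * gauss_number b)) (a + b) =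
      (\<Sum>x\<in>?D. \<Sum>y\<in>?D. smult (f x y) (gauss_twist (teich x) * gauss_twist (teich y)))"
    by (simp only:)
  have "qcong (\<Sum>x\<in>?D. \<Sum>y\<in>?D. smult (f x y) (gauss_twist (teich x) * gauss_twist (teich y)))
      (\<Sum>x\<in>?D. \<Sum>y\<in>?D. smult (f x y) (gauss_char (x + y)))"
  proof (intro qcong_sum qcong_smult)
    fix x y assume xy: "x \<in> ?D" "y \<in> ?D"
    have "qcong (gauss_twist (teich x) * gauss_twist (teich y)) (gauss_char x * gauss_char y)"
      using xy by (intro qcong_mult gauss_char_twist odd_p) auto
    then show "qcong (gauss_twist (teich x) * gauss_twist (teich y)) (gauss_char (x + y))"
      by (rule qcong_trans[OF _ gauss_char_add[OF odd_p]])
  qed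
  also have "(\<Sum>x\<in>?D. \<Sum>y\<in>?D. smult (f x y) (gauss_char (x + y))) =
      (\<Sum>x\<in>?D. smult (f x (- x)) (gauss_char (x + - x))) +
      (\<Sum>z\<in>?D. \<Sum>t\<in>UNIV - {0, 1}. smult (f (z * t) (z * (1 - t))) (gauss_char (z * t + z * (1 - t))))"
    by (rule sum_pairs_nonzero)
  finally have 1: "qcong (monom (?S ^ 2 * (gauss_number a * gauss_number b)) (a + b))
     ((\<Sum>x\<in>?D. smult (f x (- x)) (gauss_char (x + - x))) +
      (\<Sum>z\<in>?D. \<Sum>t\<in>UNIV - {0, 1}. smult (f (z * t) (z * (1 - t))) (gauss_char (z * t + z * (1 - t)))))"
    unfolding lhs .
  have Z: "(\<Sum>x\<in>?D. smult (f x (- x)) (gauss_char (x + - x))) = [:\<Sum>x\<in>?D. f x (- x):]"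
    unfolding right_minus gauss_char_0 smult_sum[symmetric] by simp
  have "(\<Sum>z\<in>?D. \<Sum>t\<in>UNIV - {0, 1}. smult (f (z * t) (z * (1 - t))) (gauss_char (z * t + z * (1 - t)))) =
      (\<Sum>z\<in>?D. smult (jacobi_sum a b) (smult (teich z ^ k) (gauss_char z)))"
  proof (rule sum.cong[OF refl])
    fix z assume "z \<in> ?D"
    then have z: "z \<noteq> 0" by simp
    have "(\<Sum>t\<in>UNIV - {0, 1}. smult (f (z * t) (z * (1 - t))) (gauss_char (z * t + z * (1 - t)))) =
        (\<Sum>t\<in>UNIV - {0, 1}. smult (teich z ^ k * (teich t ^ (?s - a) * teich (1 - t) ^ (?s - b))) (gauss_char z))"
    proof (rule sum.cong[OF refl])
      fix t :: "'p mod_ring" assume "t \<in> UNIV - {0, 1}"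
      then have "t \<noteq> 0" "1 - t \<noteq> 0" by auto
      then have "f (z * t) (z * (1 - t)) = teich z ^ k * (teich t ^ (?s - a) * teich (1 - t) ^ (?s - b))"
        using z by (simp add: f_def teich_mult power_mult_distrib k_def power_add mult_ac)
      moreover have "z * t + z * (1 - t) = z" by (simp add: algebra_simps)
      ultimately show "smult (f (z * t) (z * (1 - t))) (gauss_char (z * t + z * (1 - t))) =
          smult (teich z ^ k * (teich t ^ (?s - a) * teich (1 - t) ^ (?s - b))) (gauss_char z)" by (simp only:)
    qed
    also have "\<dots> = smult (jacobi_sum a b) (smult (teich z ^ k) (gauss_char z))"
      by (simp add: jacobi_sum_def smult_sum[symmetric] sum_distrib_left[symmetric] mult.commute)
    finally show "(\<Sum>t\<in>UNIV - {0, 1}. smult (f (z * t) (z * (1 - t))) (gauss_char (z * t + z * (1 - t)))) =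
        smult (jacobi_sum a b) (smult (teich z ^ k) (gauss_char z))" .
  qed
  also have "\<dots> = smult (jacobi_sum a b) (\<Sum>z\<in>?D. smult (teich z ^ k) (gauss_char z))"
    by (rule smult_sum2[symmetric])
  finally have 2: "(\<Sum>z\<in>?D. \<Sum>t\<in>UNIV - {0, 1}. smult (f (z * t) (z * (1 - t))) (gauss_char (z * t + z * (1 - t)))) =
      smult (jacobi_sum a b) (\<Sum>z\<in>?D. smult (teich z ^ k) (gauss_char z))" .
  have "qcong (\<Sum>z\<in>?D. smult (teich z ^ k) (gauss_char z)) (\<Sum>z\<in>?D. smult (teich z ^ k) (gauss_twist (teich z)))"
    by (intro qcong_sum qcong_smult qcong_sym[OF gauss_char_twist] odd_p) simp
  then have 3: "qcong (\<Sum>z\<in>?D. smult (teich z ^ k) (gauss_char z)) (monom (?S * gauss_number c) c)"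
    unfolding sum_gauss_twist[OF c(1) c(2)[folded k_def]] .
  have "qcong (monom (?S ^ 2 * (gauss_number a * gauss_number b)) (a + b))
      ([:\<Sum>x\<in>?D. f x (- x):] + smult (jacobi_sum a b) (monom (?S * gauss_number c) c))"
    by (rule qcong_trans[OF 1]) (unfold Z 2, intro qcong_add qcong_refl qcong_smult 3)
  then show ?thesis unfolding S f_def by (simp only: add.commute)
qed

lemma teich_minus_1:
  assumes "odd CARD('p::prime_card)"
  shows "teich (- 1 :: 'p mod_ring) = - 1"
proof -
  have "padic_reduce (- 1 :: 'p padic_int) = - 1"
    using padic_reduce_of_int[of "- 1", where 'p='p] by simp
  moreover have "(- 1 :: 'p padic_int) ^ (CARD('p) - 1) = 1" using assms by simp
  ultimately have "teichmuller (- 1 :: 'p mod_ring) = - 1" by (intro teichmuller_eqI) simp_all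
  then show ?thesis by (simp add: teich_def)
qed

lemma sum_teich_opposite:
  assumes "odd CARD('p::prime_card)" and "i \<le> CARD('p) - 1" "j \<le> CARD('p) - 1"
  shows "(\<Sum>x\<in>UNIV - {0 :: 'p mod_ring}. teich x ^ i * teich (- x) ^ j) =
    (if (CARD('p) - 1) dvd (i + j) then (- 1) ^ j * (of_nat CARD('p) - 1) else 0)"
proof -
  have "(\<Sum>x\<in>UNIV - {0 :: 'p mod_ring}. teich x ^ i * teich (- x) ^ j) = (\<Sum>x\<in>UNIV - {0 :: 'p mod_ring}. (- 1) ^ j * teich x ^ (i + j))"
  proof (rule sum.cong[OF refl])
    fix x :: "'p mod_ring" assume "x \<in> UNIV - {0}"
    then have "teich (- x) = - 1 * teich x" using teich_mult[of "- 1" x] teich_minus_1[OF assms(1)] by simp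
    then have "teich (- x) ^ j = (- 1) ^ j * teich x ^ j" by (simp only: power_mult_distrib)
    then show "teich x ^ i * teich (- x) ^ j = (- 1) ^ j * teich x ^ (i + j)" by (simp add: power_add)
  qed
  also have "\<dots> = (- 1) ^ j * (\<Sum>x\<in>UNIV - {0 :: 'p mod_ring}. teich x ^ (i + j))" by (simp add: sum_distrib_left)
  finally show ?thesis using p_gt_1[where 'p='p] by (simp add: sum_teich_power of_nat_diff)
qed

lemma gauss_square_eq:
  "(of_nat CARD('p) - 1) ^ 2 * (gauss_number a * gauss_number b) = gamma_number a * (gamma_number b :: 'p::prime_card padic)"
proof -
  have "(of_nat CARD('p) - 1) ^ 2 * (gauss_number a * gauss_number b) =
      ((of_nat CARD('p) - 1) * gauss_number a) * ((of_nat CARD('p) - 1) * gauss_number b :: 'p padic)"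
    by (simp add: power2_eq_square mult_ac)
  then show ?thesis unfolding gauss_number_eq by simp
qed

lemma not_dvd_between:
  assumes "s < n" "n < 2 * (s :: nat)"
  shows "\<not> s dvd n"
proof
  assume "s dvd n"
  then obtain k where k: "n = s * k" by (auto simp: dvd_def)
  then have "s * 1 < s * k" "s * k < s * 2" using assms by simp_all
  then have "1 < k" "k < 2" by (simp_all only: mult_less_cancel1)
  then show False by simp
qed

text \<open>Below degree p - 1 both sides are reduced and the constant vanishes, so the coefficients
  at a + b can be compared.\<close>

lemma jacobi_sum_small:
  assumes odd_p: "odd CARD('p::prime_card)" and ab: "0 < a + b" "a + b < CARD('p) - 1"
  shows "gamma_number a * gamma_number b = - jacobi_sum a b * (gamma_number (a + b) :: 'p padic)"
proof -
  let ?s = "CARD('p) - 1"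
  have d: "?s - a + (?s - b) + (a + b) = ?s * 2" using ab by simp
  have nd: "\<not> ?s dvd (?s - a + (?s - b))"
    by (rule not_dvd_between) (use ab d in linarith)+
  have "qcong (monom (gamma_number a * gamma_number b) (a + b))
      (smult (jacobi_sum a b) (monom (- gamma_number (a + b)) (a + b)) + [:0 :: 'p padic:])"
    using jacobi_sum_qcong[OF odd_p, of a b "a + b"] ab d nd
    by (simp add: gauss_square_eq gauss_number_eq sum_teich_opposite[OF odd_p])
  then have "monom (gamma_number a * gamma_number b) (a + b) =
      smult (jacobi_sum a b) (monom (- gamma_number (a + b)) (a + b)) + [:0 :: 'p padic:]"
    by (rule qcong_reduced_eq) (use ab in \<open>auto simp: coeff_monom\<close>)
  then have "coeff (monom (gamma_number a * gamma_number b) (a + b)) (a + b) =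
      coeff (smult (jacobi_sum a b) (monom (- gamma_number (a + b)) (a + b)) + [:0 :: 'p padic:]) (a + b)"
    by (simp only:)
  then show ?thesis by simp
qed

lemma qcong_monom_wrap:
  assumes "m \<ge> CARD('p::prime_card) - 1"
  shows "qcong (monom (- of_nat CARD('p) * c) (m - (CARD('p) - 1))) (monom (c :: 'p padic) m)"
  using qcong_sym[OF qcong_monom[of c "m - (CARD('p) - 1)" 1]] assms by (simp add: mult.commute)

text \<open>Reducing X^(a + b) yields one factor -p; this is where the powers of p in the series
  come from.\<close>

lemma jacobi_sum_large:
  assumes odd_p: "odd CARD('p::prime_card)" and ab: "a < CARD('p) - 1" "b < CARD('p) - 1" "a + b > CARD('p) - 1"
  shows "of_nat CARD('p) * (gamma_number a * gamma_number b) = jacobi_sum a b * (gamma_number (a + b - (CARD('p) - 1)) :: 'p padic)"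
proof -
  let ?s = "CARD('p) - 1"
  let ?c = "a + b - ?s"
  have d: "?s - a + (?s - b) + ?c = ?s" using ab by simp
  have nd: "\<not> ?s dvd (?s - a + (?s - b))"
    by (rule nat_dvd_not_less) (use ab d in linarith)+
  have "qcong (monom (gamma_number a * gamma_number b) (a + b))
      (smult (jacobi_sum a b) (monom (- gamma_number ?c) ?c) + [:0 :: 'p padic:])"
    using jacobi_sum_qcong[OF odd_p, of a b ?c] ab d nd
    by (simp add: gauss_square_eq gauss_number_eq sum_teich_opposite[OF odd_p])
  from qcong_trans[OF qcong_monom_wrap[OF less_imp_le[OF ab(3)]] this]
  have "qcong (monom (- of_nat CARD('p) * (gamma_number a * gamma_number b)) ?c)
      (smult (jacobi_sum a b) (monom (- gamma_number ?c) ?c) + [:0 :: 'p padic:])" .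
  then have "monom (- of_nat CARD('p) * (gamma_number a * gamma_number b)) ?c =
      smult (jacobi_sum a b) (monom (- gamma_number ?c) ?c) + [:0 :: 'p padic:]"
    by (rule qcong_reduced_eq) (use ab in \<open>auto simp: coeff_monom\<close>)
  then have "coeff (monom (- of_nat CARD('p) * (gamma_number a * gamma_number b)) ?c) ?c =
      coeff (smult (jacobi_sum a b) (monom (- gamma_number ?c) ?c) + [:0 :: 'p padic:]) ?c"
    by (simp only:)
  then show ?thesis by simp
qed

text \<open>With u = (1 - t)/t the summand is \<omega>(u)^a, as \<omega>(t)^b = \<omega>(t)^(-a).
  Only u = -1 is missing from the vanishing sum over all nonzero u.\<close>

lemma jacobi_sum_opposite:
  assumes odd_p: "odd CARD('p::prime_card)" and ab: "0 < a" "0 < b" "a + b = CARD('p) - 1"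
  shows "jacobi_sum a b = - ((- 1) ^ a :: 'p padic)"
proof -
  let ?s = "CARD('p) - 1"
  have sa: "?s - a = b" "?s - b = a" using ab by auto
  have "jacobi_sum a b = (\<Sum>t\<in>UNIV - {0, 1 :: 'p mod_ring}. teich t ^ b * teich (1 - t) ^ a)"
    by (simp only: jacobi_sum_def sa)
  also have "\<dots> = (\<Sum>u\<in>UNIV - {0, - 1 :: 'p mod_ring}. teich u ^ a)"
  proof (rule sum.reindex_bij_witness[where i = "\<lambda>u. 1 / (1 + u)" and j = "\<lambda>t. (1 - t) / t"])
    fix t :: "'p mod_ring" assume t: "t \<in> UNIV - {0, 1}"
    then have nz: "t \<noteq> 0" "1 - t \<noteq> 0" by auto
    show "1 / (1 + (1 - t) / t) = t" using nz by (simp add: field_simps)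
    show "(1 - t) / t \<in> UNIV - {0, - 1}" using nz by (auto simp: field_simps)
    have "teich ((1 - t) / t) = teich (1 - t) * inverse (teich t)"
      using nz by (simp add: divide_inverse teich_mult teich_inverse)
    then have "teich ((1 - t) / t) ^ a = teich (1 - t) ^ a * inverse (teich t ^ a)"
      by (simp add: power_mult_distrib power_inverse)
    also have "inverse (teich t ^ a) = teich t ^ b"
    proof (rule inverse_unique)
      show "teich t ^ a * teich t ^ b = 1" using teich_power_card[OF nz(1)] ab(3) by (simp flip: power_add)
    qed
    finally show "teich ((1 - t) / t) ^ a = teich t ^ b * teich (1 - t) ^ a" by (simp add: mult.commute)
  next
    fix u :: "'p mod_ring" assume "u \<in> UNIV - {0, - 1}"
    then have u: "u \<noteq> 0" "1 + u \<noteq> 0" by (auto simp: add_eq_0_iff)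
    show "(1 - 1 / (1 + u)) / (1 / (1 + u)) = u" using u by (simp add: field_simps)
    show "1 / (1 + u) \<in> UNIV - {0, 1}" using u by (auto simp: field_simps)
  qed
  also have "\<dots> = (\<Sum>u\<in>UNIV - {0 :: 'p mod_ring}. teich u ^ a) - teich (- 1 :: 'p mod_ring) ^ a"
  proof -
    have "UNIV - {0} - {- 1} = UNIV - {0, - 1 :: 'p mod_ring}" by blast
    then show ?thesis by (subst sum.remove[of "UNIV - {0}" "- 1"]) simp_all
  qed
  also have "(\<Sum>u\<in>UNIV - {0 :: 'p mod_ring}. teich u ^ a) = 0"
    unfolding sum_teich_power using ab by (auto dest: dvd_imp_le)
  finally show ?thesis by (simp add: teich_minus_1[OF odd_p])
qed

text \<open>Here c = 0, so after reduction both sides are constants and the pairs with x + y = 0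
  matter: -p times the product equals (-1)^a + (-1)^a (p - 1).\<close>

lemma gamma_number_reflection:
  assumes odd_p: "odd CARD('p::prime_card)" and ab: "0 < a" "0 < b" "a + b = CARD('p) - 1"
  shows "gamma_number a * gamma_number b = - ((- 1) ^ a :: 'p padic)"
proof -
  let ?s = "CARD('p) - 1"
  have d: "?s - a + (?s - b) + 0 = ?s" using ab by simp
  have lt: "a < ?s" "b < ?s" "0 < ?s" "?s - a = b" "?s - b = a" using ab by auto
  have "qcong (monom (gamma_number a * gamma_number b) (a + b))
      (smult (jacobi_sum a b) (monom (- 1) 0) + [:(- 1) ^ a * (of_nat CARD('p) - 1) :: 'p padic:])"
    using jacobi_sum_qcong[OF odd_p lt(1,2,3)] d ab(3) lt
    by (simp add: gauss_square_eq gauss_number_eq sum_teich_opposite[OF odd_p] gamma_number_0[OF odd_p] add.commute)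
  from qcong_trans[OF qcong_monom_wrap this] ab(3)
  have "qcong (monom (- of_nat CARD('p) * (gamma_number a * gamma_number b)) 0)
      (smult (jacobi_sum a b) (monom (- 1) 0) + [:(- 1) ^ a * (of_nat CARD('p) - 1) :: 'p padic:])" by simp
  then have "monom (- of_nat CARD('p) * (gamma_number a * gamma_number b)) 0 =
      smult (jacobi_sum a b) (monom (- 1) 0) + [:(- 1) ^ a * (of_nat CARD('p) - 1) :: 'p padic:]"
    by (rule qcong_reduced_eq) (use lt(3) in \<open>auto simp: coeff_monom coeff_pCons split: nat.splits\<close>)
  then have "coeff (monom (- of_nat CARD('p) * (gamma_number a * gamma_number b)) 0) 0 =
      coeff (smult (jacobi_sum a b) (monom (- 1) 0) + [:(- 1) ^ a * (of_nat CARD('p) - 1) :: 'p padic:]) 0"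
    by (simp only:)
  then have "of_nat CARD('p) * (gamma_number a * gamma_number b) = of_nat CARD('p) * (- ((- 1) ^ a) :: 'p padic)"
  proof -
    let ?x = "of_nat CARD('p) * (gamma_number a * gamma_number b) :: 'p padic"
    assume "coeff (monom (- of_nat CARD('p) * (gamma_number a * gamma_number b)) 0) 0 =
      coeff (smult (jacobi_sum a b) (monom (- 1) 0) + [:(- 1) ^ a * (of_nat CARD('p) - 1) :: 'p padic:]) 0"
    then have "- ?x = of_nat CARD('p) * (- 1) ^ a"
      unfolding jacobi_sum_opposite[OF odd_p ab] by (simp add: algebra_simps)
    then have "- (- ?x) = - (of_nat CARD('p) * (- 1) ^ a)" by (simp only:)
    then show ?thesis by (simp only: minus_minus mult_minus_right)
  qed
  moreover have "(of_nat CARD('p) :: 'p padic) \<noteq> 0" by simp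
  ultimately show ?thesis by (simp only: mult_left_cancel simp_thms)
qed

section \<open>The multiplication formula\<close>

lemma padic_unit_of_nat_inverse:
  assumes "\<not> CARD('p::prime_card) dvd m"
  shows "\<exists>z :: 'p padic_int. of_nat m * z = 1"
proof -
  have "\<not> padic_cong 1 (of_nat m :: 'p padic_int) (of_nat 0)"
    unfolding padic_cong_of_nat_iff using assms by (simp add: cong_0_iff)
  then show ?thesis by (metis padic_inverse_exists of_nat_0)
qed

text \<open>Raising y by 1 shifts the m arguments by one place, so only the end factors change: the
  value at y/m is replaced by the one at y/m + 1.\<close>

lemma prod_padic_Gamma_step:
  fixes y w :: "'p::prime_card padic_int"
  assumes odd_p: "odd CARD('p)" and w: "of_nat m * w = 1"
  shows "(\<Prod>h<m. padic_Gamma ((y + 1 + of_nat h) * w)) =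
    (\<Prod>h<m. padic_Gamma ((y + of_nat h) * w)) * (if padic_cong 1 y 0 then - 1 else - (y * w))"
proof -
  define g where "g = (\<lambda>h. padic_Gamma ((y + of_nat h) * w))"
  have m: "m > 0" using w by (cases m) auto
  have "(\<Prod>h<m. padic_Gamma ((y + 1 + of_nat h) * w)) = (\<Prod>h<m. g (Suc h))"
    unfolding g_def by (intro prod.cong refl) (simp add: add_ac)
  then have "g 0 * (\<Prod>h<m. padic_Gamma ((y + 1 + of_nat h) * w)) = (\<Prod>h<Suc m. g h)"
    by (simp add: prod.lessThan_Suc_shift del: prod.lessThan_Suc)
  also have "\<dots> = (\<Prod>h<m. g h) * g m" by simp
  also have "g m = padic_Gamma (y * w + 1)"
    using w by (simp add: g_def distrib_right)
  also have "\<dots> = (if padic_cong 1 y 0 then - 1 else - (y * w)) * g 0"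
  proof -
    have "padic_cong 1 (y * w) 0 \<longleftrightarrow> padic_cong 1 y 0"
    proof
      assume "padic_cong 1 (y * w) 0"
      then have "padic_cong 1 (y * w * of_nat m) (0 * of_nat m)" by (intro padic_cong_mult padic_cong_refl)
      moreover have "y * w * of_nat m = (of_nat m * w) * y" by (simp only: mult_ac)
      then have "y * w * of_nat m = y" by (simp only: w mult_1_left)
      ultimately show "padic_cong 1 y 0" by (simp only: mult_zero_left)
    next
      assume "padic_cong 1 y 0"
      then have "padic_cong 1 (y * w) (0 * w)" by (intro padic_cong_mult padic_cong_refl)
      then show "padic_cong 1 (y * w) 0" by (simp only: mult_zero_left)
    qed
    then show ?thesis unfolding padic_Gamma_plus_1[OF odd_p] by (simp add: g_def)
  qed
  finally have "g 0 * (\<Prod>h<m. padic_Gamma ((y + 1 + of_nat h) * w)) =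
      g 0 * ((\<Prod>h<m. g h) * (if padic_cong 1 y 0 then - 1 else - (y * w)))" by (simp only: mult_ac)
  moreover have "g 0 \<noteq> 0" using padic_Gamma_unit[OF odd_p, of "(y + of_nat 0) * w"] by (auto simp: g_def)
  ultimately have "(\<Prod>h<m. padic_Gamma ((y + 1 + of_nat h) * w)) =
      (\<Prod>h<m. g h) * (if padic_cong 1 y 0 then - 1 else - (y * w))" by (simp only: mult_left_cancel simp_thms)
  then show ?thesis by (simp only: g_def)
qed

text \<open>A step from n to n + 1 contributes -n/m on the left and -n on the right if p does not
  divide n, and -1 on both sides otherwise. The exponent counts the j < n prime to p.\<close>

lemma prod_padic_Gamma_of_nat:
  fixes w :: "'p::prime_card padic_int"
  assumes odd_p: "odd CARD('p)" and w: "of_nat m * w = 1"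
  shows "(\<Prod>h<m. padic_Gamma ((of_nat n + of_nat h) * w)) * of_nat m ^ (n - (n + CARD('p) - 1) div CARD('p)) =
    (\<Prod>h<m. padic_Gamma (of_nat h * w)) * padic_Gamma (of_nat n)"
proof (induction n)
  case 0
  have "(CARD('p) - 1) div CARD('p) = 0" using p_gt_1[where 'p='p] by (intro div_less) simp
  then show ?case using padic_Gamma_of_nat[OF odd_p, of 0] by simp
next
  case (Suc n)
  let ?p = "CARD('p)"
  let ?F = "\<lambda>n. (\<Prod>h<m. padic_Gamma ((of_nat n + of_nat h) * w))"
  define c where "c = (n + ?p - 1) div ?p"
  have cn: "c \<le> n"
  proof (cases n)
    case 0
    have "(?p - 1) div ?p = 0" using p_gt_1[where 'p='p] by (intro div_less) simp
    then show ?thesis using 0 by (simp add: c_def)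
  next
    case (Suc k)
    have "c = (k + ?p) div ?p" unfolding c_def Suc by simp
    then have "c = k div ?p + 1" by simp
    then show ?thesis using Suc by simp
  qed
  have z: "padic_cong 1 (of_nat n :: 'p padic_int) 0 \<longleftrightarrow> ?p dvd n"
    using padic_cong_of_nat_iff[of 1 n 0, where 'p='p] by (simp add: cong_0_iff)
  have "n + ?p = Suc (n + ?p - 1)" using p_gt_1[where 'p='p] by simp
  then have c': "(Suc n + ?p - 1) div ?p = (if ?p dvd n then Suc c else c)"
    unfolding c_def using div_Suc[of "n + ?p - 1" ?p] by (simp add: dvd_eq_mod_eq_0)
  have F: "?F (Suc n) = ?F n * (if padic_cong 1 (of_nat n :: 'p padic_int) 0 then - 1 else - (of_nat n * w))"
    using prod_padic_Gamma_step[OF odd_p w, of "of_nat n"] by (simp add: add.commute del: One_nat_def)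
  have G: "padic_Gamma (of_nat (Suc n) :: 'p padic_int) = (if padic_cong 1 (of_nat n :: 'p padic_int) 0 then - 1 else - of_nat n) * padic_Gamma (of_nat n)"
    using padic_Gamma_plus_1[OF odd_p, of "of_nat n"] by (simp add: add.commute del: One_nat_def)
  show ?case
  proof (cases "?p dvd n")
    case True
    then have "Suc n - (Suc n + ?p - 1) div ?p = n - c" using c' by simp
    then have "?F (Suc n) * of_nat m ^ (Suc n - (Suc n + ?p - 1) div ?p) = - (?F n * of_nat m ^ (n - c))"
      unfolding F using z True by (simp del: One_nat_def)
    also have "\<dots> = (\<Prod>h<m. padic_Gamma (of_nat h * w)) * padic_Gamma (of_nat (Suc n))"
      unfolding Suc[folded c_def] G using z True by (simp del: One_nat_def)
    finally show ?thesis .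
  next
    case False
    then have e: "Suc n - (Suc n + ?p - 1) div ?p = Suc (n - c)" using c' cn by simp
    have "?F (Suc n) * of_nat m ^ Suc (n - c) = (?F n * of_nat m ^ (n - c)) * (- of_nat n * (of_nat m * w))"
    proof -
      have "?F (Suc n) = ?F n * - (of_nat n * w)" unfolding F using z False by (simp del: One_nat_def)
      then show ?thesis by (simp only: power_Suc mult_ac mult_minus_left mult_minus_right)
    qed
    also have "\<dots> = ((\<Prod>h<m. padic_Gamma (of_nat h * w)) * padic_Gamma (of_nat n)) * (- of_nat n)"
      unfolding Suc[folded c_def] w by simp
    also have "\<dots> = (\<Prod>h<m. padic_Gamma (of_nat h * w)) * padic_Gamma (of_nat (Suc n))"
      unfolding G using z False by (simp add: mult_ac del: One_nat_def)
    finally show ?thesis unfolding e .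
  qed
qed

lemma power_sum_eq: "p > 0 \<Longrightarrow> (p - 1) * (\<Sum>i<N. p ^ i) + 1 = p ^ N" for p :: nat
  by (cases p; induction N) (auto simp: algebra_simps)

text \<open>
  For \<open>y = b/(p-1)\<close> the exponents of m in the natural approximants \<open>b (p^N - (1 + p + \<dots> + p^(N-1)))\<close>
  of y are \<open>b (p - 2) p^(N-1)\<close>, so the power of m tends to a value of the Teichmueller character.
\<close>

lemma prod_padic_Gamma:
  fixes y w :: "'p::prime_card padic_int"
  assumes odd_p: "odd CARD('p)" and w: "of_nat m * w = 1" and m: "\<not> CARD('p) dvd m"
    and y: "(of_nat CARD('p) - 1) * y = of_nat b" and b: "b < CARD('p)"
  shows "(\<Prod>h<m. padic_Gamma ((y + of_nat h) * w)) =
    teichmuller (of_nat m) ^ b * padic_Gamma y * (\<Prod>h<m. padic_Gamma (of_nat h * w))"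
proof -
  let ?p = "CARD('p)"
  let ?t = "teichmuller (of_nat m :: 'p mod_ring)"
  let ?F = "\<lambda>y. (\<Prod>h<m. padic_Gamma ((y + of_nat h) * w))"
  have p3: "?p \<ge> 3" by (rule p_ge_3[OF odd_p])
  define g where "g = (\<lambda>N. \<Sum>i<N. ?p ^ i)"
  have g: "(?p - 1) * g N + 1 = ?p ^ N" for N
    unfolding g_def by (rule power_sum_eq) simp
  have g_le: "g N \<le> ?p ^ N" for N
  proof -
    have "1 * g N \<le> (?p - 1) * g N" by (intro mult_le_mono1) (use p3 in linarith)
    then show ?thesis using g[of N] by linarith
  qed
  define x where "x = (\<lambda>N. b * (?p ^ N - g N))"
  have px: "(?p - 1) * x N = b * ((?p - 2) * ?p ^ N + 1)" for N
  proof -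
    have "(?p - 1) * (?p ^ N - g N) + (?p - 1) * g N = (?p - 1) * ?p ^ N"
      using g_le[of N] by (simp flip: distrib_left)
    moreover have "?p - 1 = (?p - 2) + 1" using p3 by simp
    then have "(?p - 1) * ?p ^ N = ((?p - 2) + 1) * ?p ^ N" by (simp only:)
    then have "(?p - 1) * ?p ^ N = (?p - 2) * ?p ^ N + ?p ^ N" by (simp only: distrib_right mult_1)
    ultimately have "(?p - 1) * (?p ^ N - g N) = (?p - 2) * ?p ^ N + 1" using g[of N] by linarith
    then show ?thesis unfolding x_def by (simp only: mult.left_commute)
  qed
  have xS: "x (Suc N) + b = ?p * x N" for N
  proof -
    have "g (Suc N) = 1 + ?p * g N" using g[of N] p3 unfolding g_def
      by (simp add: sum.lessThan_Suc_shift sum_distrib_left del: sum.lessThan_Suc)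
    moreover have "?p * g N + 1 \<le> ?p * ?p ^ N" using g_le[of "Suc N"] calculation by simp
    ultimately have "(?p ^ Suc N - g (Suc N)) + 1 = ?p * (?p ^ N - g N)" by (simp add: diff_mult_distrib2)
    then have "b * ((?p ^ Suc N - g (Suc N)) + 1) = b * (?p * (?p ^ N - g N))" by (simp only:)
    then show ?thesis by (simp add: x_def algebra_simps)
  qed
  \<comment> \<open>As p \<open>x N\<close> = \<open>x (Suc N)\<close> + b with b < p, the quotient
    of \<open>x (Suc N)\<close> by p, rounded up, is \<open>x N\<close>.\<close>
  have expo: "x (Suc N) - (x (Suc N) + ?p - 1) div ?p = ?p ^ N * (b * (?p - 2))" for N
  proof -
    have "x (Suc N) + ?p - 1 = ?p * x N + (?p - 1 - b)" using xS[of N] b by linarith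
    moreover have "(?p * x N + (?p - 1 - b)) div ?p = x N"
      using p3 by (subst div_mult_self4) auto
    ultimately have 1: "(x (Suc N) + ?p - 1) div ?p = x N" by (simp only:)
    have "(?p - 1) * x N + x N = ?p * x N" 
    proof -
      have "(?p - 1) * x N + x N = ((?p - 1) + 1) * x N" by (simp only: distrib_right mult_1)
      moreover have "(?p - 1) + 1 = ?p" using p3 by simp
      ultimately show ?thesis by (simp only:)
    qed
    then have "x (Suc N) + b = b * ((?p - 2) * ?p ^ N + 1) + x N" using xS[of N] px[of N] by linarith
    then have "x (Suc N) = b * ((?p - 2) * ?p ^ N) + x N" by (simp add: distrib_left)
    then show ?thesis unfolding 1 by (simp add: mult_ac)
  qed
  have approx: "padic_cong N (of_nat (x N)) y" for N
  proof -
    obtain v :: "'p padic_int" where v: "(of_nat ?p - 1) * v = 1" using inv_p_minus_1 by blast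
    have "(of_nat ?p - 1) * (of_nat (x N) - y) = (of_nat ((?p - 1) * x N) - of_nat b :: 'p padic_int)"
      using y p3 by (simp add: of_nat_diff algebra_simps)
    also have "\<dots> = of_nat ?p ^ N * of_nat (b * (?p - 2))"
      unfolding px by (simp only: distrib_left of_nat_add of_nat_mult mult_1_right mult_1_left of_nat_1 of_nat_power add_diff_cancel_right' mult_ac)
    finally have "v * ((of_nat ?p - 1) * (of_nat (x N) - y)) = v * (of_nat ?p ^ N * of_nat (b * (?p - 2)))" by (simp only:)
    moreover have "v * ((of_nat ?p - 1) * (of_nat (x N) - y)) = ((of_nat ?p - 1) * v) * (of_nat (x N) - y)"
      by (simp only: mult_ac)
    ultimately have "of_nat (x N) - y = v * (of_nat ?p ^ N * of_nat (b * (?p - 2)))"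
      by (simp only: v mult_1_left)
    then have "of_nat (x N) - y = of_nat ?p ^ N * (v * of_nat (b * (?p - 2)))"
      by (simp only: mult.left_commute)
    then show ?thesis by (simp add: padic_cong_iff_dvd)
  qed
  have "?F y * ?t ^ (b * (?p - 2)) = (\<Prod>h<m. padic_Gamma (of_nat h * w)) * padic_Gamma y"
  proof (rule padic_eqI)
    fix N
    have ap: "padic_cong N y (of_nat (x (Suc N)))"
      by (rule padic_cong_sym, rule padic_cong_mono[OF approx]) simp
    have "padic_cong N ?t (of_nat m ^ (?p ^ N))"
      by (rule padic_cong_mono[OF teichmuller_of_nat_cong[OF m]]) simp
    then have "padic_cong N (?t ^ (b * (?p - 2))) (of_nat m ^ (?p ^ N * (b * (?p - 2))))"
      unfolding power_mult[of _ "?p ^ N"] by (rule padic_cong_power)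
    then have "padic_cong N (?F y * ?t ^ (b * (?p - 2))) (?F (of_nat (x (Suc N))) * of_nat m ^ (?p ^ N * (b * (?p - 2))))"
      by (intro padic_cong_mult padic_cong_prod padic_Gamma_cong odd_p padic_cong_add padic_cong_refl ap)
    also have "?F (of_nat (x (Suc N))) * of_nat m ^ (?p ^ N * (b * (?p - 2))) =
        (\<Prod>h<m. padic_Gamma (of_nat h * w)) * padic_Gamma (of_nat (x (Suc N)))"
      using prod_padic_Gamma_of_nat[OF odd_p w, of "x (Suc N)"] unfolding expo .
    also have "padic_cong N \<dots> ((\<Prod>h<m. padic_Gamma (of_nat h * w)) * padic_Gamma y)"
      by (intro padic_cong_mult padic_cong_refl padic_Gamma_cong odd_p padic_cong_sym[OF ap])
    finally show "padic_cong N (?F y * ?t ^ (b * (?p - 2))) ((\<Prod>h<m. padic_Gamma (of_nat h * w)) * padic_Gamma y)" .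
  qed
  then have "?F y * ?t ^ (b * (?p - 2)) * ?t ^ b = (\<Prod>h<m. padic_Gamma (of_nat h * w)) * padic_Gamma y * ?t ^ b"
    by (simp only:)
  \<comment> \<open>The exponents add up to b (p - 1); so the limit of the powers of m is the
    inverse of \<omega>(m)^b.\<close>
  moreover have "?t ^ (b * (?p - 2)) * ?t ^ b = 1"
  proof -
    have nz: "(of_nat m :: 'p mod_ring) \<noteq> 0"
      using m of_nat_mod_ring_eq_iff[of m 0, where 'p='p] by (simp add: cong_0_iff)
    have "b * (?p - 2) + b = (?p - 1) * b" using p3 by (simp add: algebra_simps diff_mult_distrib2)
    then have "?t ^ (b * (?p - 2)) * ?t ^ b = (?t ^ (?p - 1)) ^ b" by (simp flip: power_add power_mult)
    then show ?thesis using teichmuller_power_card[OF nz] by simp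
  qed
  ultimately have "?F y * 1 = (\<Prod>h<m. padic_Gamma (of_nat h * w)) * padic_Gamma y * ?t ^ b"
    by (simp only: mult.assoc)
  then show ?thesis by (simp only: mult_1_right mult_1_left mult_ac)
qed

section \<open>Gamma products and floor sums at rational arguments\<close>

lemma padic_int_of_rat_eqI:
  assumes "to_fract y = (of_rat q :: 'p::prime_card padic)"
  shows "padic_int_of_rat q = (y :: 'p padic_int)"
  unfolding padic_int_of_rat_def
  by (rule the_equality) (simp_all only: assms[symmetric] to_fract_eq_iff)

lemma of_rat_of_nat_div_p_minus_1:
  "to_fract (of_nat b * inv_p_minus_1) = (of_rat (of_nat b / (of_nat CARD('p) - 1)) :: 'p::prime_card padic)"
proof -
  have "(of_nat CARD('p) - 1) * to_fract (of_nat b * inv_p_minus_1) = (of_nat b :: 'p padic)"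
    using gauss_number_arg[of b, where 'p='p] by (metis of_nat_fract to_fract_1 to_fract_diff to_fract_mult)
  moreover have "(of_nat CARD('p) - 1 :: 'p padic) \<noteq> 0"
    using one_minus_p_nonzero[where 'p='p] by (metis eq_iff_diff_eq_0)
  ultimately have "to_fract (of_nat b * inv_p_minus_1) = of_nat b / (of_nat CARD('p) - 1 :: 'p padic)"
    by (simp add: field_simps)
  then show ?thesis by (simp only: of_rat_divide of_rat_diff of_rat_of_nat_eq of_rat_1)
qed

lemma padic_Gamma_rat_shift:
  fixes w :: "'p::prime_card padic_int"
  assumes w: "of_nat m * w = 1"
  shows "padic_Gamma_rat ((of_nat b / (of_nat CARD('p) - 1) + of_nat h) / of_nat m) =
    to_fract (padic_Gamma ((of_nat b * inv_p_minus_1 + of_nat h) * w))"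
proof -
  have m: "m \<noteq> 0" using w by (cases m) auto
  have "of_nat m * to_fract w = (1 :: 'p padic)" using w by (metis of_nat_fract to_fract_1 to_fract_mult)
  then have "to_fract w = 1 / (of_nat m :: 'p padic)" using m by (simp add: field_simps)
  then have "to_fract ((of_nat b * inv_p_minus_1 + of_nat h) * w) =
      (of_rat ((of_nat b / (of_nat CARD('p) - 1) + of_nat h) / of_nat m) :: 'p padic)"
    by (simp only: to_fract_mult[of _ w] to_fract_add of_rat_of_nat_div_p_minus_1 of_rat_divide of_rat_add of_rat_of_nat_eq of_nat_fract[symmetric]) simp
  from padic_int_of_rat_eqI[OF this] show ?thesis unfolding padic_Gamma_rat_def by (simp only:)
qed

text \<open>With K the floor of m q, h/m + q = (h + K + frac (m q))/m; it remains to divide h + K by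
  m with remainder.\<close>

lemma floor_frac_shift:
  fixes q :: rat and m h :: nat
  assumes m: "m > 0"
  shows "\<lfloor>of_nat h / of_nat m + q\<rfloor> = (int h + \<lfloor>of_nat m * q\<rfloor>) div int m"
    and "frac (of_nat h / of_nat m + q) = (frac (of_nat m * q) + of_int ((int h + \<lfloor>of_nat m * q\<rfloor>) mod int m)) / of_nat m"
proof -
  let ?K = "\<lfloor>of_nat m * q\<rfloor>"
  define D where "D = (int h + ?K) div int m"
  define M where "M = (int h + ?K) mod int m"
  have DM: "int h + ?K = int m * D + M" by (simp add: D_def M_def)
  have M: "0 \<le> M" "M < int m" using m by (simp_all add: M_def)
  have K: "of_nat m * q = of_int ?K + frac (of_nat m * q)" by (simp add: frac_def)
  have fr: "0 \<le> frac (of_nat m * q)" "frac (of_nat m * q) < 1" by (simp_all add: frac_lt_1)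
  have m0: "(of_nat m :: rat) > 0" using m by simp
  have "of_nat h + of_nat m * q = of_int (int h + ?K) + frac (of_nat m * q)" by (simp add: frac_def)
  also have "\<dots> = of_nat m * of_int D + (of_int M + frac (of_nat m * q))" unfolding DM by simp
  finally have eq: "of_nat h / of_nat m + q = of_int D + (frac (of_nat m * q) + of_int M) / of_nat m"
    using m0 by (simp add: field_simps)
  have lt: "0 \<le> (frac (of_nat m * q) + of_int M) / of_nat m" using fr M m0 by simp
  have "(of_int M :: rat) \<le> of_int (int m - 1)" using M(2) by (simp only: of_int_le_iff)
  then have "(of_int M :: rat) \<le> of_nat m - 1" by simp
  then have gt: "(frac (of_nat m * q) + of_int M) / of_nat m < 1" using fr(2) m0 by (simp add: field_simps)
  show fl: "\<lfloor>of_nat h / of_nat m + q\<rfloor> = (int h + ?K) div int m"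
    unfolding D_def[symmetric] eq using lt gt by (intro floor_unique) simp_all
  show "frac (of_nat h / of_nat m + q) = (frac (of_nat m * q) + of_int ((int h + ?K) mod int m)) / of_nat m"
    unfolding frac_def[of "of_nat h / of_nat m + q"] fl
    unfolding D_def[symmetric] M_def[symmetric] eq by simp
qed

lemma bij_betw_shift_mod:
  assumes "m > 0"
  shows "bij_betw (\<lambda>h. nat ((int h + K) mod int m)) {..<m} {..<m}"
proof (rule bij_betwI[where g = "\<lambda>h. nat ((int h - K) mod int m)"])
  show "(\<lambda>h. nat ((int h + K) mod int m)) \<in> {..<m} \<rightarrow> {..<m}" "(\<lambda>h. nat ((int h - K) mod int m)) \<in> {..<m} \<rightarrow> {..<m}"
    using assms by (auto simp: nat_less_iff)
  fix h assume "h \<in> {..<m}"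
  then have h: "int h mod int m = int h" by simp
  have "int (nat ((int h + K) mod int m)) = (int h + K) mod int m" "int (nat ((int h - K) mod int m)) = (int h - K) mod int m"
    using assms by simp_all
  then show "nat ((int (nat ((int h + K) mod int m)) - K) mod int m) = h"
    and "nat ((int (nat ((int h - K) mod int m)) + K) mod int m) = h"
    using h by (simp_all add: mod_simps)
qed

text \<open>Hermite's identity: the remainders of h + K modulo m permute the h and drop out of the
  sum.\<close>

lemma sum_floor_shift:
  fixes q :: rat
  assumes m: "m > 0"
  shows "(\<Sum>h<m. \<lfloor>of_nat h / of_nat m + q\<rfloor>) = \<lfloor>of_nat m * q\<rfloor>"
proof -
  let ?K = "\<lfloor>of_nat m * q\<rfloor>"
  have "(\<Sum>h<m. int (nat ((int h + ?K) mod int m))) = (\<Sum>h<m. int h)"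
    by (rule sum.reindex_bij_betw[OF bij_betw_shift_mod[OF m]])
  then have "(\<Sum>h<m. (int h + ?K) mod int m) = (\<Sum>h<m. int h)" using m by simp
  moreover have "(\<Sum>h<m. int m * ((int h + ?K) div int m) + (int h + ?K) mod int m) = (\<Sum>h<m. int h + ?K)"
    by simp
  then have "(\<Sum>h<m. int m * ((int h + ?K) div int m)) + (\<Sum>h<m. (int h + ?K) mod int m) = (\<Sum>h<m. int h) + (\<Sum>h<m. ?K)"
    by (simp only: sum.distrib)
  ultimately have "(\<Sum>h<m. int m * ((int h + ?K) div int m)) = (\<Sum>h<m. ?K)" by linarith
  then have "int m * (\<Sum>h<m. (int h + ?K) div int m) = int m * ?K"
    by (simp add: sum_distrib_left)
  then have "(\<Sum>h<m. (int h + ?K) div int m) = ?K" using m by simp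
  then show ?thesis unfolding floor_frac_shift(1)[OF m] .
qed

text \<open>The fractional parts are (frac (m q) + k)/m with k permuting the indices, so the product
  is that of the multiplication formula for y = b/(p - 1).\<close>

lemma prod_padic_Gamma_rat:
  fixes q :: rat and m b :: nat
  assumes odd_p: "odd CARD('p::prime_card)" and m: "\<not> CARD('p) dvd m"
    and b: "b < CARD('p)" "frac (of_nat m * q) = of_nat b / (of_nat CARD('p) - 1)"
  shows "(\<Prod>h<m. padic_Gamma_rat (frac (of_nat h / of_nat m + q))) =
    teich (of_nat m) ^ b * to_fract (padic_Gamma (of_nat b * inv_p_minus_1)) *
    (\<Prod>h<m. padic_Gamma_rat (of_nat h / of_nat m) :: 'p padic)"
proof -
  have m0: "m > 0" using m by (cases m) auto
  obtain w :: "'p padic_int" where w: "of_nat m * w = 1" using padic_unit_of_nat_inverse[OF m] by blast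
  let ?g = "\<lambda>k. padic_Gamma_rat ((of_nat b / (of_nat CARD('p) - 1) + of_nat k) / of_nat m) :: 'p padic"
  have "(\<Prod>h<m. padic_Gamma_rat (frac (of_nat h / of_nat m + q)) :: 'p padic) =
      (\<Prod>h<m. ?g (nat ((int h + \<lfloor>of_nat m * q\<rfloor>) mod int m)))"
  proof (rule prod.cong[OF refl])
    fix h
    have "(of_nat (nat ((int h + \<lfloor>of_nat m * q\<rfloor>) mod int m)) :: rat) = of_int ((int h + \<lfloor>of_nat m * q\<rfloor>) mod int m)"
      using m0 by simp
    then show "padic_Gamma_rat (frac (of_nat h / of_nat m + q)) = ?g (nat ((int h + \<lfloor>of_nat m * q\<rfloor>) mod int m))"
      unfolding floor_frac_shift(2)[OF m0] b(2) by (simp only:)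
  qed
  also have "\<dots> = (\<Prod>k<m. ?g k)"
    by (rule prod.reindex_bij_betw[OF bij_betw_shift_mod[OF m0]])
  also have "\<dots> = to_fract (\<Prod>k<m. padic_Gamma ((of_nat b * inv_p_minus_1 + of_nat k) * w))"
    unfolding padic_Gamma_rat_shift[OF w] by (induction m) simp_all
  also have "\<dots> = to_fract (teichmuller (of_nat m) ^ b * padic_Gamma (of_nat b * inv_p_minus_1) * (\<Prod>h<m. padic_Gamma (of_nat h * w)))"
    unfolding prod_padic_Gamma[OF odd_p w m gauss_number_arg b(1)] ..
  also have "\<dots> = teich (of_nat m) ^ b * to_fract (padic_Gamma (of_nat b * inv_p_minus_1)) * to_fract (\<Prod>h<m. padic_Gamma (of_nat h * w))"
    by (simp add: teich_def to_fract_power)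
  also have "to_fract (\<Prod>h<m. padic_Gamma (of_nat h * w)) = (\<Prod>h<m. to_fract (padic_Gamma (of_nat h * w)))"
    by (induction m) simp_all
  also have "\<dots> = (\<Prod>h<m. padic_Gamma_rat (of_nat h / of_nat m))"
    using padic_Gamma_rat_shift[OF w, of 0] by simp
  finally show ?thesis .
qed

text \<open>The second form unfolds the definition, as 1 - b/(p - 1) = (p - 1 - b)/(p - 1); the
  first one is reflection.\<close>

lemma gamma_number_eq_Gamma:
  assumes odd_p: "odd CARD('p::prime_card)" and b: "b < CARD('p) - 1"
  shows "to_fract (padic_Gamma (of_nat b * inv_p_minus_1)) = (gamma_number b :: 'p padic)"
    and "0 < b \<Longrightarrow> to_fract (padic_Gamma (of_nat (CARD('p) - 1 - b) * inv_p_minus_1)) = (- 1) ^ (b + 1) / (gamma_number b :: 'p padic)"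
proof -
  let ?s = "CARD('p) - 1"
  define Gm where "Gm = (\<lambda>b. to_fract (padic_Gamma (of_nat b * inv_p_minus_1)) :: 'p padic)"
  have g: "gamma_number a = (- 1) ^ (a + 1) / Gm (?s - a)" if "a \<le> ?s" for a
  proof -
    have "of_nat (?s - a) * inv_p_minus_1 = (of_nat CARD('p) - 1) * inv_p_minus_1 - of_nat a * (inv_p_minus_1 :: 'p padic_int)"
      using that p_gt_1[where 'p='p] by (simp add: of_nat_diff algebra_simps)
    then show ?thesis unfolding gamma_number_def gauss_Gamma_def Gm_def by (simp only: inv_p_minus_1)
  qed
  have Gm0: "Gm a \<noteq> 0" for a
    using padic_Gamma_unit[OF odd_p, of "of_nat a * inv_p_minus_1"] by (auto simp: Gm_def)
  have 2: "Gm (?s - a) = (- 1) ^ (a + 1) / gamma_number a" if "a \<le> ?s" for a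
  proof -
    have aux: "x = e / y" if "y = e / x" "x \<noteq> 0" "y \<noteq> 0" for x y e :: "'p padic"
      using that by (simp add: nonzero_eq_divide_eq mult.commute)
    show ?thesis by (rule aux[OF g[OF that] Gm0 gamma_number_nonzero[OF odd_p]])
  qed
  show "0 < b \<Longrightarrow> to_fract (padic_Gamma (of_nat (?s - b) * inv_p_minus_1)) = (- 1) ^ (b + 1) / (gamma_number b :: 'p padic)"
    using 2[of b] b by (simp add: Gm_def)
  show "to_fract (padic_Gamma (of_nat b * inv_p_minus_1)) = (gamma_number b :: 'p padic)"
  proof (cases "b = 0")
    case True
    then show ?thesis using padic_Gamma_of_nat[OF odd_p, of 0] gamma_number_0[OF odd_p] by simp
  next
    case False
    let ?a = "?s - b"
    have ab: "0 < ?a" "0 < b" "?a + b = ?s" "?s - ?a = b" using b False by auto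
    have "Gm b = (- 1) ^ (?a + 1) / gamma_number ?a" using 2[of ?a] ab(4) by simp
    moreover have "gamma_number ?a * gamma_number b = ((- 1) ^ (?a + 1) :: 'p padic)"
      using gamma_number_reflection[OF odd_p ab(1,2,3)] by simp
    ultimately have "Gm b = gamma_number ?a * gamma_number b / gamma_number ?a" by (simp only:)
    then have "Gm b = gamma_number b" using gamma_number_nonzero[OF odd_p, of ?a] by simp
    then show ?thesis by (simp add: Gm_def)
  qed
qed

section \<open>Counting points\<close>

text \<open>A point with x2 = 0 would have x1^d = 0; so all points are [x : 1] for a unique
  x.\<close>

lemma card_Z_points:
  fixes l :: "'k::{field, finite}"
  assumes d: "d \<ge> 2"
  shows "card (Z_points d l) = card {x. x ^ d + 1 = of_nat d * l * x}"
proof -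
  let ?eq = "\<lambda>x1 x2. x1 ^ d + x2 ^ d = of_nat d * l * x1 * x2 ^ (d - 1)"
  define line where "line = (\<lambda>x :: 'k. {(c * x, c) | c. c \<noteq> 0})"
  define R where "R = {((x1, x2), (y1, y2)). (x1, x2) \<noteq> (0 :: 'k, 0) \<and> (\<exists>c. c \<noteq> 0 \<and> y1 = c * x1 \<and> y2 = c * x2)}"
  have R: "R `` {(x1, x2)} = {(c * x1, c * x2) | c. c \<noteq> 0}" if "(x1, x2) \<noteq> (0, 0)" for x1 x2
    using that by (auto simp: R_def)
  have proj: "proj_line = {R `` {(x1, x2)} | x1 x2. (x1, x2) \<noteq> (0, 0)}"
  proof -
    have "proj_line = (UNIV - {(0 :: 'k, 0)}) // R" unfolding proj_line_def R_def ..
    also have "\<dots> = {R `` {v} | v. v \<noteq> (0, 0)}" unfolding quotient_def by blast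
    finally show ?thesis by simp
  qed
  have line: "line x = R `` {(x, 1)}" for x
    using R[of x 1] by (simp add: line_def)
  have "bij_betw line {x. x ^ d + 1 = of_nat d * l * x} (Z_points d l)"
  proof (rule bij_betwI')
    fix x y
    show "line x = line y \<longleftrightarrow> x = y"
    proof
      assume "line x = line y"
      moreover have "(x, 1) \<in> line x" unfolding line_def by (intro CollectI exI[of _ 1]) simp
      ultimately have "(x, 1) \<in> line y" by (simp only:)
      then show "x = y" by (auto simp: line_def)
    qed simp
  next
    fix x assume x: "x \<in> {x. x ^ d + 1 = of_nat d * l * x}"
    have "line x \<in> proj_line" unfolding proj line by (intro CollectI exI[of _ x] exI[of _ 1]) simp
    moreover have "?eq (c * x) c" for c
    proof -
      have "c ^ d = c * c ^ (d - 1)" using d by (cases d) auto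
      have "(c * x) ^ d + c ^ d = c ^ d * (x ^ d + 1)" by (simp add: power_mult_distrib algebra_simps)
      also have "\<dots> = c ^ d * (of_nat d * l * x)" using x by simp
      also have "\<dots> = of_nat d * l * (c * x) * c ^ (d - 1)" unfolding \<open>c ^ d = c * c ^ (d - 1)\<close> by (simp add: mult_ac)
      finally show ?thesis .
    qed
    ultimately show "line x \<in> Z_points d l" by (auto simp: Z_points_def line_def)
  next
    fix P assume "P \<in> Z_points d l"
    then obtain x1 x2 where P: "P = R `` {(x1, x2)}" "(x1, x2) \<noteq> (0, 0)" and all: "\<forall>(y1, y2)\<in>P. ?eq y1 y2"
      by (auto simp: Z_points_def proj)
    have Pe: "P = {(c * x1, c * x2) | c. c \<noteq> 0}" using P R by simp
    have "(1 * x1, 1 * x2) \<in> P" unfolding Pe by (intro CollectI exI[of _ 1]) simp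
    then have e: "?eq x1 x2" using all by auto
    have x2: "x2 \<noteq> 0"
    proof
      assume "x2 = 0"
      then have "x1 ^ d = 0" using e d by (simp add: power_0_left)
      then show False using P(2) \<open>x2 = 0\<close> by simp
    qed
    have "((1 / x2) * x1, (1 / x2) * x2) \<in> P" unfolding Pe using x2 by (intro CollectI exI[of _ "1 / x2"]) simp
    then have "?eq (x1 / x2) 1" using all x2 by auto
    moreover have "P = line (x1 / x2)"
      unfolding Pe line_def
    proof (intro Collect_cong iffI; elim exE conjE)
      fix v c assume "v = (c * x1, c * x2)" "c \<noteq> (0 :: 'k)"
      then show "\<exists>c'. v = (c' * (x1 / x2), c') \<and> c' \<noteq> 0"
        using x2 by (intro exI[of _ "c * x2"]) simp
    next
      fix v c assume "v = (c * (x1 / x2), c)" "c \<noteq> (0 :: 'k)"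
      then show "\<exists>c'. v = (c' * x1, c' * x2) \<and> c' \<noteq> 0"
        using x2 by (intro exI[of _ "c / x2"]) simp
    qed
    ultimately show "\<exists>x\<in>{x. x ^ d + 1 = of_nat d * l * x}. P = line x"
      by (intro bexI[of _ "x1 / x2"]) simp_all
  qed
  then show ?thesis by (simp add: bij_betw_same_card)
qed

text \<open>The substitution \<open>y = x^d\<close> makes both sides of the equation multiplicative in \<open>\<lambda>\<close>.\<close>

lemma card_trinomial_roots:
  fixes k :: "'k::{field, finite}"
  assumes d: "d > 0" and k: "k \<noteq> 0"
  shows "card {x. x ^ d + 1 = k * x} = card {y \<in> UNIV - {0, - 1}. (1 + y) ^ d = k ^ d * y}"
proof (rule bij_betw_same_card[of "\<lambda>x. x ^ d"], rule bij_betwI[where g = "\<lambda>y. (1 + y) / k"])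
  show "(\<lambda>x. x ^ d) \<in> {x. x ^ d + 1 = k * x} \<rightarrow> {y \<in> UNIV - {0, - 1}. (1 + y) ^ d = k ^ d * y}"
  proof
    fix x assume "x \<in> {x. x ^ d + 1 = k * x}"
    then have x: "1 + x ^ d = k * x" by (simp add: add.commute)
    then have "x \<noteq> 0" using d by (auto simp: power_0_left)
    then have "1 + x ^ d \<noteq> 0" using x k by simp
    then have "x ^ d \<noteq> - 1" by auto
    then show "x ^ d \<in> {y \<in> UNIV - {0, - 1}. (1 + y) ^ d = k ^ d * y}"
      using x \<open>x \<noteq> 0\<close> by (simp add: power_mult_distrib)
  qed
  show "(\<lambda>y. (1 + y) / k) \<in> {y \<in> UNIV - {0, - 1}. (1 + y) ^ d = k ^ d * y} \<rightarrow> {x. x ^ d + 1 = k * x}"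
    using k by (auto simp: power_divide)
  show "(1 + x ^ d) / k = x" if "x \<in> {x. x ^ d + 1 = k * x}" for x
    using that k by (simp add: add.commute)
  show "((1 + y) / k) ^ d = y" if "y \<in> {y \<in> UNIV - {0, - 1}. (1 + y) ^ d = k ^ d * y}" for y
    using that k by (simp add: power_divide)
qed

lemma sum_teich_orthogonality:
  assumes z: "z \<noteq> (0 :: 'p::prime_card mod_ring)"
  shows "(\<Sum>j<CARD('p) - 1. teich z ^ j) = (if z = 1 then of_nat (CARD('p) - 1) else 0)"
proof (cases "z = 1")
  case False
  then have "teich z - 1 \<noteq> 0" using teich_eq_1_iff[OF z] by simp
  moreover have "(teich z - 1) * (\<Sum>j<CARD('p) - 1. teich z ^ j) = 0"
    using power_diff_1_eq[of "teich z" "CARD('p) - 1"] teich_power_card[OF z] by simp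
  ultimately show ?thesis using False by simp
qed simp

lemma teich_power_cong:
  assumes x: "x \<noteq> (0 :: 'p::prime_card mod_ring)" and "[i = j] (mod (CARD('p) - 1))"
  shows "teich x ^ i = teich x ^ j"
proof -
  have red: "teich x ^ n = teich x ^ (n mod (CARD('p) - 1))" for n
  proof -
    have "teich x ^ n = (teich x ^ (CARD('p) - 1)) ^ (n div (CARD('p) - 1)) * teich x ^ (n mod (CARD('p) - 1))"
      by (simp flip: power_mult power_add)
    then show ?thesis using teich_power_card[OF x] by simp
  qed
  show ?thesis using red[of i] red[of j] assms(2) by (simp add: cong_def)
qed

text \<open>Put t = -y: the sign comes from \<omega>(-1) = -1, and d j is -b modulo p - 1.\<close>

lemma sum_jacobi:
  assumes odd_p: "odd CARD('p::prime_card)" and j: "0 < j" "j < CARD('p) - 1"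
    and b: "b < CARD('p) - 1" "[b + d * j = 0] (mod (CARD('p) - 1))"
  shows "(\<Sum>y\<in>UNIV - {0, - 1 :: 'p mod_ring}. inverse (teich y) ^ j * teich (1 + y) ^ (d * j)) = (- 1) ^ j * jacobi_sum j b"
proof -
  have neg: "- y = 1 \<longleftrightarrow> y = - 1" for y :: "'p mod_ring"
  proof
    assume "- y = 1"
    then have "- (- y) = - 1" by (simp only:)
    then show "y = - 1" by (simp only: minus_minus)
  qed simp
  let ?s = "CARD('p) - 1"
  have "(\<Sum>y\<in>UNIV - {0, - 1 :: 'p mod_ring}. inverse (teich y) ^ j * teich (1 + y) ^ (d * j)) =
      (\<Sum>t\<in>UNIV - {0, 1}. (- 1) ^ j * (teich t ^ (?s - j) * teich (1 - t) ^ (?s - b)))"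
  proof (rule sum.reindex_bij_witness[where i = uminus and j = uminus])
    fix y :: "'p mod_ring" assume y: "y \<in> UNIV - {0, - 1}"
    then have nz: "y \<noteq> 0" "- y \<noteq> 0" "1 + y \<noteq> 0" by (auto simp: add_eq_0_iff)
    have "teich (- y) = - teich y" using teich_mult[of "- 1" y] teich_minus_1[OF odd_p] nz by simp
    moreover have "teich (- y) ^ (?s - j) * teich (- y) ^ j = 1"
      using teich_power_card[OF nz(2)] j by (simp flip: power_add)
    ultimately have "teich (- y) ^ (?s - j) * (- teich y) ^ j = 1" by simp
    then have "teich (- y) ^ (?s - j) * ((- 1) ^ j * teich y ^ j) = 1" by (simp only: power_minus[of "teich y"])
    then have "((- 1) ^ j * teich (- y) ^ (?s - j)) * teich y ^ j = 1" by (simp only: mult_ac)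
    then have "inverse (teich y) ^ j = (- 1) ^ j * teich (- y) ^ (?s - j)"
      unfolding power_inverse by (intro inverse_unique) (simp only: mult.commute)
    moreover have "teich (1 + y) ^ (d * j) = teich (1 + y) ^ (?s - b)"
    proof (rule teich_power_cong[OF nz(3)])
      have "[b + d * j = b + (?s - b)] (mod ?s)" using b by (simp add: cong_def)
      then show "[d * j = ?s - b] (mod ?s)" by (simp only: cong_add_lcancel_nat)
    qed
    ultimately show "(- 1) ^ j * (teich (- y) ^ (?s - j) * teich (1 - - y) ^ (?s - b)) = inverse (teich y) ^ j * teich (1 + y) ^ (d * j)"
      by simp
    show "- y \<in> UNIV - {0, 1}" using nz(2) y neg[of y] by simp
  next
    fix y :: "'p mod_ring" assume "y \<in> UNIV - {0, 1}"
    then show "- y \<in> UNIV - {0, - 1}" by simp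
  qed simp_all
  then show ?thesis by (simp add: jacobi_sum_def sum_distrib_left)
qed

text \<open>With k = d l, the roots are the y with (1 + y)^d/(k^d y) = 1, and the value 1 is
  detected by summing the powers of the Teichmueller character.\<close>

lemma card_Z_points_fourier:
  fixes l :: "'p::prime_card mod_ring"
  assumes d: "d \<ge> 2" and dl: "of_nat d * l \<noteq> 0"
  shows "of_nat (CARD('p) - 1) * of_nat (card (Z_points d l)) =
    (\<Sum>j<CARD('p) - 1. inverse (teich (of_nat d * l)) ^ (d * j) *
      (\<Sum>y\<in>UNIV - {0, - 1}. inverse (teich y) ^ j * teich (1 + y) ^ (d * j)))"
proof -
  let ?s = "CARD('p) - 1"
  let ?k = "of_nat d * l"
  let ?D = "UNIV - {0, - 1 :: 'p mod_ring}"
  define z where "z = (\<lambda>y. inverse (?k ^ d) * (inverse y * (1 + y) ^ d))"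
  have zy: "teich (z y) = inverse (teich ?k) ^ d * (inverse (teich y) * teich (1 + y) ^ d)" "z y \<noteq> 0"
      "z y = 1 \<longleftrightarrow> (1 + y) ^ d = ?k ^ d * y" if "y \<in> ?D" for y
  proof -
    have nz: "y \<noteq> 0" "1 + y \<noteq> 0" using that by (auto simp: add_eq_0_iff)
    show "z y \<noteq> 0" using nz dl by (simp add: z_def)
    show "teich (z y) = inverse (teich ?k) ^ d * (inverse (teich y) * teich (1 + y) ^ d)"
      unfolding z_def using nz dl by (simp only: teich_mult teich_inverse teich_power power_not_zero
          inverse_nonzero_iff_nonzero mult_eq_0_iff simp_thms power_inverse)
    show "z y = 1 \<longleftrightarrow> (1 + y) ^ d = ?k ^ d * y" unfolding z_def using nz dl by (simp add: field_simps)
  qed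
  have "of_nat ?s * (of_nat (card (Z_points d l)) :: 'p padic) = of_nat ?s * of_nat (card {y \<in> ?D. (1 + y) ^ d = ?k ^ d * y})"
    using card_Z_points[OF d, of l] card_trinomial_roots[OF _ dl, of d] d by simp
  also have "\<dots> = (\<Sum>y\<in>?D. if (1 + y) ^ d = ?k ^ d * y then of_nat ?s else 0)"
    by (simp add: sum.If_cases Int_def mult.commute)
  also have "\<dots> = (\<Sum>y\<in>?D. \<Sum>j<?s. teich (z y) ^ j)"
  proof (rule sum.cong[OF refl])
    fix y assume y: "y \<in> ?D"
    show "(if (1 + y) ^ d = ?k ^ d * y then of_nat ?s else 0) = (\<Sum>j<?s. teich (z y) ^ j)"
      using sum_teich_orthogonality[OF zy(2)[OF y]] zy(3)[OF y] by simp
  qed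
  also have "\<dots> = (\<Sum>j<?s. \<Sum>y\<in>?D. teich (z y) ^ j)" by (rule sum.swap)
  also have "\<dots> = (\<Sum>j<?s. inverse (teich ?k) ^ (d * j) * (\<Sum>y\<in>?D. inverse (teich y) ^ j * teich (1 + y) ^ (d * j)))"
    unfolding sum_distrib_left
    by (intro sum.cong refl) (simp only: zy power_mult_distrib power_mult)
  finally show ?thesis .
qed

section \<open>The summands of the hypergeometric series\<close>

lemma frac_floor_eqI:
  assumes "x = of_int n + f" "0 \<le> f" "f < (1 :: 'a::floor_ceiling)"
  shows "\<lfloor>x\<rfloor> = n" "frac x = f"
proof -
  show "\<lfloor>x\<rfloor> = n" using assms by (intro floor_unique) simp_all
  then show "frac x = f" using assms(1) by (simp add: frac_def)
qed

lemma prod_powi_sum: "x \<noteq> 0 \<Longrightarrow> (\<Prod>i\<in>A. x powi f i) = x powi (\<Sum>i\<in>A. f i)" for x :: "'a::field"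
  by (induction A rule: infinite_finite_induct) (simp_all add: power_int_add)

lemma neg_one_power_eqI: "even (m + n) \<Longrightarrow> (- 1) ^ m = ((- 1) ^ n :: 'a::ring_1)"
  by (auto simp: minus_one_power_iff)

text \<open>The sum j + b + c is positive, below 3 (p - 1) and a multiple of p - 1; so e is 0 or 1.
  This selects the Jacobi sum formula without or with the factor p, and reflection removes the third
  gamma value.\<close>

lemma gamma_number_jacobi:
  assumes odd_p: "odd CARD('p::prime_card)" and j: "0 < j" "j < CARD('p) - 1" and b: "b < CARD('p) - 1" and c: "c < CARD('p) - 1"
    and e: "(int CARD('p) - 1) * e = int j + int b + int c - (int CARD('p) - 1)"
  shows "(- of_nat CARD('p)) powi e * (gamma_number j * gamma_number b) * gamma_number c = (- 1) ^ c * (jacobi_sum j b :: 'p padic)"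
proof -
  let ?s = "CARD('p) - 1"
  have s: "int CARD('p) - 1 = int ?s" "?s > 0" using p_gt_1[where 'p='p] by auto
  have e': "int ?s * (e + 1) = int (j + b + c)" using e unfolding s(1) by (simp add: algebra_simps)
  have "0 < int ?s * (e + 1)" unfolding e' using j by simp
  then have e0: "0 < e + 1" using s(2) by (simp add: zero_less_mult_iff)
  have "int ?s * (e + 1) < int ?s * 3" unfolding e' using j b c by simp
  then have "e + 1 < 3" using s(2) by (simp only: mult_less_cancel_left_pos of_nat_0_less_iff)
  then consider "e = 0" | "e = 1" using e0 by linarith
  then show ?thesis
  proof cases
    case 1
    then have jbc: "j + b + c = ?s" using e' by simp
    show ?thesis
    proof (cases "c = 0")
      case True
      then have jb: "j + b = ?s" "0 < b" using jbc j by auto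
      show ?thesis
        using True 1 gamma_number_reflection[OF odd_p j(1) jb(2,1)] jacobi_sum_opposite[OF odd_p j(1) jb(2,1)]
        by (simp add: gamma_number_0[OF odd_p])
    next
      case False
      have sum: "j + b < ?s" "0 < j + b" "j + b + c = ?s" using False jbc j by auto
      have refl: "gamma_number (j + b) * gamma_number c = (- ((- 1) ^ (j + b)) :: 'p padic)"
        using sum False by (intro gamma_number_reflection[OF odd_p]) auto
      have "even ?s" using odd_p by simp
      then have par: "(- 1) ^ (j + b) = ((- 1) ^ c :: 'p padic)"
        using sum(3) by (intro neg_one_power_eqI) simp
      have "(gamma_number j * gamma_number b) * gamma_number c = - jacobi_sum j b * (gamma_number (j + b) * gamma_number c :: 'p padic)"
        unfolding jacobi_sum_small[OF odd_p sum(2,1)] by (simp only: mult_ac)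
      then show ?thesis using 1 unfolding refl par by simp
    qed
  next
    case 2
    then have jbc: "j + b + c = 2 * ?s" using e' by simp
    let ?c = "j + b - ?s"
    have sum: "j + b > ?s" "0 < ?c" "0 < c" "?c + c = ?s" using jbc j b c by auto
    have refl: "gamma_number ?c * gamma_number c = (- ((- 1) ^ ?c) :: 'p padic)"
      using sum by (intro gamma_number_reflection[OF odd_p]) auto
    have "even ?s" using odd_p by simp
    then have par: "(- 1) ^ ?c = ((- 1) ^ c :: 'p padic)"
      using sum(4) by (intro neg_one_power_eqI) simp
    have "(- of_nat CARD('p)) powi e * (gamma_number j * gamma_number b) * gamma_number c =
        - ((of_nat CARD('p) * (gamma_number j * gamma_number b)) * gamma_number c :: 'p padic)"
      using 2 by (simp add: mult.assoc)
    also have "\<dots> = - (jacobi_sum j b * (gamma_number ?c * gamma_number c))"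
      unfolding jacobi_sum_large[OF odd_p j(2) b sum(1)] by (simp only: mult.assoc)
    finally show ?thesis unfolding refl par by simp
  qed
qed

lemma frac_frac_add: "frac (frac x + y) = frac (x + y)" for x :: "'a::floor_ceiling"
proof -
  have eq: "x + y = (frac x + y) + of_int \<lfloor>x\<rfloor>" by (simp add: frac_def)
  have "frac (z + of_int n) = frac z" for z :: 'a and n by (simp add: frac_def)
  then show ?thesis unfolding eq by simp
qed

lemma frac_of_nat_div: "h < m \<Longrightarrow> frac (of_nat h / of_nat m) = (of_nat h / of_nat m :: 'a::floor_ceiling)"
  by (intro frac_eq_id) (simp add: field_simps)

lemma prod_lessThan_head: "0 < d \<Longrightarrow> (\<Prod>h<d. f h) = f 0 * (\<Prod>i=1..d - 1. f i)" for f :: "nat \<Rightarrow> 'a::comm_monoid_mult"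
  by (cases d) (simp_all add: prod.lessThan_Suc_shift prod.atLeast1_atMost_eq del: prod.lessThan_Suc)

lemma sum_lessThan_head: "0 < d \<Longrightarrow> (\<Sum>h<d. f h) = f 0 + (\<Sum>i=1..d - 1. f i)" for f :: "nat \<Rightarrow> 'a::comm_monoid_add"
  by (cases d) (simp_all add: sum.lessThan_Suc_shift sum.atLeast1_atMost_eq del: sum.lessThan_Suc)

text \<open>The numerator of the fractional part of -(i - 1)/m; i = 1 is special since there the
  fractional part is 0 and not 1.\<close>

definition neg_index :: "nat \<Rightarrow> nat \<Rightarrow> nat" where
  "neg_index m i = (if i = 1 then 0 else m + 1 - i)"

lemma bij_neg_index: "bij_betw (neg_index m) {1..m} {..<m}"
  by (rule bij_betw_byWitness[where f' = "\<lambda>h. if h = 0 then 1 else m + 1 - h"]) (auto simp: neg_index_def)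

lemma frac_neg_index:
  assumes "i \<in> {1..m}"
  shows "frac (- (of_nat (i - 1) / of_nat m)) = (of_nat (neg_index m i) / of_nat m :: 'a::floor_ceiling)"
proof (cases "i = 1")
  case False
  have m: "(of_nat m :: 'a) > 0" using assms by simp
  have "of_nat (m + 1 - i) + of_nat (i - 1) = (of_nat m :: 'a)"
    using assms by (simp flip: of_nat_add)
  then have eq: "- (of_nat (i - 1) / of_nat m) = of_int (- 1) + (of_nat (m + 1 - i) / of_nat m :: 'a)"
    using m by (simp add: field_simps del: of_nat_diff of_nat_Suc of_nat_add)
  have "of_nat (m + 1 - i) < (of_nat m :: 'a)" using assms False by (simp only: of_nat_less_iff) auto
  then have lt: "of_nat (m + 1 - i) / of_nat m < (1 :: 'a)" using m by simp
  show ?thesis unfolding neg_index_def if_not_P[OF False] by (rule frac_floor_eqI(2)[OF eq _ lt]) simp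
qed (simp add: neg_index_def)

lemma padic_Gamma_rat_nonzero:
  assumes "odd CARD('p::prime_card)"
  shows "padic_Gamma_rat q \<noteq> (0 :: 'p padic)"
proof -
  have "padic_Gamma (padic_int_of_rat q) dvd (1 :: 'p padic_int)" by (rule padic_Gamma_unit[OF assms])
  then have "padic_Gamma (padic_int_of_rat q) \<noteq> (0 :: 'p padic_int)" by auto
  then show ?thesis by (simp add: padic_Gamma_rat_def)
qed

lemma padic_Gamma_rat_card_minus_1:
  "padic_Gamma_rat (of_nat b / (of_nat CARD('p) - 1)) = (to_fract (padic_Gamma (of_nat b * inv_p_minus_1)) :: 'p::prime_card padic)"
  using padic_Gamma_rat_shift[of 1 "1 :: 'p padic_int" b 0] by simp

lemma of_nat_card_minus_1: "of_nat CARD('p::prime_card) - 1 = (of_nat (CARD('p) - 1) :: 'a::ring_1)"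
  using p_gt_1[where 'p='p] by (simp add: of_nat_diff)

text \<open>Writing -d j/s as d (s - j)/s - d leads back to division of natural numbers.\<close>

lemma floor_frac_mult_neg:
  assumes s: "s > 0" and j: "j < s"
  shows "\<lfloor>of_nat d * - (of_nat j / of_nat s) :: 'a\<rfloor> = int (d * (s - j) div s) - int d" (is ?floor)
    and "frac (of_nat d * - (of_nat j / of_nat s)) = (of_nat (d * (s - j) mod s) / of_nat s :: 'a::floor_ceiling)" (is ?frac)
proof -
  let ?n = "d * (s - j)"
  have "(of_nat ?n :: 'a) = of_nat s * of_nat (?n div s) + of_nat (?n mod s)"
    by (simp only: of_nat_mult[symmetric] of_nat_add[symmetric] mult_div_mod_eq)
  moreover have "(of_nat ?n :: 'a) = of_nat d * (of_nat s - of_nat j)" using j by (simp add: of_nat_diff)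
  ultimately have "of_nat d * (of_nat s - of_nat j) = of_nat s * of_nat (?n div s) + (of_nat (?n mod s) :: 'a)" by (simp only:)
  then have eq: "of_nat d * - (of_nat j / of_nat s) = of_int (int (?n div s) - int d) + (of_nat (?n mod s) / of_nat s :: 'a)"
    using s by (simp add: field_simps del: of_nat_mult)
  have "(of_nat (?n mod s) :: 'a) < of_nat s" using s by (simp only: of_nat_less_iff mod_less_divisor)
  then have lt: "of_nat (?n mod s) / of_nat s < (1 :: 'a)" using s by simp
  show ?floor by (rule frac_floor_eqI(1)[OF eq _ lt]) simp
  show ?frac by (rule frac_floor_eqI(2)[OF eq _ lt]) simp
qed

lemma floor_frac_mult:
  assumes s: "s > 0"
  shows "\<lfloor>of_nat m * (of_nat j / of_nat s) :: 'a\<rfloor> = int (m * j div s)" (is ?floor)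
    and "frac (of_nat m * (of_nat j / of_nat s)) = (of_nat (m * j mod s) / of_nat s :: 'a::floor_ceiling)" (is ?frac)
proof -
  let ?n = "m * j"
  have "(of_nat ?n :: 'a) = of_nat s * of_nat (?n div s) + of_nat (?n mod s)"
    by (simp only: of_nat_mult[symmetric] of_nat_add[symmetric] mult_div_mod_eq)
  then have eq: "of_nat m * (of_nat j / of_nat s) = of_int (int (?n div s)) + (of_nat (?n mod s) / of_nat s :: 'a)"
    using s by (simp add: field_simps)
  have "(of_nat (?n mod s) :: 'a) < of_nat s" using s by (simp only: of_nat_less_iff mod_less_divisor)
  then have lt: "of_nat (?n mod s) / of_nat s < (1 :: 'a)" using s by simp
  show ?floor by (rule frac_floor_eqI(1)[OF eq _ lt]) simp
  show ?frac by (rule frac_floor_eqI(2)[OF eq _ lt]) simp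
qed

text \<open>The multiplication formula has all h/d with h < d, but the parameters start at 1/d. The
  missing factor at h = 0 is the value at 1 - j/(p - 1); dividing by it brings in
  \<open>gamma_number j\<close>.\<close>

lemma prod_Gamma_numerator:
  assumes odd_p: "odd CARD('p::prime_card)" and d: "0 < d" "\<not> CARD('p) dvd d" and j: "0 < j" "j < CARD('p) - 1"
    and b: "b = d * (CARD('p) - 1 - j) mod (CARD('p) - 1)"
  shows "(\<Prod>i=1..d - 1. padic_Gamma_rat (frac (of_nat i / of_nat d - of_nat j / (of_nat CARD('p) - 1))) /
      padic_Gamma_rat (frac (of_nat i / of_nat d))) =
    teich (of_nat d) ^ b * gamma_number b * ((- 1) ^ (j + 1) * (gamma_number j :: 'p padic))"
proof -
  let ?s = "CARD('p) - 1"
  let ?r = "of_nat j / (of_nat CARD('p) - 1) :: rat"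
  let ?F = "\<lambda>i. padic_Gamma_rat (frac (of_nat i / of_nat d + - ?r)) :: 'p padic"
  let ?H = "\<lambda>i. padic_Gamma_rat (of_nat i / of_nat d) :: 'p padic"
  let ?X = "\<Prod>i=1..d - 1. ?F i"
  let ?Y = "\<Prod>i=1..d - 1. ?H i"
  have s: "0 < ?s" and b': "b < ?s" "b < CARD('p)" using j b by (auto intro: less_le_trans[OF mod_less_divisor])
  have fr: "frac (of_nat d * - ?r) = of_nat b / (of_nat CARD('p) - 1)"
    unfolding of_nat_card_minus_1[where 'p='p] b by (rule floor_frac_mult_neg[OF s j(2)])
  have "frac (- ?r) = of_nat (?s - j) / (of_nat CARD('p) - 1)"
    using floor_frac_mult_neg(2)[OF s j(2), of 1, where 'a=rat] j unfolding of_nat_card_minus_1[where 'p='p] by simp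
  then have F0: "?F 0 = (- 1) ^ (j + 1) / gamma_number j"
    using gamma_number_eq_Gamma(2)[OF odd_p j(2,1)] by (simp add: padic_Gamma_rat_card_minus_1)
  have H0: "?H 0 = 1"
    using padic_Gamma_rat_card_minus_1[of 0, where 'p='p] gamma_number_eq_Gamma(1)[OF odd_p s] gamma_number_0[OF odd_p] by simp
  have "?F 0 * ?X = teich (of_nat d) ^ b * gamma_number b * (?H 0 * ?Y)"
    using prod_padic_Gamma_rat[OF odd_p d(2) b'(2) fr] gamma_number_eq_Gamma(1)[OF odd_p b'(1)]
    by (simp only: prod_lessThan_head[OF d(1)])
  then have "(- 1) ^ (j + 1) * ?X = teich (of_nat d) ^ b * gamma_number b * gamma_number j * ?Y"
    unfolding F0 H0 using gamma_number_nonzero[OF odd_p, of j] by (simp add: field_simps)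
  then have "((- 1) ^ (j + 1) * (- 1) ^ (j + 1)) * ?X = teich (of_nat d) ^ b * gamma_number b * ((- 1) ^ (j + 1) * gamma_number j) * ?Y"
    by (simp only: mult_ac)
  then have "?X = teich (of_nat d) ^ b * gamma_number b * ((- 1) ^ (j + 1) * gamma_number j) * ?Y"
    by (simp only: power_mult_distrib[symmetric]) simp
  moreover have "?Y \<noteq> 0" using padic_Gamma_rat_nonzero[OF odd_p] by (simp add: prod_zero_iff)
  ultimately have "?X / ?Y = teich (of_nat d) ^ b * gamma_number b * ((- 1) ^ (j + 1) * gamma_number j)" by simp
  moreover have "?Y = (\<Prod>i=1..d - 1. padic_Gamma_rat (frac (of_nat i / of_nat d)))"
    using d by (intro prod.cong refl) (subst frac_of_nat_div, auto)
  ultimately show ?thesis by (simp add: prod_dividef)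
qed

text \<open>The negated lower parameters run, modulo 1, through all h/m including 0, so the whole
  product of the multiplication formula occurs.\<close>

lemma prod_Gamma_denominator:
  assumes odd_p: "odd CARD('p::prime_card)" and m: "0 < m" "\<not> CARD('p) dvd m" and j: "j < CARD('p) - 1"
    and c: "c = m * j mod (CARD('p) - 1)"
  shows "(\<Prod>i=1..m. padic_Gamma_rat (frac (- (of_nat (i - 1) / of_nat m) + of_nat j / (of_nat CARD('p) - 1))) /
      padic_Gamma_rat (frac (- (of_nat (i - 1) / of_nat m)))) =
    teich (of_nat m) ^ c * (gamma_number c :: 'p padic)"
proof -
  let ?s = "CARD('p) - 1"
  let ?r = "of_nat j / (of_nat CARD('p) - 1) :: rat"
  have s: "0 < ?s" and c': "c < ?s" "c < CARD('p)" using j c by (auto intro: less_le_trans[OF mod_less_divisor])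
  have fr: "frac (of_nat m * ?r) = of_nat c / (of_nat CARD('p) - 1)"
    unfolding of_nat_card_minus_1[where 'p='p] c by (rule floor_frac_mult[OF s])
  have "(\<Prod>i=1..m. padic_Gamma_rat (frac (- (of_nat (i - 1) / of_nat m) + ?r)) /
      padic_Gamma_rat (frac (- (of_nat (i - 1) / of_nat m)))) =
    (\<Prod>i=1..m. padic_Gamma_rat (frac (of_nat (neg_index m i) / of_nat m + ?r)) / (padic_Gamma_rat (of_nat (neg_index m i) / of_nat m) :: 'p padic))"
    by (rule prod.cong[OF refl]) (simp only: frac_frac_add[of "- (of_nat _ / of_nat _)", symmetric] frac_neg_index)
  also have "\<dots> = (\<Prod>h<m. padic_Gamma_rat (frac (of_nat h / of_nat m + ?r)) / padic_Gamma_rat (of_nat h / of_nat m))"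
    by (rule prod.reindex_bij_betw[OF bij_neg_index])
  also have "\<dots> = (\<Prod>h<m. padic_Gamma_rat (frac (of_nat h / of_nat m + ?r))) / (\<Prod>h<m. padic_Gamma_rat (of_nat h / of_nat m))"
    by (rule prod_dividef)
  also have "\<dots> = teich (of_nat m) ^ c * gamma_number c"
    unfolding prod_padic_Gamma_rat[OF odd_p m(2) c'(2) fr] gamma_number_eq_Gamma(1)[OF odd_p c'(1)]
    by (simp add: prod_zero_iff padic_Gamma_rat_nonzero[OF odd_p])
  finally show ?thesis .
qed

text \<open>Hermite's identity for both families, the first without its term -1 at h = 0. The total
  is the exponent required by \<open>gamma_number_jacobi\<close>.\<close>

lemma sum_floor_exponents:
  assumes d: "d \<ge> 2" and j: "0 < j" "j < s"
  shows "int s * (\<Sum>i=1..d - 1. - \<lfloor>frac (of_nat i / of_nat d) - of_nat j / of_nat s :: rat\<rfloor> -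
      \<lfloor>frac (- (of_nat (i - 1) / of_nat (d - 1))) + of_nat j / of_nat s :: rat\<rfloor>) =
    int j + int (d * (s - j) mod s) + int ((d - 1) * j mod s) - int s"
proof -
  let ?r = "of_nat j / of_nat s :: rat"
  have s: "s > 0" using j by simp
  have dm: "int s * int (n div s) = int n - int (n mod s)" for n
    by (metis add_diff_cancel_right' mult_div_mod_eq of_nat_add of_nat_mult)
  have "(\<Sum>h<d. \<lfloor>of_nat h / of_nat d + - ?r\<rfloor>) = int (d * (s - j) div s) - int d"
    using d sum_floor_shift[of d "- ?r"] floor_frac_mult_neg(1)[OF s j(2), of d, where 'a=rat] by simp
  moreover have "\<lfloor>- ?r\<rfloor> = - 1"
    using floor_frac_mult_neg(1)[OF s j(2), of 1, where 'a=rat] j by simp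
  ultimately have "(\<Sum>i=1..d - 1. \<lfloor>of_nat i / of_nat d + - ?r\<rfloor>) = int (d * (s - j) div s) - int d + 1"
    using d sum_lessThan_head[of d "\<lambda>h. \<lfloor>of_nat h / of_nat d + - ?r\<rfloor>"] by simp
  moreover have "(\<Sum>i=1..d - 1. \<lfloor>frac (of_nat i / of_nat d) - ?r\<rfloor>) = (\<Sum>i=1..d - 1. \<lfloor>of_nat i / of_nat d + - ?r\<rfloor>)"
    using d by (intro sum.cong refl) (subst frac_of_nat_div, auto)
  moreover have "(\<Sum>i=1..d - 1. \<lfloor>frac (- (of_nat (i - 1) / of_nat (d - 1))) + ?r\<rfloor>) = int ((d - 1) * j div s)"
  proof -
    have "(\<Sum>i=1..d - 1. \<lfloor>frac (- (of_nat (i - 1) / of_nat (d - 1))) + ?r\<rfloor>) =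
        (\<Sum>i=1..d - 1. \<lfloor>of_nat (neg_index (d - 1) i) / of_nat (d - 1) + ?r\<rfloor>)"
      by (rule sum.cong[OF refl]) (simp only: frac_neg_index)
    also have "\<dots> = (\<Sum>h<d - 1. \<lfloor>of_nat h / of_nat (d - 1) + ?r\<rfloor>)"
      by (rule sum.reindex_bij_betw[OF bij_neg_index])
    also have "\<dots> = int ((d - 1) * j div s)"
      using d sum_floor_shift[of "d - 1" ?r] floor_frac_mult(1)[OF s, of "d - 1" j, where 'a=rat] by simp
    finally show ?thesis .
  qed
  ultimately have "(\<Sum>i=1..d - 1. - \<lfloor>frac (of_nat i / of_nat d) - ?r\<rfloor> -
      \<lfloor>frac (- (of_nat (i - 1) / of_nat (d - 1))) + ?r\<rfloor>) = int d - 1 - int (d * (s - j) div s) - int ((d - 1) * j div s)"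
    by (simp only: sum_subtractf sum_negf)
  then have "int s * (\<Sum>i=1..d - 1. - \<lfloor>frac (of_nat i / of_nat d) - ?r\<rfloor> -
      \<lfloor>frac (- (of_nat (i - 1) / of_nat (d - 1))) + ?r\<rfloor>) =
      int s * int d - int s - int s * int (d * (s - j) div s) - int s * int ((d - 1) * j div s)"
    by (simp only: right_diff_distrib mult_1_right)
  also have "\<dots> = int s * int d - int s - (int (d * (s - j)) - int (d * (s - j) mod s)) - (int ((d - 1) * j) - int ((d - 1) * j mod s))"
    by (simp only: dm)
  also have "int (d * (s - j)) = int d * (int s - int j)" using j by (simp add: of_nat_diff)
  also have "int ((d - 1) * j) = (int d - 1) * int j" using d by (simp add: of_nat_diff)
  finally show ?thesis by (simp only: algebra_simps)
qed

text \<open>The power of \<omega>(d - 1) cancels against that of the argument, and the sign (-1)^(j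
  (d - 1)) against (-1)^c, since p - 1 is even. Finally \<omega>(d)^b = \<omega>(d)^(-d j) joins the
  power of \<omega>(l).\<close>

lemma mccarthy_summand:
  fixes l :: "'p::prime_card mod_ring"
  assumes odd_p: "odd CARD('p)" and d: "d \<ge> 2" "\<not> CARD('p) dvd d * (d - 1)" and l: "l \<noteq> 0"
    and j: "0 < j" "j < CARD('p) - 1"
    and b: "b = d * (CARD('p) - 1 - j) mod (CARD('p) - 1)"
  defines "r \<equiv> of_nat j / (of_nat CARD('p) - 1) :: rat"
  shows "(- 1) ^ (j * (d - 1)) * teichmuller_inv_power j (l ^ d * of_nat (d - 1) ^ (d - 1)) *
         (\<Prod>i = 1..d - 1.
            (- of_nat CARD('p)) powi (- \<lfloor>frac (of_nat i / of_nat d) - r\<rfloor> - \<lfloor>frac (- (of_nat (i - 1) / of_nat (d - 1))) + r\<rfloor>) *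
            (padic_Gamma_rat (frac (of_nat i / of_nat d - r)) / padic_Gamma_rat (frac (of_nat i / of_nat d))) *
            (padic_Gamma_rat (frac (- (of_nat (i - 1) / of_nat (d - 1)) + r)) / padic_Gamma_rat (frac (- (of_nat (i - 1) / of_nat (d - 1)))))) =
     - (inverse (teich (of_nat d * l)) ^ (d * j) * ((- 1) ^ j * jacobi_sum j b))"
proof -
  let ?s = "CARD('p) - 1"
  let ?m = "d - 1"
  let ?P = "- of_nat CARD('p) :: 'p padic"
  define c where "c = ?m * j mod ?s"
  define e where "e = (\<Sum>i=1..?m. - \<lfloor>frac (of_nat i / of_nat d) - r\<rfloor> - \<lfloor>frac (- (of_nat (i - 1) / of_nat ?m)) + r\<rfloor>)"
  have nd: "\<not> CARD('p) dvd d" "\<not> CARD('p) dvd ?m" using d(2) by auto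
  have d0: "(of_nat d :: 'p mod_ring) \<noteq> 0" "(of_nat ?m :: 'p mod_ring) \<noteq> 0"
    using nd of_nat_mod_ring_eq_iff[of _ 0, where 'p='p] by (simp_all add: cong_0_iff)
  have bc: "b < ?s" "c < ?s" using j b by (auto simp: c_def)
  have P0: "?P \<noteq> 0" by simp
  have e: "(int CARD('p) - 1) * e = int j + int b + int c - (int CARD('p) - 1)"
    using sum_floor_exponents[OF d(1) j] unfolding e_def r_def b c_def of_nat_card_minus_1[where 'p='p] by simp
  have t: "inverse (to_fract (teichmuller (l ^ d * of_nat ?m ^ ?m))) ^ j = 
      inverse (teich l) ^ (d * j) * inverse (teich (of_nat ?m)) ^ (?m * j)"
    using l d0(2) by (simp add: teich_mult teich_power power_mult_distrib power_mult power_inverse flip: teich_def)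
  have tm: "inverse (teich (of_nat ?m :: 'p mod_ring)) ^ (?m * j) * teich (of_nat ?m) ^ c = 1"
  proof -
    have eq: "teich (of_nat ?m :: 'p mod_ring) ^ c = teich (of_nat ?m) ^ (?m * j)"
      by (rule teich_power_cong[OF d0(2)]) (simp add: c_def cong_def)
    show ?thesis unfolding eq power_inverse using teich_nonzero[OF d0(2)] by (intro left_inverse) simp
  qed
  have td: "teich (of_nat d) ^ b = (inverse (teich (of_nat d)) ^ (d * j) :: 'p padic)"
  proof -
    have "d * (?s - j) + d * j = d * ?s" using j by (simp flip: distrib_left)
    then have "[b + d * j = 0] (mod ?s)" unfolding b cong_def by (simp only: mod_add_left_eq) simp
    then have "teich (of_nat d :: 'p mod_ring) ^ (b + d * j) = teich (of_nat d) ^ 0" by (rule teich_power_cong[OF d0(1)])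
    then show ?thesis using teich_nonzero[OF d0(1)] by (simp add: power_inverse power_add inverse_unique mult.commute)
  qed
  have sign: "(- 1) ^ (j * ?m) * (- 1) ^ c = (1 :: 'p padic)"
  proof -
    have "even ?s" using odd_p by simp
    then have "even c = even (?m * j)" unfolding c_def by (metis dvd_mod_iff)
    then show ?thesis by (simp add: mult.commute flip: power_add)
  qed
  have "(\<Prod>i = 1..?m.
            ?P powi (- \<lfloor>frac (of_nat i / of_nat d) - r\<rfloor> - \<lfloor>frac (- (of_nat (i - 1) / of_nat ?m)) + r\<rfloor>) *
            (padic_Gamma_rat (frac (of_nat i / of_nat d - r)) / padic_Gamma_rat (frac (of_nat i / of_nat d))) *
            (padic_Gamma_rat (frac (- (of_nat (i - 1) / of_nat ?m) + r)) / padic_Gamma_rat (frac (- (of_nat (i - 1) / of_nat ?m))))) =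
      ?P powi e * (teich (of_nat d) ^ b * gamma_number b * ((- 1) ^ (j + 1) * gamma_number j)) * (teich (of_nat ?m) ^ c * gamma_number c)"
    unfolding prod.distrib prod_powi_sum[OF P0] e_def r_def
    using d(1) by (simp only: prod_Gamma_numerator[OF odd_p _ nd(1) j b] prod_Gamma_denominator[OF odd_p _ nd(2) j(2) c_def])
  also have "\<dots> = (- 1) ^ (j + 1) * teich (of_nat d) ^ b * teich (of_nat ?m) ^ c * (?P powi e * (gamma_number j * gamma_number b) * gamma_number c)"
    by (simp only: mult_ac)
  also have "\<dots> = (- 1) ^ (j + 1) * inverse (teich (of_nat d)) ^ (d * j) * teich (of_nat ?m) ^ c * ((- 1) ^ c * jacobi_sum j b)"
    by (simp only: gamma_number_jacobi[OF odd_p j bc e] td)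
  finally have prod: "(\<Prod>i = 1..?m.
            ?P powi (- \<lfloor>frac (of_nat i / of_nat d) - r\<rfloor> - \<lfloor>frac (- (of_nat (i - 1) / of_nat ?m)) + r\<rfloor>) *
            (padic_Gamma_rat (frac (of_nat i / of_nat d - r)) / padic_Gamma_rat (frac (of_nat i / of_nat d))) *
            (padic_Gamma_rat (frac (- (of_nat (i - 1) / of_nat ?m) + r)) / padic_Gamma_rat (frac (- (of_nat (i - 1) / of_nat ?m))))) =
       (- 1) ^ (j + 1) * inverse (teich (of_nat d)) ^ (d * j) * teich (of_nat ?m) ^ c * ((- 1) ^ c * jacobi_sum j b)" .
  have "l ^ d * of_nat ?m ^ ?m \<noteq> 0" using l d0 by simp
  then have inv: "teichmuller_inv_power j (l ^ d * of_nat ?m ^ ?m) = inverse (teich l) ^ (d * j) * inverse (teich (of_nat ?m)) ^ (?m * j)"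
    unfolding teichmuller_inv_power_def using t by (simp only: if_False)
  have tl: "inverse (teich (of_nat d * l)) ^ (d * j) = inverse (teich (of_nat d)) ^ (d * j) * inverse (teich l) ^ (d * j)"
    using teich_mult[OF d0(1) l] by (simp add: power_mult_distrib)
  have "(- 1) ^ (j * ?m) * (inverse (teich l) ^ (d * j) * inverse (teich (of_nat ?m)) ^ (?m * j)) *
      ((- 1) ^ (j + 1) * inverse (teich (of_nat d)) ^ (d * j) * teich (of_nat ?m) ^ c * ((- 1) ^ c * jacobi_sum j b)) =
      ((- 1) ^ (j * ?m) * (- 1) ^ c) * (inverse (teich (of_nat ?m)) ^ (?m * j) * teich (of_nat ?m) ^ c) *
      ((inverse (teich (of_nat d)) ^ (d * j) * inverse (teich l) ^ (d * j)) * ((- 1) ^ (j + 1) * jacobi_sum j b))"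
    by (simp only: mult_ac)
  then show ?thesis unfolding prod inv tl sign tm by simp
qed

lemma mccarthy_summand_0:
  fixes t :: "'p::prime_card mod_ring"
  assumes odd_p: "odd CARD('p)" and d: "d \<ge> 2" and t: "t \<noteq> 0"
  shows "teichmuller_inv_power 0 t *
         (\<Prod>i = 1..d - 1.
            (- of_nat CARD('p)) powi (- \<lfloor>frac (of_nat i / of_nat d) :: rat\<rfloor> - \<lfloor>frac (- (of_nat (i - 1) / of_nat (d - 1))) :: rat\<rfloor>) *
            (padic_Gamma_rat (frac (of_nat i / of_nat d)) / padic_Gamma_rat (frac (of_nat i / of_nat d))) *
            (padic_Gamma_rat (frac (- (of_nat (i - 1) / of_nat (d - 1)))) / padic_Gamma_rat (frac (- (of_nat (i - 1) / of_nat (d - 1)))))) =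
     (1 :: 'p padic)"
proof -
  have "\<lfloor>frac q\<rfloor> = 0" for q :: rat using frac_lt_1[of q] frac_ge_0[of q] by (simp add: floor_unique)
  then show ?thesis using t by (simp add: teichmuller_inv_power_def padic_Gamma_rat_nonzero[OF odd_p])
qed

theorem theorem1p1:
  fixes d :: nat and l :: "'p::prime_card mod_ring"
  assumes "d \<ge> 2"
    and "odd CARD('p)"
    and "\<not> CARD('p) dvd d * (d - 1)"
    and "l \<noteq> 0"
  shows "of_nat (card (Z_points d l)) =
    (1 + mccarthy_G (d - 1)
           (\<lambda>i. of_nat i / of_nat d) (\<lambda>i. of_nat (i - 1) / of_nat (d - 1))
           (l ^ d * of_nat (d - 1) ^ (d - 1)) :: 'p padic)"
proof -
  let ?s = "CARD('p) - 1"
  let ?t = "l ^ d * of_nat (d - 1) ^ (d - 1)"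
  let ?G = "mccarthy_G (d - 1) (\<lambda>i. of_nat i / of_nat d) (\<lambda>i. of_nat (i - 1) / of_nat (d - 1)) ?t :: 'p padic"
  define S :: "'p padic" where "S = of_nat ?s"
  define b where "b = (\<lambda>j. d * (?s - j) mod ?s)"
  define f where "f = (\<lambda>j. inverse (teich (of_nat d * l)) ^ (d * j) * ((- 1) ^ j * jacobi_sum j (b j)))"
  define T where "T = (\<lambda>j. (- 1) ^ (j * (d - 1)) * teichmuller_inv_power j ?t *
    (\<Prod>i = 1..d - 1.
      (- of_nat CARD('p)) powi (- \<lfloor>frac (of_nat i / of_nat d) - of_nat j / (of_nat CARD('p) - 1) :: rat\<rfloor> -
          \<lfloor>frac (- (of_nat (i - 1) / of_nat (d - 1))) + of_nat j / (of_nat CARD('p) - 1) :: rat\<rfloor>) *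
      (padic_Gamma_rat (frac (of_nat i / of_nat d - of_nat j / (of_nat CARD('p) - 1))) / padic_Gamma_rat (frac (of_nat i / of_nat d))) *
      (padic_Gamma_rat (frac (- (of_nat (i - 1) / of_nat (d - 1)) + of_nat j / (of_nat CARD('p) - 1))) /
        padic_Gamma_rat (frac (- (of_nat (i - 1) / of_nat (d - 1)))))) :: 'p padic)"
  have p3: "CARD('p) \<ge> 3" by (rule p_ge_3[OF assms(2)])
  have "\<not> CARD('p) dvd d" "\<not> CARD('p) dvd d - 1" using assms(3) by auto
  then have "(of_nat d :: 'p mod_ring) \<noteq> 0" "(of_nat (d - 1) :: 'p mod_ring) \<noteq> 0"
    using of_nat_mod_ring_eq_iff[of _ 0, where 'p='p] by (simp_all add: cong_0_iff)
  then have dl: "of_nat d * l \<noteq> 0" and t: "?t \<noteq> 0" using assms(4) by simp_all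
  have S: "S \<noteq> 0" using p3 by (simp add: S_def)
  have ivl: "{..<?s} = insert 0 {1..<?s}" "{0..CARD('p) - 2} = insert 0 {1..<?s}" using p3 by auto
  have f: "inverse (teich (of_nat d * l)) ^ (d * j) *
      (\<Sum>y\<in>UNIV - {0, - 1}. inverse (teich y) ^ j * teich (1 + y) ^ (d * j)) = f j" if j: "j \<in> {1..<?s}" for j
  proof -
    have "?s - j + j = ?s" using j by (intro le_add_diff_inverse2) simp
    then have "d * (?s - j) + d * j = d * ?s" by (simp only: distrib_left[symmetric])
    then have "[b j + d * j = 0] (mod ?s)" unfolding b_def cong_def by (simp only: mod_add_left_eq) simp
    moreover have "b j < ?s" unfolding b_def using p3 by (intro mod_less_divisor) simp
    ultimately show ?thesis unfolding f_def using sum_jacobi[OF assms(2), of j "b j" d] j by simp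
  qed
  have "card (UNIV - {0, - 1 :: 'p mod_ring}) = CARD('p) - 2"
    using p3 by (subst card_Diff_subset) (simp_all add: CARD_mod_ring)
  then have f0: "(\<Sum>y\<in>UNIV - {0, - 1 :: 'p mod_ring}. 1) = S - 1"
    using p3 by (simp add: S_def of_nat_diff)
  \<comment> \<open>The trivial character contributes p - 2 = S - 1 to the count, but
    \<open>T 0\<close> = 1 to the series; reading S - 1 as S - \<open>T 0\<close> yields the summand
    1 of the formula.\<close>
  have "S * of_nat (card (Z_points d l)) = (S - 1) + (\<Sum>j\<in>{1..<?s}. f j)"
    unfolding S_def card_Z_points_fourier[OF assms(1) dl] ivl
    using f f0 by (simp add: S_def)
  moreover have "f j = - T j" if "j \<in> {1..<?s}" for j
  proof -
    have "T j = - f j"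
      unfolding T_def f_def by (rule mccarthy_summand[OF assms(2,1,3,4)]) (use that in \<open>simp_all add: b_def\<close>)
    then show ?thesis by simp
  qed
  ultimately have "S * of_nat (card (Z_points d l)) = S - 1 - (\<Sum>j\<in>{1..<?s}. T j)" by (simp add: sum_negf)
  moreover have "T 0 = 1" unfolding T_def using mccarthy_summand_0[OF assms(2,1) t] by simp
  then have "(\<Sum>j = 0..CARD('p) - 2. T j) = 1 + (\<Sum>j\<in>{1..<?s}. T j)" unfolding ivl by simp
  moreover have "?G = (- 1) / S * (\<Sum>j = 0..CARD('p) - 2. T j)"
    unfolding mccarthy_G_def Let_def T_def S_def of_nat_card_minus_1 ..
  then have "S * ?G = - (\<Sum>j = 0..CARD('p) - 2. T j)" using S by simp
  ultimately have "S * of_nat (card (Z_points d l)) = S * (1 + ?G)" by (simp add: distrib_left)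
  then show ?thesis using S by (simp only: mult_cancel_left simp_thms)
qed

end
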